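(* Let $K$ be an algebraically closed field of arbitrary characteristic. Let $\widetilde{X} \subset \mathbb{P}^{r+1}_K$ be a smooth rational normal scroll of codimension at least $2$, with rulings $\mathbb{L}(x)$, $x\in\mathbb{P}^1_K$, and let $p \in \mathrm{Sec}(\widetilde{X}) \setminus \widetilde{X}$ be a closed point. Then one of the following holds: (a) $\mathrm{Sec}_p(\widetilde{X}) = \mathbb{P}^1_K$ (a line in $\mathbb{P}^{r+1}_K$) and $\Sigma_p(\widetilde{X}) \subset \mathbb{P}^1_K$ is either a double point or the union of two simple points. (b) $\mathrm{Sec}_p(\widetilde{X}) = \mathbb{P}^2_K$ (a plane in $\mathbb{P}^{r+1}_K$) and $\Sigma_p(\widetilde{X}) \subset \mathbb{P}^2_K$ is either a smooth conic or the union of a line $L$ which is contained in a ruling $\mathbb{L}(x) \subset \widetilde{X}$ and a line section $L'$ of $\widetilde{X}$. (c) $\mathrm{Sec}_p(\widetilde{X}) = \mathbb{P}^3_K$ (a $3$-dimensional linear subspace of $\mathbb{P}^{r+1}_K$) and $\Sigma_p(\widetilde{X}) \subset \mathbb{P}^3_K$ is a smooth quadric surface.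
   Context: Smooth rational normal scroll: given integers $1\le a_1\le\dots\le a_n$ ($n\ge 1$), choose complementary linear subspaces $\Lambda_i\cong\mathbb{P}^{a_i}_K$ ($1\le i\le n$) spanning $\mathbb{P}^{r+1}_K$, where $r+1=a_1+\dots+a_n+n-1$, and embeddings $\phi_i:\mathbb{P}^1_K\to\Lambda_i$ as rational normal curves of degree $a_i$. Then $S(a_1,\dots,a_n)=\bigcup_{x\in\mathbb{P}^1_K}\langle\phi_1(x),\dots,\phi_n(x)\rangle\subset\mathbb{P}^{r+1}_K$ is a smooth $n$-dimensional non-degenerate variety, the smooth rational normal scroll of type $(a_1,\dots,a_n)$. Here $\langle\cdot\rangle$ denotes linear span. There is a projection morphism $\varphi:\widetilde{X}\to\mathbb{P}^1_K$ whose fiber over $x$ is the ruling $\mathbb{L}(x)=\langle\phi_1(x),\dots,\phi_n(x)\rangle$, a linear space of dimension $n-1$. A line section of $\widetilde{X}$ is a line $L'\subset\widetilde{X}$ mapped isomorphically onto $\mathbb{P}^1_K$ by $\varphi$. $\mathrm{Sec}(\widetilde{X})$ is the secant variety, i.e. the closure of the union of chords joining pairs of distinct points of $\widetilde{X}$. For a closed point $p\in\mathbb{P}^{r+1}_K\setminus\widetilde{X}$, the secant cone is $\mathrm{Sec}_p(\widetilde{X})=\bigcup_{q\in\widetilde{X},\ \mathrm{length}(\widetilde{X}\cap\langle p,q\rangle)\ge 2}\langle p,q\rangle$, with the convention $\mathrm{Sec}_p(\widetilde{X})=\{p\}$ if there is no such $q$. The secant locus $\Sigma_p(\widetilde{X})$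 is the scheme-theoretic intersection of $\widetilde{X}$ and $\mathrm{Sec}_p(\widetilde{X})$. *)

theory Defs
  imports
    "HOL-Analysis.Analysis"
    "HOL-Library.Poly_Mapping"
    "HOL-Computational_Algebra.Computational_Algebra"
begin

text \<open>
  Conventions.  The coordinates of the projective space over \<open>'k\<close> are indexed by a finite
  type \<open>'v\<close>, so the ambient space is \<open>\<P>\<close> of \<open>'k ^ 'v\<close>, of dimension \<open>CARD('v) - 1\<close>.
  A set of closed points is represented by its affine cone in \<open>'k ^ 'v\<close> (with \<open>0\<close>): the point
  of a vector \<open>u \<noteq> 0\<close> is \<open>vec.span {u}\<close>, a \<open>d\<close>-dimensional linear subspace is a vector subspace
  of dimension \<open>d + 1\<close>.  A closed subscheme is given by a homogeneous ideal of the
  coordinate ring; two homogeneous ideals give the same subscheme iff they have the same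
  saturation.  A variety (reduced closed subset) has its full vanishing ideal.
\<close>


section \<open>The homogeneous coordinate ring\<close>

type_synonym ('v, 'k) mpol = "('v \<Rightarrow>\<^sub>0 nat) \<Rightarrow>\<^sub>0 'k"

interpretation ideal: module "(*) :: 'r::comm_ring_1 \<Rightarrow> 'r \<Rightarrow> 'r"
  by unfold_locales (simp_all add: algebra_simps)

definition monom_deg :: "('v::finite \<Rightarrow>\<^sub>0 nat) \<Rightarrow> nat" where
  "monom_deg m = (\<Sum>i\<in>UNIV. Poly_Mapping.lookup m i)"

definition homogeneous :: "nat \<Rightarrow> ('v::finite, 'k::zero) mpol \<Rightarrow> bool" where
  "homogeneous d f \<longleftrightarrow> (\<forall>m\<in>Poly_Mapping.keys f. monom_deg m = d)"

definition eval :: "('v::finite, 'k::comm_semiring_1) mpol \<Rightarrow> 'k ^ 'v \<Rightarrow> 'k" where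
  "eval f u = (\<Sum>m\<in>Poly_Mapping.keys f.
     Poly_Mapping.lookup f m * (\<Prod>i\<in>UNIV. (u $ i) ^ Poly_Mapping.lookup m i))"

definition partial_deriv ::
    "'v \<Rightarrow> ('v::finite, 'k::comm_semiring_1) mpol \<Rightarrow> ('v, 'k) mpol" where
  "partial_deriv i f = (\<Sum>m\<in>Poly_Mapping.keys f.
     Poly_Mapping.single (m - Poly_Mapping.single i 1)
       (of_nat (Poly_Mapping.lookup m i) * Poly_Mapping.lookup f m))"


section \<open>Closed subsets and closed subschemes\<close>

definition zero_set :: "('v::finite, 'k::field) mpol set \<Rightarrow> ('k ^ 'v) set" where
  "zero_set I = {u. \<forall>f\<in>I. eval f u = 0}"

text \<open>For an affine cone over an infinite field this ideal is automatically homogeneous.\<close>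

definition vanishing_ideal :: "('k::field ^ 'v::finite) set \<Rightarrow> ('v, 'k) mpol set" where
  "vanishing_ideal A = {f. \<forall>u\<in>A. eval f u = 0}"

definition zariski_closure :: "('k::field ^ 'v::finite) set \<Rightarrow> ('k ^ 'v) set" where
  "zariski_closure A = zero_set (vanishing_ideal A)"

definition saturation :: "('v::finite, 'k::field) mpol set \<Rightarrow> ('v, 'k) mpol set" where
  "saturation I = {f. \<exists>k. \<forall>m. monom_deg m = k \<longrightarrow> Poly_Mapping.single m 1 * f \<in> I}"

text \<open>
  The scheme-theoretic intersection is defined by the sum of the two ideals, represented
  by its saturation.
\<close>

definition scheme_inter ::
    "('v::finite, 'k::field) mpol set \<Rightarrow> ('v, 'k) mpol set \<Rightarrow> ('v, 'k) mpol set" where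
  "scheme_inter I J = saturation (ideal.span (I \<union> J))"

definition linear_subspace :: "nat \<Rightarrow> ('k::field ^ 'v::finite) set \<Rightarrow> bool" where
  "linear_subspace d W \<longleftrightarrow> vec.subspace W \<and> vec.dim W = d + 1"

text \<open>The \<open>'k\<close>-dimension of the quotient of the polynomial ring by the ideal \<open>J\<close>.\<close>

definition quotient_dim :: "('v::finite, 'k::field) mpol set \<Rightarrow> enat" where
  "quotient_dim J = (SUP B \<in> {B. finite B \<and>
     (\<forall>c. (\<Sum>b\<in>B. Poly_Mapping.single 0 (c b) * b) \<in> J \<longrightarrow> (\<forall>b\<in>B. c b = 0))}. enat (card B))"

text \<open>
  If the linear form \<open>l\<close> has no zero on the subscheme \<open>Z\<close> of the homogeneous ideal \<open>I\<close>, then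
  \<open>Z\<close> lies in the affine chart \<open>l \<noteq> 0\<close>, hence is affine with coordinate ring
  \<open>'k[x] / (I + (l - 1))\<close>, whose dimension does not depend on \<open>l\<close>.  There is such an \<open>l\<close> iff
  \<open>Z\<close> is finite (\<open>'k\<close> being infinite); otherwise the infimum over the empty set makes the
  length infinite.
\<close>

definition scheme_length :: "('v::finite, 'k::field) mpol set \<Rightarrow> enat" where
  "scheme_length I =
     (INF l \<in> {l. homogeneous 1 l \<and> (\<forall>u\<in>zero_set I. u \<noteq> 0 \<longrightarrow> eval l u \<noteq> 0)}.
        quotient_dim (ideal.span (insert (l - 1) I)))"

text \<open>The affine cone over the embedded projective tangent space at the point of \<open>u\<close>.\<close>

definition tangent_space ::
    "('v::finite, 'k::field) mpol set \<Rightarrow> 'k ^ 'v \<Rightarrow> ('k ^ 'v) set" where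
  "tangent_space I u = {w. \<forall>f\<in>I. (\<Sum>i\<in>UNIV. w $ i * eval (partial_deriv i f) u) = 0}"

text \<open>
  Smooth quadric hypersurfaces in the linear space of \<open>W\<close>, by the Jacobian criterion: the
  cone over such a hypersurface has dimension \<open>vec.dim W - 1\<close>.
\<close>

definition smooth_quadric_in ::
    "('k::field ^ 'v::finite) set \<Rightarrow> ('v, 'k) mpol set \<Rightarrow> bool" where
  "smooth_quadric_in W Z \<longleftrightarrow>
     (\<exists>F. homogeneous 2 F \<and> F \<notin> vanishing_ideal W \<and>
          Z = saturation (ideal.span (insert F (vanishing_ideal W)))) \<and>
     (\<forall>u\<in>zero_set Z. u \<noteq> 0 \<longrightarrow> vec.dim (tangent_space Z u) = vec.dim W - 1)"

definition double_point :: "('v::finite, 'k::field) mpol set \<Rightarrow> bool" where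
  "double_point Z \<longleftrightarrow> (\<exists>z. z \<noteq> 0 \<and> zero_set Z = vec.span {z}) \<and> scheme_length Z = 2"

definition two_simple_points :: "('v::finite, 'k::field) mpol set \<Rightarrow> bool" where
  "two_simple_points Z \<longleftrightarrow>
     (\<exists>y z. y \<noteq> 0 \<and> z \<noteq> 0 \<and> vec.span {y} \<noteq> vec.span {z} \<and>
        Z = vanishing_ideal (vec.span {y}) \<inter> vanishing_ideal (vec.span {z}))"


section \<open>Rational normal scrolls\<close>

text \<open>
  Points of \<open>\<P>\<^sup>1\<close> are given by pairs \<open>x \<noteq> (0, 0)\<close>; \<open>P1_map d c\<close> is the general tuple of binary
  forms of degree \<open>d\<close>, and it is a morphism if the forms have no common zero.
\<close>

definition P1_map :: "nat \<Rightarrow> (nat \<Rightarrow> 'k::field ^ 'v::finite) \<Rightarrow> 'k \<times> 'k \<Rightarrow> 'k ^ 'v" where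
  "P1_map d c x = (\<Sum>j\<le>d. (fst x ^ (d - j) * snd x ^ j) *s c j)"

definition P1_morphism :: "('k::field \<times> 'k \<Rightarrow> 'k ^ 'v::finite) \<Rightarrow> bool" where
  "P1_morphism \<sigma> \<longleftrightarrow> (\<exists>d c. \<sigma> = P1_map d c) \<and> (\<forall>x. x \<noteq> (0, 0) \<longrightarrow> \<sigma> x \<noteq> 0)"

definition rational_normal_curve ::
    "('k::field ^ 'v::finite) set \<Rightarrow> nat \<Rightarrow> ('k \<times> 'k \<Rightarrow> 'k ^ 'v) \<Rightarrow> bool" where
  "rational_normal_curve \<Lambda> d \<phi> \<longleftrightarrow>
     (\<exists>c. \<phi> = P1_map d c \<and> inj_on c {..d} \<and> vec.independent (c ` {..d}) \<and>
          vec.span (c ` {..d}) = \<Lambda>)"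

text \<open>The list \<open>a\<close> is \<open>(a\<^sub>1, \<dots>, a\<^sub>n)\<close>; the spaces \<open>\<Lambda> i\<close> and curves \<open>\<phi> i\<close> are indexed from \<open>0\<close>.\<close>

definition scroll_data ::
    "nat list \<Rightarrow> (nat \<Rightarrow> ('k::field ^ 'v::finite) set) \<Rightarrow> (nat \<Rightarrow> 'k \<times> 'k \<Rightarrow> 'k ^ 'v) \<Rightarrow> bool" where
  "scroll_data a \<Lambda> \<phi> \<longleftrightarrow>
     a \<noteq> [] \<and> sorted a \<and> (\<forall>i<length a. 1 \<le> a ! i) \<and>
     CARD('v) = sum_list a + length a \<and>
     (\<forall>i<length a. linear_subspace (a ! i) (\<Lambda> i)) \<and>
     (\<forall>i<length a. \<Lambda> i \<inter> vec.span (\<Union>j\<in>{..<length a} - {i}. \<Lambda> j) = {0}) \<and>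
     vec.span (\<Union>i<length a. \<Lambda> i) = UNIV \<and>
     (\<forall>i<length a. rational_normal_curve (\<Lambda> i) (a ! i) (\<phi> i))"

definition ruling ::
    "nat \<Rightarrow> (nat \<Rightarrow> 'k::field \<times> 'k \<Rightarrow> 'k ^ 'v::finite) \<Rightarrow> 'k \<times> 'k \<Rightarrow> ('k ^ 'v) set" where
  "ruling n \<phi> x = vec.span ((\<lambda>i. \<phi> i x) ` {..<n})"

definition scroll ::
    "nat \<Rightarrow> (nat \<Rightarrow> 'k::field \<times> 'k \<Rightarrow> 'k ^ 'v::finite) \<Rightarrow> ('k ^ 'v) set" where
  "scroll n \<phi> = (\<Union>x\<in>{x. x \<noteq> (0, 0)}. ruling n \<phi> x)"

text \<open>
  The projection of the scroll to \<open>\<P>\<^sup>1\<close> restricts to an isomorphism on the line of \<open>L\<close> iff this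
  restriction has an inverse morphism \<open>\<sigma>\<close>: \<open>\<sigma>\<close> maps \<open>x\<close> to a point of the line in the fibre
  over \<open>x\<close>, and every point of the line is reached.
\<close>

definition line_section ::
    "nat \<Rightarrow> (nat \<Rightarrow> 'k::field \<times> 'k \<Rightarrow> 'k ^ 'v::finite) \<Rightarrow> ('k ^ 'v) set \<Rightarrow> bool" where
  "line_section n \<phi> L \<longleftrightarrow> linear_subspace 1 L \<and> L \<subseteq> scroll n \<phi> \<and>
     (\<exists>\<sigma>. P1_morphism \<sigma> \<and>
        (\<forall>x. x \<noteq> (0, 0) \<longrightarrow> \<sigma> x \<in> L \<inter> ruling n \<phi> x) \<and>
        (\<forall>u\<in>L. \<exists>x. x \<noteq> (0, 0) \<and> u \<in> vec.span {\<sigma> x}))"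


section \<open>Secant varieties, secant cones and secant loci\<close>

definition secant_variety :: "('k::field ^ 'v::finite) set \<Rightarrow> ('k ^ 'v) set" where
  "secant_variety X = zariski_closure
     (\<Union>{vec.span {u, v} | u v. u \<in> X \<and> v \<in> X \<and> u \<noteq> 0 \<and> v \<noteq> 0 \<and> vec.span {u} \<noteq> vec.span {v}})"

definition secant_cone :: "('k::field ^ 'v::finite) set \<Rightarrow> 'k ^ 'v \<Rightarrow> ('k ^ 'v) set" where
  "secant_cone X p =
     (let Q = {q \<in> X. q \<noteq> 0 \<and>
                2 \<le> scheme_length (scheme_inter (vanishing_ideal X) (vanishing_ideal (vec.span {p, q})))}
      in if Q = {} then vec.span {p} else (\<Union>q\<in>Q. vec.span {p, q}))"

definition secant_locus :: "('k::field ^ 'v::finite) set \<Rightarrow> 'k ^ 'v \<Rightarrow> ('v, 'k) mpol set" where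
  "secant_locus X p = scheme_inter (vanishing_ideal X) (vanishing_ideal (secant_cone X p))"

end

theory Submission
  imports Defs
begin

text \<open>
  The classification reduces to linear algebra of \<open>2 \<times> 2\<close> matrices.

  A rational normal scroll \<open>X\<close> is the degeneracy locus of a pencil of linear maps: if \<open>A\<close> and \<open>B\<close>
  drop the last, respectively the first, coefficient of the coordinates along each curve, then the
  ruling over \<open>(s, t)\<close> is the kernel of \<open>t A - s B\<close> (\<open>scroll_pencil_exists\<close>).  So \<open>u\<close> lies on \<open>X\<close> iff
  \<open>A u\<close> and \<open>B u\<close> are linearly dependent, and the \<open>2 \<times> 2\<close> minors of the pair \<open>A u, B u\<close> are quadrics
  through \<open>X\<close>.

  Let \<open>p\<close> be a point outside \<open>X\<close>.  Then \<open>A p\<close> and \<open>B p\<close> span a plane \<open>P\<close>.  Let \<open>U\<close> be the space of all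
  \<open>u\<close> with both \<open>A u\<close> and \<open>B u\<close> in \<open>P\<close>; it contains \<open>p\<close>.  Restricting the quadrics through \<open>X\<close> to a line
  through \<open>p\<close> and a point \<open>q\<close> of \<open>X\<close> shows that the line meets \<open>X\<close> in length at least 2 iff \<open>q\<close> lies
  in \<open>U\<close> (\<open>line_length_ge_2\<close>, \<open>line_length_le_1\<close>).  Hence the secant locus is supported on the
  intersection of \<open>X\<close> and \<open>U\<close>, and if \<open>U\<close> is more than the point \<open>p\<close>, the secant cone is \<open>U\<close>
  (\<open>secant_cone_eq_U\<close>).  For a point \<open>p\<close> on a chord the two end points of the chord lie in \<open>U\<close>.
  That the dimension of \<open>U\<close> jumps is a determinantal, thus closed condition, so \<open>U\<close> is more than \<open>p\<close> for
  every \<open>p\<close> in the secant variety (\<open>secant_point_U\<close>).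

  Writing \<open>A u\<close> and \<open>B u\<close> in the basis \<open>A p, B p\<close> of \<open>P\<close> embeds \<open>U\<close> into the space of \<open>2 \<times> 2\<close> matrices
  such that \<open>p\<close> becomes the identity and \<open>X\<close> becomes the quadric \<open>det = 0\<close>.  So \<open>U\<close> has dimension
  2, 3 or 4, and the secant locus is a section of this quadric surface: all of it, a plane section, which is
  a smooth conic or a pair of lines of different families, or a line section, which is a pair of points or a
  double point.

  For the scheme structure, let \<open>F\<close> be a quadric through \<open>X\<close> that restricts to \<open>det\<close> on \<open>U\<close>.  In the
  reduced cases it suffices that a form \<open>f\<close> vanishing on the locus lies in the saturation of the ideal of
  \<open>F\<close> and the linear forms vanishing on \<open>U\<close>.  For the pair of lines this is a division of \<open>f\<close> by two linear forms.
  Otherwise, projection from a point \<open>e\<close> of the quadric maps \<open>u\<close> to the second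
  intersection point with the line through \<open>e\<close>; as \<open>f\<close> vanishes there, a power of the polar
  linear form of \<open>e\<close> multiplies \<open>f\<close> into the ideal (\<open>polar_form_in_radical_colon\<close>), and on the locus the polar forms
  have no common zero.  The double point has only its length to be computed, and there
  explicit curves on \<open>X\<close> show that \<open>X\<close> is tangent to the line (\<open>tangent_to_X\<close>).
  All this is independent of the characteristic.
\<close>

(* The symbol $ stands for vector components only. *)
no_notation fps_nth (infixl "$" 75)

(* Used as a rewrite rule, this form of associativity undoes the sorting of products by algebra_simps. *)
lemmas [simp del] = ideal.scale_scale

section \<open>Evaluation of polynomials\<close>

lemma lookup_sum_single:
  "(\<Sum>m\<in>Poly_Mapping.keys f. Poly_Mapping.single m (Poly_Mapping.lookup f m)) = f"
proof (rule poly_mapping_eqI)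
  fix k
  have "Poly_Mapping.lookup (\<Sum>m\<in>Poly_Mapping.keys f. Poly_Mapping.single m (Poly_Mapping.lookup f m)) k
     = (\<Sum>m\<in>Poly_Mapping.keys f. if m = k then Poly_Mapping.lookup f m else 0)"
    by (simp add: lookup_sum lookup_single when_def)
  also have "\<dots> = Poly_Mapping.lookup f k"
    by (simp add: in_keys_iff)
  finally show "Poly_Mapping.lookup (\<Sum>m\<in>Poly_Mapping.keys f.
      Poly_Mapping.single m (Poly_Mapping.lookup f m)) k = Poly_Mapping.lookup f k" .
qed

lemma eval_superset:
  assumes "finite S" "Poly_Mapping.keys f \<subseteq> S"
  shows "eval f u = (\<Sum>m\<in>S. Poly_Mapping.lookup f m * (\<Prod>i\<in>UNIV. (u $ i) ^ Poly_Mapping.lookup m i))"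
  unfolding eval_def using assms
  by (intro sum.mono_neutral_left) (auto simp: in_keys_iff)

lemma eval_add: "eval (f + g) u = eval f u + eval g u"
proof -
  let ?S = "Poly_Mapping.keys f \<union> Poly_Mapping.keys g"
  have "Poly_Mapping.keys (f + g) \<subseteq> ?S" by (rule keys_add)
  then have "eval (f + g) u = (\<Sum>m\<in>?S. Poly_Mapping.lookup (f + g) m * (\<Prod>i\<in>UNIV. (u $ i) ^ Poly_Mapping.lookup m i))"
    by (intro eval_superset) auto
  also have "\<dots> = eval f u + eval g u"
    by (subst (1 2) eval_superset[of ?S]) (auto simp: lookup_add sum.distrib algebra_simps)
  finally show ?thesis .
qed

lemma eval_zero: "eval 0 u = 0"
  by (simp add: eval_def)

lemma eval_sum: "eval (sum g S) u = (\<Sum>x\<in>S. eval (g x) u)"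
  by (induction S rule: infinite_finite_induct) (simp_all add: eval_zero eval_add)

lemma eval_single: "eval (Poly_Mapping.single m c) u = c * (\<Prod>i\<in>UNIV. (u $ i) ^ Poly_Mapping.lookup m i)"
  by (subst eval_superset[of "{m}"]) auto

lemma eval_mult: "eval (f * g) u = eval f u * eval g u"
proof -
  have "f * g = (\<Sum>m\<in>Poly_Mapping.keys f. \<Sum>k\<in>Poly_Mapping.keys g.
      Poly_Mapping.single (m + k) (Poly_Mapping.lookup f m * Poly_Mapping.lookup g k))"
    using arg_cong2[OF lookup_sum_single[of f] lookup_sum_single[of g], of "(*)"]
    by (simp only: sum_product mult_single)
  then have "eval (f * g) u = (\<Sum>m\<in>Poly_Mapping.keys f. \<Sum>k\<in>Poly_Mapping.keys g.
      eval (Poly_Mapping.single m (Poly_Mapping.lookup f m)) u *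
      eval (Poly_Mapping.single k (Poly_Mapping.lookup g k)) u)"
    by (simp add: eval_sum eval_single lookup_add power_add prod.distrib algebra_simps)
  also have "\<dots> = eval f u * eval g u"
    using arg_cong[OF lookup_sum_single[of f], of "\<lambda>f. eval f u"]
      arg_cong[OF lookup_sum_single[of g], of "\<lambda>f. eval f u"]
    by (simp only: eval_sum sum_product[symmetric])
  finally show ?thesis .
qed

lemma eval_const: "eval (Poly_Mapping.single 0 c) u = c"
  by (simp add: eval_single)

lemma eval_one: "eval 1 u = 1"
  using eval_const[of 1 u] by simp

lemma eval_uminus: "eval (- f) u = - eval f (u :: 'k::comm_ring_1 ^ 'v::finite)"
  using eval_add[of f "- f" u] by (simp add: eval_zero eq_neg_iff_add_eq_0 add.commute)

lemma eval_diff: "eval (f - g) u = eval f u - eval g (u :: 'k::comm_ring_1 ^ 'v::finite)"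
  using eval_add[of f "- g" u] by (simp add: eval_uminus)

lemma eval_power: "eval (f ^ n) u = eval f u ^ n"
  by (induction n) (simp_all add: eval_one eval_mult)

lemmas eval_simps = eval_add eval_zero eval_sum eval_mult eval_const eval_one eval_uminus
  eval_diff eval_power

definition dot :: "'k::comm_semiring_1 ^ 'v::finite \<Rightarrow> 'k ^ 'v \<Rightarrow> 'k" where
  "dot c u = (\<Sum>i\<in>UNIV. c $ i * u $ i)"

lemma dot_add: "dot c (u + v) = dot c u + dot c v"
  by (simp add: dot_def sum.distrib algebra_simps)

lemma dot_scale: "dot c (k *s u) = k * dot c u"
  by (simp add: dot_def sum_distrib_left algebra_simps)

lemma dot_zero [simp]: "dot c 0 = 0" "dot 0 c = 0"
  by (simp_all add: dot_def)

lemma dot_diff: "dot c (u - v) = dot c u - dot c (v :: 'k::comm_ring_1 ^ 'v::finite)"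
  by (simp add: dot_def sum_subtractf algebra_simps)

lemma dot_sum: "dot c (sum g S) = (\<Sum>x\<in>S. dot c (g x))"
  by (induction S rule: infinite_finite_induct) (simp_all add: dot_add)

lemmas dot_simps = dot_add dot_scale dot_diff dot_sum

lemma dot_commute: "dot c u = dot u c"
  by (simp add: dot_def mult.commute)

lemma dot_axis: "dot (axis i 1) u = u $ i"
  by (simp add: dot_def axis_def if_distrib[of "\<lambda>x. x * _"] cong: if_cong)

definition lin_form :: "'k::comm_semiring_1 ^ 'v::finite \<Rightarrow> ('v, 'k) mpol" where
  "lin_form c = (\<Sum>i\<in>UNIV. Poly_Mapping.single (Poly_Mapping.single i 1) (c $ i))"

lemma prod_power_single:
  "(\<Prod>j\<in>UNIV. (u $ j) ^ Poly_Mapping.lookup (Poly_Mapping.single i (1::nat)) j)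
     = (u :: 'k::comm_semiring_1 ^ 'v::finite) $ i"
proof -
  have "(\<Prod>j\<in>UNIV. (u $ j) ^ Poly_Mapping.lookup (Poly_Mapping.single i (1::nat)) j)
      = (\<Prod>j\<in>UNIV. if j = i then u $ j else 1)"
    by (intro prod.cong) (auto simp: lookup_single when_def)
  then show ?thesis by simp
qed

lemma eval_lin_form: "eval (lin_form c) u = dot c u"
  by (simp add: lin_form_def eval_sum eval_single prod_power_single dot_def del: One_nat_def)

lemma homogeneous_lin_form:
  "homogeneous 1 (lin_form (c :: 'k::comm_semiring_1 ^ 'v::finite))"
proof -
  have "monom_deg (Poly_Mapping.single i (1::nat)) = 1" for i :: 'v
    by (simp add: monom_deg_def lookup_single when_def)
  moreover have "\<exists>i. m = Poly_Mapping.single i 1" if "m \<in> Poly_Mapping.keys (lin_form c)" for m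
  proof -
    have "m \<in> (\<Union>i\<in>UNIV. Poly_Mapping.keys (Poly_Mapping.single (Poly_Mapping.single i (1::nat)) (c $ i)))"
      by (rule subsetD[OF keys_sum that[unfolded lin_form_def]])
    then show ?thesis by (auto split: if_splits)
  qed
  ultimately show ?thesis unfolding homogeneous_def by metis
qed

lemma monom_deg_add: "monom_deg (m + k) = monom_deg m + monom_deg k"
  by (simp add: monom_deg_def lookup_add sum.distrib)

lemma homogeneous_mult:
  "homogeneous d f \<Longrightarrow> homogeneous e g \<Longrightarrow> homogeneous (d + e) (f * g)"
  using keys_mult[of f g] by (force simp: homogeneous_def monom_deg_add)

lemma homogeneous_diff:
  "homogeneous d f \<Longrightarrow> homogeneous d (g :: ('v::finite, 'k::ab_group_add) mpol) \<Longrightarrow> homogeneous d (f - g)"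
  unfolding homogeneous_def by (metis diff_zero in_keys_iff lookup_minus)

lemma monom_deg_1:
  assumes "monom_deg m = 1"
  obtains i where "m = Poly_Mapping.single i 1"
proof -
  from assms obtain i where "Poly_Mapping.lookup m i = 1" "\<forall>j. j \<noteq> i \<longrightarrow> Poly_Mapping.lookup m j = 0"
    using sum_eq_1_iff[of UNIV "Poly_Mapping.lookup m"] by (auto simp: monom_deg_def)
  then have "m = Poly_Mapping.single i 1"
    by (intro poly_mapping_eqI) (auto simp: lookup_single when_def)
  then show thesis by (rule that)
qed

text \<open>
  The chart forms \<open>l\<close> in the definition of the length are arbitrary polynomials of degree 1; this turns them
  into coefficient vectors.
\<close>

lemma homogeneous_1_eval:
  fixes l :: "('v::finite, 'k::comm_ring_1) mpol"
  assumes "homogeneous 1 l"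
  obtains c where "\<And>u. eval l u = dot c u"
proof -
  have "\<exists>i. m = Poly_Mapping.single i 1" if "m \<in> Poly_Mapping.keys l" for m
  proof -
    have "monom_deg m = 1" using assms that by (simp add: homogeneous_def)
    then show ?thesis by (rule monom_deg_1) (rule exI)
  qed
  then obtain i where i: "\<And>m. m \<in> Poly_Mapping.keys l \<Longrightarrow> m = Poly_Mapping.single (i m) 1"
    by metis
  define c :: "'k ^ 'v" where
    "c = (\<Sum>m\<in>Poly_Mapping.keys l. Poly_Mapping.lookup l m *s axis (i m) 1)"
  have "eval l u = dot c u" for u
  proof -
    have "eval l u = (\<Sum>m\<in>Poly_Mapping.keys l. Poly_Mapping.lookup l m * dot (axis (i m) 1) u)"
      unfolding eval_def
    proof (rule sum.cong[OF refl])
      fix m assume "m \<in> Poly_Mapping.keys l"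
      then have "m = Poly_Mapping.single (i m) 1" by (rule i)
      then have "(\<Prod>j\<in>UNIV. u $ j ^ Poly_Mapping.lookup m j) = u $ i m"
        using prod_power_single[of u "i m"] by simp
      then show "Poly_Mapping.lookup l m * (\<Prod>j\<in>UNIV. u $ j ^ Poly_Mapping.lookup m j)
          = Poly_Mapping.lookup l m * dot (axis (i m) 1) u"
        by (simp add: dot_axis)
    qed
    then show ?thesis
      by (simp add: c_def dot_commute[of _ u] dot_sum dot_scale)
  qed
  then show thesis by (rule that)
qed

section \<open>Polynomial functions\<close>

text \<open>
  Membership in an ideal that contains the vanishing ideal of a set depends only on the values on that set, so
  most arguments below are about functions rather than about polynomials.
\<close>

definition polyfun :: "('k::comm_ring_1 ^ 'v::finite \<Rightarrow> 'k) \<Rightarrow> bool" where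
  "polyfun h \<longleftrightarrow> (\<exists>f. h = eval f)"

lemma polyfun_eval: "polyfun (eval f)"
  by (auto simp: polyfun_def)

lemma polyfun_const: "polyfun (\<lambda>u. c)"
  unfolding polyfun_def by (rule exI[of _ "Poly_Mapping.single 0 c"]) (simp add: eval_const fun_eq_iff)

lemma polyfun_dot: "polyfun (\<lambda>u. dot c u)"
  unfolding polyfun_def by (rule exI[of _ "lin_form c"]) (simp add: eval_lin_form fun_eq_iff)

lemma polyfun_coord: "polyfun (\<lambda>u. u $ i)"
  using polyfun_dot[of "axis i 1"] by (simp add: dot_axis)

lemma polyfun_add:
  assumes "polyfun g" "polyfun h" shows "polyfun (\<lambda>u. g u + h u)"
proof -
  obtain p q where "g = eval p" "h = eval q" using assms by (auto simp: polyfun_def)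
  then have "(\<lambda>u. g u + h u) = eval (p + q)" by (simp add: eval_add fun_eq_iff)
  then show ?thesis by (simp only: polyfun_eval)
qed

lemma polyfun_mult:
  assumes "polyfun g" "polyfun h" shows "polyfun (\<lambda>u. g u * h u)"
proof -
  obtain p q where "g = eval p" "h = eval q" using assms by (auto simp: polyfun_def)
  then have "(\<lambda>u. g u * h u) = eval (p * q)" by (simp add: eval_mult fun_eq_iff)
  then show ?thesis by (simp only: polyfun_eval)
qed

lemma polyfun_diff:
  assumes "polyfun g" "polyfun h" shows "polyfun (\<lambda>u. g u - h u)"
proof -
  obtain p q where "g = eval p" "h = eval q" using assms by (auto simp: polyfun_def)
  then have "(\<lambda>u. g u - h u) = eval (p - q)" by (simp add: eval_diff fun_eq_iff)
  then show ?thesis by (simp only: polyfun_eval)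
qed

lemma polyfun_uminus: "polyfun g \<Longrightarrow> polyfun (\<lambda>u. - g u)"
  using polyfun_diff[OF polyfun_const[of 0]] by simp

lemma polyfun_sum: "(\<And>x. x \<in> S \<Longrightarrow> polyfun (g x)) \<Longrightarrow> polyfun (\<lambda>u. \<Sum>x\<in>S. g x u)"
  by (induction S rule: infinite_finite_induct) (auto intro: polyfun_const polyfun_add)

lemma polyfun_prod: "(\<And>x. x \<in> S \<Longrightarrow> polyfun (g x)) \<Longrightarrow> polyfun (\<lambda>u. \<Prod>x\<in>S. g x u)"
  by (induction S rule: infinite_finite_induct) (auto intro: polyfun_const polyfun_mult)

lemma polyfun_power: "polyfun g \<Longrightarrow> polyfun (\<lambda>u. g u ^ n)"
  by (induction n) (auto intro: polyfun_const polyfun_mult)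

lemma polyfun_induct [consumes 1, case_names const coord add mult]:
  fixes P :: "('k::comm_ring_1 ^ 'v::finite \<Rightarrow> 'k) \<Rightarrow> bool"
  assumes h: "polyfun h"
    and const: "\<And>c. P (\<lambda>u. c)"
    and coord: "\<And>i. P (\<lambda>u. u $ i)"
    and add: "\<And>g h. P g \<Longrightarrow> P h \<Longrightarrow> P (\<lambda>u. g u + h u)"
    and mult: "\<And>g h. P g \<Longrightarrow> P h \<Longrightarrow> P (\<lambda>u. g u * h u)"
  shows "P h"
proof -
  have power: "P (\<lambda>u. u $ i ^ n)" for i n
    by (induction n) (auto intro: const[of 1] mult coord)
  have prod: "P (\<lambda>u. \<Prod>i\<in>S. u $ i ^ k i)" if "finite S" for S and k :: "'v \<Rightarrow> nat"
    using that by (induction S) (auto intro: const[of 1] mult power)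
  have sum: "P (\<lambda>u. \<Sum>m\<in>S. c m * (\<Prod>i\<in>UNIV. u $ i ^ Poly_Mapping.lookup m i))"
    if "finite S" for S and c :: "('v \<Rightarrow>\<^sub>0 nat) \<Rightarrow> 'k"
    using that by (induction S) (auto intro!: const add mult prod)
  obtain f where "h = eval f" using h by (auto simp: polyfun_def)
  then have "h = (\<lambda>u. \<Sum>m\<in>Poly_Mapping.keys f. Poly_Mapping.lookup f m * (\<Prod>i\<in>UNIV. u $ i ^ Poly_Mapping.lookup m i))"
    by (simp add: eval_def fun_eq_iff)
  with sum show ?thesis by simp
qed

text \<open>
  Taylor expansion of first order: the remainder is divisible by the displacement.  This is the only form of
  polynomial division that is used: vanishing at the shifted point gives divisibility at the original one.
\<close>

lemma polyfun_shift:
  fixes a :: "'k::comm_ring_1 ^ 'v::finite \<Rightarrow> 'k ^ 'v"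
  assumes g: "polyfun g" and a: "\<And>i. polyfun (\<lambda>u. a u $ i)" and b: "polyfun b"
  shows "\<exists>h. polyfun h \<and> (\<forall>u. g (a u + b u *s e) = g (a u) + b u * h u) \<and> polyfun (\<lambda>u. g (a u))"
  using g
proof (induction rule: polyfun_induct)
  case (const c)
  show ?case by (rule exI[of _ "\<lambda>u. 0"]) (simp add: polyfun_const)
next
  case (coord i)
  show ?case by (rule exI[of _ "\<lambda>u. e $ i"]) (simp add: polyfun_const a)
next
  case (add g1 g2)
  then obtain h1 h2 where h: "polyfun h1" "polyfun h2" "polyfun (\<lambda>u. g1 (a u))" "polyfun (\<lambda>u. g2 (a u))"
    "\<forall>u. g1 (a u + b u *s e) = g1 (a u) + b u * h1 u"
    "\<forall>u. g2 (a u + b u *s e) = g2 (a u) + b u * h2 u" by blast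
  show ?case
  proof (intro exI conjI)
    show "polyfun (\<lambda>u. h1 u + h2 u)" "polyfun (\<lambda>u. g1 (a u) + g2 (a u))"
      using h by (intro polyfun_add; simp)+
  qed (simp only: h, simp add: ring_distribs ac_simps)
next
  case (mult g1 g2)
  then obtain h1 h2 where h: "polyfun h1" "polyfun h2" "polyfun (\<lambda>u. g1 (a u))" "polyfun (\<lambda>u. g2 (a u))"
    "\<forall>u. g1 (a u + b u *s e) = g1 (a u) + b u * h1 u"
    "\<forall>u. g2 (a u + b u *s e) = g2 (a u) + b u * h2 u" by blast
  have ring: "(x + c * y) * (x' + c * y') = x * x' + c * (y * x' + x * y' + c * (y * y'))" for x y x' y' c :: 'k
    by (simp add: algebra_simps)
  show ?case
  proof (intro exI conjI)
    show "polyfun (\<lambda>u. h1 u * g2 (a u) + g1 (a u) * h2 u + b u * (h1 u * h2 u))"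
      "polyfun (\<lambda>u. g1 (a u) * g2 (a u))"
      using h b by (intro polyfun_add polyfun_mult; simp)+
  qed (simp only: h ring, simp)
qed

text \<open>
  Over a finite field the polynomial \<open>1 + (\<Prod>a. x - a)\<close> has no root.
\<close>

lemma infinite_UNIV_alg_closed: "infinite (UNIV :: 'k::alg_closed_field set)"
proof
  assume fin: "finite (UNIV :: 'k set)"
  define q where "q = (\<Prod>a\<in>(UNIV :: 'k set). [:- a, 1:])"
  have deg: "degree q = card (UNIV :: 'k set)"
    unfolding q_def by (subst degree_prod_eq_sum_degree) auto
  then have "degree (q + 1) > 0"
    using fin by (subst degree_add_eq_left) (auto simp: card_gt_0_iff)
  then obtain x where "poly (q + 1) x = 0"
    using alg_closed_imp_poly_has_root by blast
  moreover have "poly q x = 0"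
    unfolding q_def poly_prod using fin by (intro prod_zero) auto
  ultimately show False by simp
qed

lemma poly_eqI_values:
  fixes P Q :: "'k::alg_closed_field poly"
  assumes "\<And>T. poly P T = poly Q T"
  shows "P = Q"
proof (rule ccontr)
  assume "P \<noteq> Q"
  then have "finite {T. poly (P - Q) T = 0}" by (intro poly_roots_finite) simp
  with assms show False by (simp add: infinite_UNIV_alg_closed)
qed

lemma polyfun_affine: "polyfun (\<lambda>u. (a + dot c u *s b) $ i)"
  by (simp, intro polyfun_add polyfun_mult polyfun_const polyfun_dot)

lemma polyfun_poly: "polyfun r \<Longrightarrow> polyfun (\<lambda>u. poly P (r u))"
  by (induction P) (auto intro!: polyfun_const polyfun_add polyfun_mult)

lemma polyfun_det:
  fixes M :: "'k::comm_ring_1 ^ 'v::finite \<Rightarrow> 'k ^ 'v ^ 'v"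
  assumes "\<And>i j. polyfun (\<lambda>u. M u $ i $ j)"
  shows "polyfun (\<lambda>u. det (M u))"
  unfolding det_def by (intro polyfun_sum polyfun_mult polyfun_const polyfun_prod assms)

section \<open>Polynomials on curves and directional derivatives\<close>

text \<open>
  The restriction of a polynomial to a parametrised curve.  Over an infinite field it is determined by its
  values, so its algebraic rules follow from those of \<open>eval\<close>.
\<close>

definition pullback :: "('v::finite, 'k::comm_ring_1) mpol \<Rightarrow> 'k poly ^ 'v \<Rightarrow> 'k poly" where
  "pullback f \<gamma> = (\<Sum>m\<in>Poly_Mapping.keys f.
     [:Poly_Mapping.lookup f m:] * (\<Prod>i\<in>UNIV. (\<gamma> $ i) ^ Poly_Mapping.lookup m i))"

definition curve_at :: "'k::comm_ring_1 poly ^ 'v::finite \<Rightarrow> 'k \<Rightarrow> 'k ^ 'v" where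
  "curve_at \<gamma> T = (\<chi> i. poly (\<gamma> $ i) T)"

lemma poly_pullback: "poly (pullback f \<gamma>) T = eval f (curve_at \<gamma> T)"
  by (simp add: pullback_def eval_def poly_sum poly_prod curve_at_def)

lemma pullback_add: "pullback (f + g) \<gamma> = pullback f \<gamma> + pullback g (\<gamma> :: 'k::alg_closed_field poly ^ 'v::finite)"
  by (rule poly_eqI_values) (simp add: poly_pullback eval_simps)

lemma pullback_mult: "pullback (f * g) \<gamma> = pullback f \<gamma> * pullback g (\<gamma> :: 'k::alg_closed_field poly ^ 'v::finite)"
  by (rule poly_eqI_values) (simp add: poly_pullback eval_simps)

definition tangent_line :: "'k::comm_ring_1 ^ 'v::finite \<Rightarrow> 'k ^ 'v \<Rightarrow> 'k poly ^ 'v" where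
  "tangent_line u w = (\<chi> i. [:u $ i, w $ i:])"

lemma curve_at_tangent_line: "curve_at (tangent_line u w) T = u + T *s w"
  by (simp add: curve_at_def tangent_line_def vec_eq_iff)

lemma pullback_single:
  "pullback (Poly_Mapping.single m c) \<gamma> = [:c:] * (\<Prod>i\<in>UNIV. (\<gamma> $ i) ^ Poly_Mapping.lookup m i)"
  by (cases "c = 0") (simp_all add: pullback_def)

lemma pullback_eq_sum_single:
  "pullback f \<gamma> = (\<Sum>m\<in>Poly_Mapping.keys f. pullback (Poly_Mapping.single m (Poly_Mapping.lookup f m)) \<gamma>)"
  by (simp add: pullback_def[of f] pullback_single)

text \<open>
  The expression that defines the tangent space is the coefficient of the parameter in the restriction to a
  line.  Unlike the partial derivatives, this coefficient is visibly compatible with products.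
\<close>

lemma directional_derivative:
  fixes u w :: "'k::field ^ 'v::finite"
  shows "(\<Sum>i\<in>UNIV. w $ i * eval (partial_deriv i f) u) = coeff (pullback f (tangent_line u w)) 1"
proof -
  have c1: "coeff q 1 = poly (pderiv q) 0" for q :: "'k poly"
    by (simp add: coeff_pderiv poly_0_coeff_0)
  have *: "(\<Sum>i\<in>UNIV. w $ i * eval (Poly_Mapping.single (m - Poly_Mapping.single i 1)
       (of_nat (Poly_Mapping.lookup m i) * c)) u)
     = coeff (pullback (Poly_Mapping.single m c) (tangent_line u w)) 1" for m :: "'v \<Rightarrow>\<^sub>0 nat" and c
  proof -
    let ?k = "Poly_Mapping.lookup m"
    have mon: "(\<Prod>j\<in>UNIV. u $ j ^ Poly_Mapping.lookup (m - Poly_Mapping.single i 1) j)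
       = u $ i ^ (?k i - 1) * (\<Prod>j\<in>UNIV - {i}. u $ j ^ ?k j)" for i
      by (subst prod.remove[of _ i]) (auto simp: lookup_minus lookup_single when_def intro!: prod.cong)
    have "(\<Sum>i\<in>UNIV. w $ i * eval (Poly_Mapping.single (m - Poly_Mapping.single i 1) (of_nat (?k i) * c)) u)
      = c * (\<Sum>i\<in>UNIV. (\<Prod>j\<in>UNIV - {i}. u $ j ^ ?k j) * (of_nat (?k i) * u $ i ^ (?k i - 1) * w $ i))"
      unfolding eval_single mon sum_distrib_left by (intro sum.cong refl) (simp only: ac_simps)
    also have "\<dots> = coeff (pullback (Poly_Mapping.single m c) (tangent_line u w)) 1"
      unfolding c1
      by (simp add: pullback_single pderiv_smult pderiv_prod pderiv_power poly_sum poly_prod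
          tangent_line_def pderiv_pCons ac_simps)
    finally show ?thesis .
  qed
  have "(\<Sum>i\<in>UNIV. w $ i * eval (partial_deriv i f) u)
    = (\<Sum>m\<in>Poly_Mapping.keys f. \<Sum>i\<in>UNIV. w $ i * eval (Poly_Mapping.single (m - Poly_Mapping.single i 1)
       (of_nat (Poly_Mapping.lookup m i) * Poly_Mapping.lookup f m)) u)"
    by (simp add: partial_deriv_def eval_sum sum_distrib_left) (rule sum.swap)
  also have "\<dots> = coeff (pullback f (tangent_line u w)) 1"
    unfolding * by (subst (2) pullback_eq_sum_single) (simp add: coeff_sum)
  finally show ?thesis .
qed

text \<open>
  Modulo the square of the parameter, the restriction of a polynomial depends only on the tangent vector of
  the curve.
\<close>

lemma jet_zero_cong:
  fixes \<gamma> \<delta> :: "'k::comm_ring_1 poly ^ 'v::finite"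
  assumes "\<And>i. coeff (\<gamma> $ i) 0 = coeff (\<delta> $ i) 0" "\<And>i. coeff (\<gamma> $ i) 1 = coeff (\<delta> $ i) 1"
  shows "coeff (pullback f \<gamma>) 0 = coeff (pullback f \<delta>) 0 \<and> coeff (pullback f \<gamma>) 1 = coeff (pullback f \<delta>) 1"
proof -
  define R where "R p q \<longleftrightarrow> coeff p 0 = coeff q 0 \<and> coeff p 1 = coeff q 1" for p q :: "'k poly"
  have mult: "R (p * p') (q * q')" if "R p q" "R p' q'" for p q p' q'
    using that by (simp add: R_def coeff_mult)
  have one: "R 1 1" "R 0 0" by (simp_all add: R_def)
  have power: "R (p ^ k) (q ^ k)" if "R p q" for p q k
    using that by (induction k) (simp_all add: one mult)
  have prod: "R (prod p S) (prod q S)" if "\<And>x. x \<in> S \<Longrightarrow> R (p x) (q x)" for p q and S :: "'v set"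
    using that by (induction S rule: infinite_finite_induct) (simp_all add: one mult)
  have sum: "R (sum p S) (sum q S)" if "\<And>x. x \<in> S \<Longrightarrow> R (p x) (q x)" for p q and S :: "('v \<Rightarrow>\<^sub>0 nat) set"
    using that by (induction S rule: infinite_finite_induct) (auto simp: R_def)
  have "R (pullback f \<gamma>) (pullback f \<delta>)"
    unfolding pullback_def by (intro sum mult prod power) (use assms in \<open>auto simp: R_def\<close>)
  then show ?thesis by (simp add: R_def)
qed

section \<open>Homogeneous components\<close>

definition homogeneous_part :: "nat \<Rightarrow> ('v::finite, 'k::comm_ring_1) mpol \<Rightarrow> ('v, 'k) mpol" where
  "homogeneous_part d f = (\<Sum>m\<in>{m\<in>Poly_Mapping.keys f. monom_deg m = d}.
     Poly_Mapping.single m (Poly_Mapping.lookup f m))"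

lemma eval_homogeneous_part_scale:
  "eval (homogeneous_part d f) (c *s u) = c ^ d * eval (homogeneous_part d f) u"
  unfolding homogeneous_part_def eval_sum sum_distrib_left
  by (intro sum.cong) (auto simp: eval_single power_mult_distrib prod.distrib monom_deg_def power_sum)

lemma sum_homogeneous_part: "\<exists>D. f = (\<Sum>d\<le>D. homogeneous_part d f)"
proof -
  let ?K = "Poly_Mapping.keys f"
  define D where "D = Max (insert 0 (monom_deg ` ?K))"
  have D: "monom_deg m \<le> D" if "m \<in> ?K" for m
    unfolding D_def using that by (intro Max_ge) auto
  have "(\<Sum>d\<le>D. homogeneous_part d f) = (\<Sum>m\<in>?K. Poly_Mapping.single m (Poly_Mapping.lookup f m))"
    unfolding homogeneous_part_def by (rule sum.group) (use D in auto)
  then show ?thesis using lookup_sum_single[of f] by metis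
qed

text \<open>
  On the line through \<open>u\<close> a polynomial becomes a polynomial in the scaling factor, with the values of its
  homogeneous parts as coefficients.
\<close>

lemma eval_homogeneous_part_cone:
  fixes f :: "('v::finite, 'k::alg_closed_field) mpol"
  assumes D: "f = (\<Sum>d\<le>D. homogeneous_part d f)" and "d \<le> D"
    and zero: "\<And>c. eval f (c *s u) = 0"
  shows "eval (homogeneous_part d f) u = 0"
proof -
  define P where "P = (\<Sum>d\<le>D. monom (eval (homogeneous_part d f) u) d)"
  have "poly P c = 0" for c
  proof -
    have "poly P c = eval (\<Sum>d\<le>D. homogeneous_part d f) (c *s u)"
      by (simp add: P_def poly_sum poly_monom eval_sum eval_homogeneous_part_scale mult.commute)
    then show ?thesis using D zero by metis
  qed
  then have "P = 0" by (intro poly_eqI_values) simp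
  moreover have "coeff P d = eval (homogeneous_part d f) u"
    using \<open>d \<le> D\<close> by (simp add: P_def coeff_sum)
  ultimately show ?thesis by simp
qed

section \<open>Linear algebra\<close>

lemma matrix_vector_nth: "(M *v u) $ i = dot (M $ i) u"
  by (simp add: matrix_vector_mult_def dot_def)

text \<open>
  Linear forms separate points from subspaces; it provides both the linear equations of a linear
  space and all dual bases below.
\<close>

lemma separating_functional:
  fixes S :: "('k::field ^ 'v::finite) set"
  assumes S: "vec.subspace S" and v: "v \<notin> S"
  obtains c where "\<And>u. u \<in> S \<Longrightarrow> dot c u = 0" "dot c v = 1"
proof -
  obtain B where B: "B \<subseteq> S" "vec.independent B" "vec.span B = S"
    using vec.basis_subspace_exists[OF S] by metis
  then have "vec.independent (insert v B)" using v by (intro vec.independent_insertI) auto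
  then obtain g :: "'k ^ 'v \<Rightarrow> 'k ^ 'v" where g: "Vector_Spaces.linear (*s) (*s) g"
    "\<And>x. x \<in> insert v B \<Longrightarrow> g x = (if x = v then 1 else 0)"
    using vec.linear_independent_extend[of "insert v B" "\<lambda>x. if x = v then 1 else 0"] by blast
  have "v \<notin> B" using B v by blast
  let ?c = "matrix g $ undefined"
  have c: "dot ?c u = g u $ undefined" for u
    using matrix_works[OF g(1), of u] by (simp add: matrix_vector_nth[symmetric])
  show thesis
  proof
    show "dot ?c v = 1" by (simp add: c g)
    fix u assume "u \<in> S"
    then have "u \<in> vec.span B" by (simp add: B)
    then show "dot ?c u = 0"
      by (induction rule: vec.span_induct_alt) (use g \<open>v \<notin> B\<close> in \<open>auto simp: dot_simps c\<close>)
  qed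
qed

lemma subspace_hyperplane:
  "vec.subspace U \<Longrightarrow> vec.subspace {u \<in> U. dot c u = (0 :: 'k::field)}"
  by (auto simp: vec.subspace_def dot_simps)

lemma dim_hyperplane:
  fixes U :: "('k::field ^ 'v::finite) set"
  assumes U: "vec.subspace U" and e: "e \<in> U" "dot c e \<noteq> 0"
  shows "vec.dim {u \<in> U. dot c u = 0} = vec.dim U - 1"
proof -
  let ?K = "{u \<in> U. dot c u = 0}"
  have K: "vec.subspace ?K" by (rule subspace_hyperplane[OF U])
  then have sp: "vec.span ?K = ?K" by (rule vec.span_eq_iff[THEN iffD2])
  have "U \<subseteq> vec.span (insert e ?K)"
  proof
    fix u assume u: "u \<in> U"
    let ?t = "dot c u / dot c e"
    have "u - ?t *s e \<in> vec.span ?K"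
      using u e U by (auto simp: sp dot_simps intro: vec.subspace_diff vec.subspace_scale)
    then show "u \<in> vec.span (insert e ?K)" by (auto simp: vec.in_span_insert vec.span_breakdown_eq)
  qed
  moreover have "insert e ?K \<subseteq> U" using e by auto
  ultimately have "vec.dim U = vec.dim (insert e ?K)"
    by (meson order_antisym vec.dim_mono vec.dim_subset)
  also have "\<dots> = Suc (vec.dim ?K)" using e by (simp add: vec.dim_insert sp)
  finally show ?thesis by simp
qed

lemma dot_matrix_vector: "dot g (M *v u) = dot (g v* M) u"
  unfolding dot_def matrix_vector_mult_def vector_matrix_mult_def
  by (simp add: sum_distrib_left sum_distrib_right ac_simps) (rule sum.swap)

lemma dual_pair:
  fixes u v w :: "'k::field ^ 'v::finite"
  assumes "u \<notin> vec.span {v, w}"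
  obtains g where "dot g u = 1" "dot g v = 0" "dot g w = 0"
proof -
  obtain g where g: "\<And>x. x \<in> vec.span {v, w} \<Longrightarrow> dot g x = 0" "dot g u = 1"
    using separating_functional[OF vec.subspace_span assms] by blast
  then show thesis using that vec.span_base[of _ "{v, w}"] by blast
qed

lemma in_span_image_iff:
  fixes f :: "'i \<Rightarrow> 'k::field ^ 'v::finite"
  assumes "finite S"
  shows "u \<in> vec.span (f ` S) \<longleftrightarrow> (\<exists>c. u = (\<Sum>i\<in>S. c i *s f i))"
proof
  assume "u \<in> vec.span (f ` S)"
  then show "\<exists>c. u = (\<Sum>i\<in>S. c i *s f i)"
  proof (induction rule: vec.span_induct_alt)
    case base
    show ?case by (rule exI[of _ "\<lambda>_. 0"]) simp
  next
    case (step r x y)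
    then obtain i c where i: "i \<in> S" "x = f i" and y: "y = (\<Sum>i\<in>S. c i *s f i)" by auto
    have "r *s f i = (\<Sum>j\<in>S. (if j = i then r else 0) *s f j)"
      using i assms by (simp add: if_distrib[of "\<lambda>x. x *s _"] cong: if_cong)
    then have "r *s x + y = (\<Sum>j\<in>S. ((if j = i then r else 0) + c j) *s f j)"
      by (simp add: i y sum.distrib vector_sadd_rdistrib)
    then show ?case by (intro exI[of _ "\<lambda>j. (if j = i then r else 0) + c j"])
  qed
next
  assume "\<exists>c. u = (\<Sum>i\<in>S. c i *s f i)"
  then obtain c where "u = (\<Sum>i\<in>S. c i *s f i)" by blast
  then show "u \<in> vec.span (f ` S)"
    by (simp add: vec.span_sum vec.span_scale vec.span_base)
qed

lemma in_span_pair: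
  fixes u :: "'k::field ^ 'v::finite"
  shows "u \<in> vec.span {v, w} \<longleftrightarrow> (\<exists>c d. u = c *s v + d *s w)"
proof
  assume "u \<in> vec.span {v, w}"
  then obtain c where "u - c *s v \<in> vec.span {w}" by (auto simp: vec.span_breakdown_eq[of _ v])
  then obtain d where "u - c *s v = d *s w" by (auto simp: vec.span_singleton)
  then have "u = c *s v + d *s w" by (simp add: algebra_simps)
  then show "\<exists>c d. u = c *s v + d *s w" by blast
next
  assume "\<exists>c d. u = c *s v + d *s w"
  then obtain c d where "u = c *s v + d *s w" by blast
  then show "u \<in> vec.span {v, w}" by (simp add: vec.span_add vec.span_scale vec.span_base)
qed

text \<open>
  Two proportional vectors are multiples of a common vector, with the same ratio.  For \<open>x = A u\<close> and
  \<open>y = B u\<close> this parametrises the points of the scroll.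
\<close>

lemma scale_pairs_eq:
  fixes x y :: "'k::field ^ 'v::finite"
  assumes "(s, t) \<noteq> (0, 0)" "t *s x = s *s y"
  obtains w where "x = s *s w" "y = t *s w"
proof (cases "s = 0")
  case True
  with assms have "t \<noteq> 0" "x = 0" by (auto simp: vec.scale_eq_0_iff)
  then show thesis using that[of "inverse t *s y"] True by simp
next
  case False
  have "y = t *s (inverse s *s x)"
    using arg_cong[OF assms(2), of "\<lambda>z. inverse s *s z"] False by (simp add: ac_simps)
  then show thesis using that[of "inverse s *s x"] False by simp
qed

lemma span_singleton_neq_imp_notin:
  fixes u v :: "'k::field ^ 'v::finite"
  assumes "u \<noteq> 0" "vec.span {u} \<noteq> vec.span {v}"
  shows "u \<notin> vec.span {v}"
proof
  assume u: "u \<in> vec.span {v}"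
  then obtain k where k: "u = k *s v" by (auto simp: vec.span_singleton)
  with assms have "v = inverse k *s u" by auto
  then have "v \<in> vec.span {u}" using vec.span_scale[OF vec.span_base[of u "{u}"]] by simp
  with u have "vec.span {u} = vec.span {v}"
    by (intro equalityI vec.span_minimal vec.subspace_span) auto
  with assms show False by simp
qed

lemma dot_lin_form_coeffs:
  "dot (a + b) u = dot a u + dot b u" "dot (r *s a) u = r * dot a u"
  "dot (a - b) u = dot a u - dot b (u :: 'k::comm_ring_1 ^ 'v::finite)"
  by (simp_all add: dot_def sum.distrib sum_distrib_left sum_subtractf algebra_simps)

lemma vector_4:
  "(vector [a, b, c, d] :: 'a::zero ^ 4) $ 1 = a" "(vector [a, b, c, d] :: 'a::zero ^ 4) $ 2 = b"
  "(vector [a, b, c, d] :: 'a::zero ^ 4) $ 3 = c" "(vector [a, b, c, d] :: 'a::zero ^ 4) $ 4 = d"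
  unfolding vector_def by simp_all

lemma dot_4: "dot c (u :: 'k::comm_semiring_1 ^ 4) = c $ 1 * u $ 1 + c $ 2 * u $ 2 + c $ 3 * u $ 3 + c $ 4 * u $ 4"
  by (simp add: dot_def sum_4)

lemma det_nonzero_iff_kernel:
  fixes M :: "'k::field ^ 'v::finite ^ 'v"
  shows "det M \<noteq> 0 \<longleftrightarrow> (\<forall>u. M *v u = 0 \<longrightarrow> u = 0)"
  by (simp add: invertible_det_nz[symmetric] invertible_left_inverse matrix_left_invertible_ker)

text \<open>
  If a family of linear forms has no common zero, its span is everything, so it contains a basis.  In this
  form \<open>kernel \<noteq> 0\<close> becomes a condition on determinants even for a family with more members than variables.
\<close>

lemma det_rows_nonzero:
  fixes r :: "'i \<Rightarrow> 'k::field ^ 'v::finite"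
  assumes ker: "\<And>u. \<forall>x. dot (r x) u = 0 \<Longrightarrow> u = 0"
  shows "\<exists>f :: 'v \<Rightarrow> 'i. det (\<chi> a. r (f a)) \<noteq> 0"
proof -
  have span: "vec.span (range r) = UNIV"
  proof (rule ccontr)
    assume "vec.span (range r) \<noteq> UNIV"
    then obtain e where "e \<notin> vec.span (range r)" by blast
    then obtain c where c: "\<And>u. u \<in> vec.span (range r) \<Longrightarrow> dot c u = 0" "dot c e = 1"
      using separating_functional[OF vec.subspace_span] by blast
    have "c = 0" by (rule ker) (simp add: dot_commute[of _ c] c vec.span_base)
    with c(2) show False by simp
  qed
  obtain S where S: "S \<subseteq> range r" "vec.independent S" "range r \<subseteq> vec.span S"
    using vec.maximal_independent_subset[of "range r"] by blast
  have span_S: "vec.span S = UNIV"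
    using span vec.span_mono[OF S(3)] by (simp add: vec.span_span top.extremum_unique)
  have "card S = CARD('v)"
    using vec.basis_card_eq_dim[of S UNIV] S span_S by (simp add: vec_dim_card card_cart_basis)
  moreover have "finite S" by (rule vec.finiteI_independent[OF S(2)])
  ultimately obtain b where b: "bij_betw b (UNIV :: 'v set) S"
    using finite_same_card_bij[of "UNIV :: 'v set" S] by auto
  have "\<exists>x. r x = b a" for a
    using b S(1) by (metis (no_types, opaque_lifting) UNIV_I bij_betw_apply image_iff subsetD)
  then obtain f where f: "\<And>a. r (f a) = b a" by metis
  have "u = 0" if u: "(\<chi> a. r (f a)) *v u = 0" for u
  proof -
    have "dot y u = 0" if "y \<in> S" for y
    proof -
      have "y \<in> range b" using b that by (simp add: bij_betw_def)
      then obtain a where "y = b a" by (rule rangeE)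
      then show ?thesis
        using arg_cong[OF u, of "\<lambda>x. x $ a"] by (simp add: matrix_vector_nth f)
    qed
    then have "S \<subseteq> {y \<in> UNIV. dot u y = 0}" by (auto simp: dot_commute)
    then have "vec.span S \<subseteq> {y \<in> UNIV. dot u y = 0}"
      by (intro vec.span_minimal subspace_hyperplane vec.subspace_UNIV)
    then have "dot u (axis i 1) = 0" for i by (auto simp: span_S)
    then show "u = 0" by (simp add: dot_commute[of u] dot_axis vec_eq_iff)
  qed
  then have "det (\<chi> a. r (f a)) \<noteq> 0" by (simp add: det_nonzero_iff_kernel)
  then show ?thesis by (intro exI[of _ f])
qed

lemma unimodular_completion:
  fixes a0 a1 :: "'k::field"
  assumes "(a0, a1) \<noteq> (0, 0)"
  obtains b0 b1 where "a0 * b1 - a1 * b0 = 1"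
proof (cases "a0 = 0")
  case True
  then show thesis using assms by (intro that[of 0 "- inverse a1"]) auto
next
  case False
  then show thesis by (intro that[of "inverse a0" 0]) auto
qed

text \<open>
  The solutions of \<open>c0 r0 + c1 r1 = 0\<close> are the multiples of \<open>(- c1, c0)\<close>, and \<open>(d0, d1)\<close> reads off the factor.
\<close>

lemma unimodular_orthogonal:
  fixes c0 c1 d0 d1 r0 r1 :: "'k::comm_ring_1"
  assumes "c0 * d1 - c1 * d0 = 1" "c0 * r0 + c1 * r1 = 0"
  shows "r0 = - c1 * (d0 * r0 + d1 * r1)" "r1 = c0 * (d0 * r0 + d1 * r1)"
proof -
  have "(c0 * d1 - c1 * d0) * r0 = d1 * (c0 * r0 + c1 * r1) - c1 * (d0 * r0 + d1 * r1)"
    "(c0 * d1 - c1 * d0) * r1 = c0 * (d0 * r0 + d1 * r1) - d0 * (c0 * r0 + c1 * r1)"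
    by (simp_all add: algebra_simps)
  then show "r0 = - c1 * (d0 * r0 + d1 * r1)" "r1 = c0 * (d0 * r0 + d1 * r1)"
    by (simp_all add: assms)
qed

text \<open>
  For the matrices with rows \<open>a, b\<close>, with rows \<open>(z0, z1), (z2, z3)\<close>, and with columns \<open>c, d\<close>, multiplicativity
  of the determinant is used for their product, whose first entry vanishes by the last assumption.
\<close>

lemma det_product:
  fixes a0 a1 b0 b1 c0 c1 d0 d1 z0 z1 z2 z3 :: "'k::comm_ring_1"
  assumes "a0 * b1 - a1 * b0 = 1" "c0 * d1 - c1 * d0 = 1"
    and "a0 * (c0 * z0 + c1 * z1) + a1 * (c0 * z2 + c1 * z3) = 0"
  shows "z0 * z3 - z1 * z2 = - ((a0 * (d0 * z0 + d1 * z1) + a1 * (d0 * z2 + d1 * z3))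
     * (b0 * (c0 * z0 + c1 * z1) + b1 * (c0 * z2 + c1 * z3)))"
proof -
  have "(a0 * b1 - a1 * b0) * (c0 * d1 - c1 * d0) * (z0 * z3 - z1 * z2)
      = (a0 * (c0 * z0 + c1 * z1) + a1 * (c0 * z2 + c1 * z3)) * (b0 * (d0 * z0 + d1 * z1) + b1 * (d0 * z2 + d1 * z3))
      - (a0 * (d0 * z0 + d1 * z1) + a1 * (d0 * z2 + d1 * z3)) * (b0 * (c0 * z0 + c1 * z1) + b1 * (c0 * z2 + c1 * z3))"
    by (simp add: algebra_simps)
  then show ?thesis by (simp add: assms)
qed

section \<open>Ideals, saturation and tangent vectors\<close>

lemma ideal_subspaceI:
  "0 \<in> J \<Longrightarrow> (\<And>f g. f \<in> J \<Longrightarrow> g \<in> J \<Longrightarrow> f + g \<in> J) \<Longrightarrow> (\<And>h f. f \<in> J \<Longrightarrow> h * f \<in> J) \<Longrightarrow>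
   ideal.subspace J"
  by (auto simp: ideal.subspace_def)

lemma saturation_superset: "I \<subseteq> saturation I"
proof
  fix f assume f: "f \<in> I"
  have "Poly_Mapping.single m 1 * f \<in> I" if "monom_deg m = 0" for m :: "'a \<Rightarrow>\<^sub>0 nat"
  proof -
    have "m = 0" using that by (intro poly_mapping_eqI) (simp add: monom_deg_def)
    then show ?thesis using f by simp
  qed
  then show "f \<in> saturation I" by (auto simp: saturation_def)
qed

lemma saturation_mono: "I \<subseteq> J \<Longrightarrow> saturation I \<subseteq> saturation J"
  by (auto simp: saturation_def)

text \<open>
  Vanishing of \<open>f\<close> on the tangent vector \<open>w\<close> at \<open>u\<close>, that is, under the map from the polynomial ring to the dual
  numbers that it defines.
\<close>

definition jet_zero :: "'k::comm_ring_1 ^ 'v::finite \<Rightarrow> 'k ^ 'v \<Rightarrow> ('v, 'k) mpol \<Rightarrow> bool" where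
  "jet_zero u w f \<longleftrightarrow> coeff (pullback f (tangent_line u w)) 0 = 0 \<and> coeff (pullback f (tangent_line u w)) 1 = 0"

lemma coeff_pullback_0: "coeff (pullback f (tangent_line u w)) 0 = eval f u"
  using poly_pullback[of f "tangent_line u w" 0]
  by (simp add: curve_at_tangent_line poly_0_coeff_0)

lemma jet_zero_iff:
  fixes u w :: "'k::field ^ 'v::finite"
  shows "jet_zero u w f \<longleftrightarrow> eval f u = 0 \<and> (\<Sum>i\<in>UNIV. w $ i * eval (partial_deriv i f) u) = 0"
  unfolding jet_zero_def directional_derivative coeff_pullback_0 ..

lemma jet_zero_0: "jet_zero u 0 f \<longleftrightarrow> eval f (u :: 'k::field ^ 'v::finite) = 0"
  by (simp add: jet_zero_iff)

text \<open>
  The polynomials that vanish on a tangent vector form an ideal, being the kernel of a map to the dual numbers.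
\<close>

lemma jet_zero_span:
  fixes u w :: "'k::alg_closed_field ^ 'v::finite"
  assumes "\<And>f. f \<in> S \<Longrightarrow> jet_zero u w f" "f \<in> ideal.span S"
  shows "jet_zero u w f"
proof -
  have "ideal.subspace (Collect (jet_zero u w))"
    by (rule ideal_subspaceI)
      (auto simp: jet_zero_def pullback_add pullback_mult coeff_mult pullback_def[of 0])
  then have "ideal.span S \<subseteq> Collect (jet_zero u w)"
    by (intro ideal.span_minimal) (use assms in auto)
  with assms show ?thesis by auto
qed

text \<open>
  Some coordinate does not vanish at \<open>u \<noteq> 0\<close>, hence it is a unit in the dual numbers and can be cancelled.
\<close>

lemma jet_zero_saturation:
  fixes u w :: "'k::alg_closed_field ^ 'v::finite"
  assumes I: "\<And>f. f \<in> I \<Longrightarrow> jet_zero u w f" and u: "u \<noteq> 0" and f: "f \<in> saturation I"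
  shows "jet_zero u w f"
proof -
  obtain i where i: "u $ i \<noteq> 0" using u by (auto simp: vec_eq_iff)
  obtain k where k: "\<And>m. monom_deg m = k \<Longrightarrow> Poly_Mapping.single m 1 * f \<in> I"
    using f by (auto simp: saturation_def)
  let ?m = "Poly_Mapping.single i k"
  have "monom_deg ?m = k" by (simp add: monom_deg_def lookup_single when_def)
  then have "jet_zero u w (Poly_Mapping.single ?m 1 * f)" by (intro I k)
  moreover have "coeff (pullback (Poly_Mapping.single ?m 1) (tangent_line u w)) 0 \<noteq> 0"
    using i by (auto simp: coeff_pullback_0 eval_single lookup_single when_def)
  ultimately show ?thesis
    by (auto simp: jet_zero_def pullback_mult coeff_mult)
qed

lemma eval_span_zero:
  fixes u :: "'k::alg_closed_field ^ 'v::finite"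
  shows "(\<And>f. f \<in> S \<Longrightarrow> eval f u = 0) \<Longrightarrow> f \<in> ideal.span S \<Longrightarrow> eval f u = 0"
  using jet_zero_span[of S u 0 f] by (simp add: jet_zero_0)

text \<open>
  The origin of the affine cone is not a point of the projective scheme, but it lies in the closure of each
  punctured line of the cone.
\<close>

lemma eval_0_of_line:
  fixes u :: "'k::alg_closed_field ^ 'v::finite"
  assumes "\<And>c. c \<noteq> 0 \<Longrightarrow> eval f (c *s u) = 0"
  shows "eval f 0 = 0"
proof -
  let ?P = "pullback f (tangent_line 0 u)"
  have "[:0, 1:] * ?P = 0"
    by (rule poly_eqI_values) (use assms in \<open>auto simp: poly_pullback curve_at_tangent_line\<close>)
  then show ?thesis using coeff_pullback_0[of f 0 u] by simp
qed

text \<open>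
  The difference of \<open>f\<close> and a multiple of \<open>F\<close> vanishes on \<open>W\<close>, so only values on \<open>W\<close> have to be compared.
\<close>

lemma mem_span_insert_vanishing:
  fixes f F :: "('v::finite, 'k::field) mpol"
  assumes g: "polyfun g" and f: "\<And>u. u \<in> W \<Longrightarrow> eval f u = eval F u * g u"
  shows "f \<in> ideal.span (insert F (vanishing_ideal W))"
proof -
  obtain h where "g = eval h" using g by (auto simp: polyfun_def)
  then have "f - h * F \<in> vanishing_ideal W"
    using f by (simp add: vanishing_ideal_def eval_simps mult.commute)
  then have "f - h * F + h * F \<in> ideal.span (insert F (vanishing_ideal W))"
    by (intro ideal.span_add ideal.span_scale ideal.span_base) auto
  then show ?thesis by simp
qed

lemma zero_set_vanishing_ideal_subspace:
  fixes W :: "('k::field ^ 'v::finite) set"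
  assumes "vec.subspace W" shows "zero_set (vanishing_ideal W) = W"
proof (intro set_eqI iffI)
  fix w assume w: "w \<in> zero_set (vanishing_ideal W)"
  show "w \<in> W"
  proof (rule ccontr)
    assume "w \<notin> W"
    then obtain c where c: "\<And>u. u \<in> W \<Longrightarrow> dot c u = 0" "dot c w = 1"
      using separating_functional[OF assms] by blast
    then have "lin_form c \<in> vanishing_ideal W" by (simp add: vanishing_ideal_def eval_lin_form)
    with w c show False by (force simp: zero_set_def eval_lin_form)
  qed
qed (auto simp: zero_set_def vanishing_ideal_def)

lemma scheme_inter_superset: "I \<subseteq> scheme_inter I J" "J \<subseteq> scheme_inter I J"
proof -
  have "I \<union> J \<subseteq> scheme_inter I J"
    unfolding scheme_inter_def by (rule subset_trans[OF ideal.span_superset saturation_superset])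
  then show "I \<subseteq> scheme_inter I J" "J \<subseteq> scheme_inter I J" by simp_all
qed

lemma jet_zero_scheme_inter:
  fixes u w :: "'k::alg_closed_field ^ 'v::finite"
  assumes "\<And>f. f \<in> I \<Longrightarrow> jet_zero u w f" "\<And>f. f \<in> J \<Longrightarrow> jet_zero u w f"
    and "u \<noteq> 0" "f \<in> scheme_inter I J"
  shows "jet_zero u w f"
proof -
  have "jet_zero u w f" if "f \<in> ideal.span (I \<union> J)" for f
    by (rule jet_zero_span[OF _ that]) (use assms(1,2) in blast)
  from jet_zero_saturation[OF this assms(3) assms(4)[unfolded scheme_inter_def]] show ?thesis .
qed

lemma eval_scheme_inter_vanishing:
  fixes u :: "'k::alg_closed_field ^ 'v::finite"
  assumes "u \<in> Y" "u \<in> L" "u \<noteq> 0" "f \<in> scheme_inter (vanishing_ideal Y) (vanishing_ideal L)"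
  shows "eval f u = 0"
  using jet_zero_scheme_inter[of "vanishing_ideal Y" u 0 "vanishing_ideal L" f] assms
  by (simp add: jet_zero_0 vanishing_ideal_def)

lemma zero_set_scheme_inter_subset:
  "zero_set (scheme_inter (vanishing_ideal Y) (vanishing_ideal L))
     \<subseteq> zero_set (vanishing_ideal Y) \<inter> zero_set (vanishing_ideal L)"
  using scheme_inter_superset(1)[of "vanishing_ideal Y" "vanishing_ideal L"]
    scheme_inter_superset(2)[of "vanishing_ideal L" "vanishing_ideal Y"]
  by (auto simp: zero_set_def)

lemma jet_zero_vanishing_subspace:
  fixes u w :: "'k::alg_closed_field ^ 'v::finite"
  assumes L: "vec.subspace L" and uw: "u \<in> L" "w \<in> L" and f: "f \<in> vanishing_ideal L"
  shows "jet_zero u w f"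
proof -
  have "pullback f (tangent_line u w) = 0"
    using f uw L by (intro poly_eqI_values)
      (simp add: poly_pullback curve_at_tangent_line vanishing_ideal_def vec.subspace_add vec.subspace_scale)
  then show ?thesis by (simp add: jet_zero_def)
qed

lemma jet_zero_dehomogenisation:
  fixes u w :: "'k::alg_closed_field ^ 'v::finite"
  assumes "\<And>x. eval l x = dot c x" "dot c u = 1" "dot c w = 0"
  shows "jet_zero u w (l - 1)"
proof -
  have "pullback (l - 1) (tangent_line u w) = 0"
    by (rule poly_eqI_values) (simp add: poly_pullback curve_at_tangent_line eval_simps assms dot_simps)
  then show ?thesis by (simp add: jet_zero_def)
qed

section \<open>Radicals of colon ideals\<close>

text \<open>
  The radical of the colon ideal \<open>J : f\<close>.  The element \<open>f\<close> lies in the saturation of \<open>J\<close> as soon as this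
  radical contains all variables, and membership of linear forms can be combined linearly.
\<close>

definition radical_colon :: "('v, 'k::comm_ring_1) mpol set \<Rightarrow> ('v, 'k) mpol \<Rightarrow> ('v::finite, 'k) mpol set" where
  "radical_colon J f = {g. \<exists>k. g ^ k * f \<in> J}"

context
  fixes J :: "('v::finite, 'k::field) mpol set" and f :: "('v, 'k) mpol"
  assumes J: "ideal.subspace J"

begin

lemma radical_colon_superset: "g \<in> J \<Longrightarrow> g \<in> radical_colon J f"
  unfolding radical_colon_def using ideal.subspace_scale[OF J, of g f]
  by (auto simp: mult.commute intro!: exI[of _ 1])

text \<open>
  In each term of the binomial expansion one of the two exponents is large enough.
\<close>

lemma radical_colon_add:
  assumes "g \<in> radical_colon J f" "h \<in> radical_colon J f"
  shows "g + h \<in> radical_colon J f"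
proof -
  obtain k l where k: "g ^ k * f \<in> J" and l: "h ^ l * f \<in> J"
    using assms by (auto simp: radical_colon_def)
  have "of_nat (k + l choose i) * g ^ i * h ^ (k + l - i) * f \<in> J" if "i \<le> k + l" for i
  proof (cases "k \<le> i")
    case True
    then have "of_nat (k + l choose i) * g ^ i * h ^ (k + l - i) * f
       = (of_nat (k + l choose i) * g ^ (i - k) * h ^ (k + l - i)) * (g ^ k * f)"
      using power_add[of g "i - k" k] by (simp add: ac_simps)
    then show ?thesis using ideal.subspace_scale[OF J k] by metis
  next
    case False
    then have "of_nat (k + l choose i) * g ^ i * h ^ (k + l - i) * f
       = (of_nat (k + l choose i) * g ^ i * h ^ (k - i)) * (h ^ l * f)"
      using power_add[of h "k - i" l] by (simp add: ac_simps)
    then show ?thesis using ideal.subspace_scale[OF J l] by metis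
  qed
  then have "(\<Sum>i\<le>k + l. of_nat (k + l choose i) * g ^ i * h ^ (k + l - i) * f) \<in> J"
    by (intro ideal.subspace_sum[OF J]) auto
  then show ?thesis
    unfolding radical_colon_def by (auto simp: binomial_ring sum_distrib_right intro!: exI[of _ "k + l"])
qed

lemma radical_colon_mult:
  assumes "g \<in> radical_colon J f" shows "h * g \<in> radical_colon J f"
proof -
  obtain k where k: "g ^ k * f \<in> J" using assms by (auto simp: radical_colon_def)
  then have "(h * g) ^ k * f \<in> J"
    using ideal.subspace_scale[OF J k, of "h ^ k"] by (simp add: power_mult_distrib ac_simps)
  then show ?thesis by (auto simp: radical_colon_def)
qed

lemma radical_colon_sum:
  "(\<And>x. x \<in> S \<Longrightarrow> g x \<in> radical_colon J f) \<Longrightarrow> sum g S \<in> radical_colon J f"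
proof (induction S rule: infinite_finite_induct)
  case (insert x S)
  then show ?case by (simp add: radical_colon_add)
qed (simp_all add: radical_colon_superset ideal.subspace_0 J)

lemma radical_colon_square:
  assumes "g * g \<in> radical_colon J f" shows "g \<in> radical_colon J f"
proof -
  obtain k where "(g * g) ^ k * f \<in> J" using assms by (auto simp: radical_colon_def)
  moreover have "(g * g) ^ k = g ^ (2 * k)" by (simp add: power_mult power2_eq_square)
  ultimately show ?thesis by (auto simp: radical_colon_def)
qed

lemma single_eq_power:
  "Poly_Mapping.single (Poly_Mapping.single v n) 1 = (Poly_Mapping.single (Poly_Mapping.single v 1) 1 :: ('v, 'k) mpol) ^ n"
proof (induction n)
  case (Suc n)
  have "Poly_Mapping.single (Poly_Mapping.single v (Suc n)) (1 :: 'k)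
     = Poly_Mapping.single (Poly_Mapping.single v 1 + Poly_Mapping.single v n) (1 * 1)"
    by (simp add: single_add[symmetric])
  then show ?case using Suc by (simp only: mult_single[symmetric] power_Suc)
qed simp

text \<open>
  A monomial whose degree is the sum of the exponents needed for the single variables is divisible by one of
  these powers.
\<close>

lemma saturationI_radical_colon:
  assumes x: "\<And>v. Poly_Mapping.single (Poly_Mapping.single v 1) 1 \<in> radical_colon J f"
  shows "f \<in> saturation J"
proof -
  obtain k where k: "\<And>v. Poly_Mapping.single (Poly_Mapping.single v 1) 1 ^ k v * f \<in> J"
    using x unfolding radical_colon_def by simp metis
  have "Poly_Mapping.single m 1 * f \<in> J" if m: "monom_deg m = (\<Sum>v\<in>UNIV. k v)" for m
  proof -
    have "\<exists>v. k v \<le> Poly_Mapping.lookup m v"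
    proof (rule ccontr)
      assume "\<not> ?thesis"
      then have "monom_deg m < (\<Sum>v\<in>UNIV. k v)"
        unfolding monom_deg_def by (intro sum_strict_mono) (auto simp: not_le)
      with m show False by simp
    qed
    then obtain v where v: "k v \<le> Poly_Mapping.lookup m v" ..
    have "m = (m - Poly_Mapping.single v (k v)) + Poly_Mapping.single v (k v)"
      using v by (intro poly_mapping_eqI) (auto simp: lookup_add lookup_minus lookup_single when_def)
    then have "Poly_Mapping.single m (1::'k) = Poly_Mapping.single (m - Poly_Mapping.single v (k v)) 1 *
       Poly_Mapping.single (Poly_Mapping.single v (k v)) 1"
      by (simp add: mult_single)
    then show ?thesis
      using ideal.subspace_scale[OF J k] by (simp only: single_eq_power[of v "k v"] mult.assoc)
  qed
  then show ?thesis by (auto simp: saturation_def)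
qed

end

section \<open>Lengths of finite schemes\<close>

text \<open>
  Coordinates with respect to a spanning family map an independent set injectively to an
  independent set of vectors.
\<close>

lemma quotient_dim_le:
  fixes J :: "('v::finite, 'k::field) mpol set" and b :: "'n::finite \<Rightarrow> ('v, 'k) mpol"
  assumes J: "ideal.subspace J"
    and spanning: "\<And>f. \<exists>c. f - (\<Sum>i\<in>UNIV. Poly_Mapping.single 0 (c i) * b i) \<in> J"
  shows "quotient_dim J \<le> enat CARD('n)"
  unfolding quotient_dim_def
proof (rule SUP_least, clarify)
  fix B :: "('v, 'k) mpol set"
  assume fin: "finite B"
    and indep: "\<forall>c. (\<Sum>b\<in>B. Poly_Mapping.single 0 (c b) * b) \<in> J \<longrightarrow> (\<forall>b\<in>B. c b = 0)"
  obtain r0 where r0: "\<And>f. f - (\<Sum>i\<in>UNIV. Poly_Mapping.single 0 (r0 f i) * b i) \<in> J"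
    using spanning by metis
  define r :: "('v, 'k) mpol \<Rightarrow> 'k ^ 'n" where "r f = (\<chi> i. r0 f i)" for f
  have key: "(\<Sum>g\<in>B. Poly_Mapping.single 0 (c g) * g) \<in> J" if c: "(\<Sum>g\<in>B. c g *s r g) = 0" for c
  proof -
    have "(\<Sum>g\<in>B. Poly_Mapping.single 0 (c g) * (\<Sum>i\<in>UNIV. Poly_Mapping.single 0 (r0 g i) * b i))
      = (\<Sum>i\<in>UNIV. (\<Sum>g\<in>B. Poly_Mapping.single 0 (c g * r0 g i)) * b i)"
      by (simp add: sum_distrib_left sum_distrib_right mult.assoc[symmetric] mult_single)
         (rule sum.swap)
    also have "\<dots> = (\<Sum>i\<in>UNIV. Poly_Mapping.single 0 (\<Sum>g\<in>B. c g * r0 g i) * b i)"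
      by (intro sum.cong arg_cong2[where f = "(*)"] refl)
         (induction B rule: infinite_finite_induct; simp add: single_add)
    also have "\<dots> = 0"
    proof -
      have "(\<Sum>g\<in>B. c g * r0 g i) = 0" for i
        using arg_cong[OF c, of "\<lambda>x. x $ i"] by (simp add: r_def)
      then show ?thesis by simp
    qed
    finally have "(\<Sum>g\<in>B. Poly_Mapping.single 0 (c g) * g)
      = (\<Sum>g\<in>B. Poly_Mapping.single 0 (c g) * (g - (\<Sum>i\<in>UNIV. Poly_Mapping.single 0 (r0 g i) * b i)))"
      by (simp add: right_diff_distrib sum_subtractf)
    also have "\<dots> \<in> J" by (intro ideal.subspace_sum[OF J] ideal.subspace_scale[OF J] r0)
    finally show ?thesis .
  qed
  have inj: "inj_on r B"
  proof (rule inj_onI, rule ccontr)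
    fix g h assume gh: "g \<in> B" "h \<in> B" "r g = r h" "g \<noteq> h"
    let ?c = "\<lambda>x. if x = g then 1 else if x = h then - 1 else (0::'k)"
    have "(\<Sum>x\<in>B. ?c x *s r x) = (\<Sum>x\<in>{g,h}. ?c x *s r x)"
      using gh fin by (intro sum.mono_neutral_right) auto
    also have "\<dots> = 0" using gh by simp
    finally have "(\<Sum>x\<in>B. Poly_Mapping.single 0 (?c x) * x) \<in> J" by (rule key)
    from indep[rule_format, OF this gh(1)] have "?c g = 0" .
    then show False by simp
  qed
  have "vec.independent (r ` B)"
  proof (rule vec.independent_if_scalars_zero)
    show "finite (r ` B)" using fin by simp
    fix c x assume "(\<Sum>x\<in>r ` B. c x *s x) = 0" and x: "x \<in> r ` B"
    then have "(\<Sum>g\<in>B. c (r g) *s r g) = 0" by (simp add: sum.reindex[OF inj])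
    from indep[rule_format, OF key[OF this]] x show "c x = 0" by auto
  qed
  then have "card (r ` B) \<le> CARD('n)"
    using vec.independent_card_le_dim[of "r ` B" UNIV] by (simp add: card_cart_basis)
  then show "enat (card B) \<le> enat CARD('n)" by (simp add: card_image inj)
qed

lemma quotient_dim_ge_2:
  assumes "b1 \<noteq> b2"
    and "\<And>c d. Poly_Mapping.single 0 c * b1 + Poly_Mapping.single 0 d * b2 \<in> J \<Longrightarrow> c = 0 \<and> d = 0"
  shows "2 \<le> quotient_dim J"
proof -
  have "enat (card {b1, b2}) \<le> quotient_dim J"
    unfolding quotient_dim_def by (rule SUP_upper) (use assms in auto)
  then show ?thesis using assms(1) by (simp add: numeral_eq_enat numeral_2_eq_2)
qed

text \<open>
  A coordinate function and the constant 1 are independent on two points that this coordinate separates.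
\<close>

lemma quotient_dim_ge_2_points:
  fixes y z :: "'k::field ^ 'v::finite"
  assumes J: "\<And>f. f \<in> J \<Longrightarrow> eval f y = 0 \<and> eval f z = 0" and ne: "y \<noteq> z"
  shows "2 \<le> quotient_dim J"
proof -
  obtain i where i: "y $ i \<noteq> z $ i" using ne by (auto simp: vec_eq_iff)
  let ?m = "lin_form (axis i 1) :: ('v, 'k) mpol"
  show ?thesis
  proof (rule quotient_dim_ge_2[of 1 ?m])
    have "eval ?m y \<noteq> eval ?m z" by (simp add: eval_lin_form dot_axis i)
    then show "1 \<noteq> ?m" by (metis eval_one)
    fix c d assume "Poly_Mapping.single 0 c * 1 + Poly_Mapping.single 0 d * ?m \<in> J"
    from J[OF this] have "c + d * y $ i = 0" "c + d * z $ i = 0"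
      by (simp_all add: eval_simps eval_lin_form dot_axis)
    moreover from this have "d * (y $ i - z $ i) = 0"
      by (metis add_left_cancel eq_iff_diff_eq_0 right_diff_distrib)
    ultimately show "c = 0 \<and> d = 0" using i by simp
  qed
qed

text \<open>
  A coordinate function and the constant 1 are independent on a tangent vector along which this coordinate
  varies.
\<close>

lemma quotient_dim_ge_2_tangent:
  fixes u w :: "'k::alg_closed_field ^ 'v::finite"
  assumes J: "\<And>f. f \<in> J \<Longrightarrow> jet_zero u w f" and ne: "w \<noteq> 0"
  shows "2 \<le> quotient_dim J"
proof -
  obtain i where i: "w $ i \<noteq> 0" using ne by (auto simp: vec_eq_iff)
  let ?m = "lin_form (axis i 1) :: ('v, 'k) mpol"
  let ?s = "\<lambda>f. pullback f (tangent_line u w)"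
  have s: "?s ?m = [:u $ i, w $ i:]" "?s 1 = 1" "?s (Poly_Mapping.single 0 c) = [:c:]" for c
    by (rule poly_eqI_values,
        simp add: poly_pullback curve_at_tangent_line eval_simps eval_lin_form dot_axis)+
  show ?thesis
  proof (rule quotient_dim_ge_2[of 1 ?m])
    show "1 \<noteq> ?m" using s(1,2) i by (auto simp: one_pCons)
    fix c d assume "Poly_Mapping.single 0 c * 1 + Poly_Mapping.single 0 d * ?m \<in> J"
    from J[OF this] have "c + d * u $ i = 0" "d * w $ i = 0"
      by (simp_all add: jet_zero_def pullback_add pullback_mult s mult.commute)
    then show "c = 0 \<and> d = 0" using i by simp
  qed
qed

lemma scheme_length_ge_2I:
  fixes I :: "('v::finite, 'k::field) mpol set"
  assumes "\<And>c l. (\<And>u. u \<in> zero_set I \<Longrightarrow> u \<noteq> 0 \<Longrightarrow> dot c u \<noteq> 0) \<Longrightarrow> (\<And>u. eval l u = dot c u) \<Longrightarrow>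
      2 \<le> quotient_dim (ideal.span (insert (l - 1) I))"
  shows "2 \<le> scheme_length I"
  unfolding scheme_length_def
proof (rule INF_greatest, clarify)
  fix l :: "('v, 'k) mpol"
  assume l: "homogeneous 1 l" "\<forall>u\<in>zero_set I. u \<noteq> 0 \<longrightarrow> eval l u \<noteq> 0"
  obtain c where "\<And>u. eval l u = dot c u" using homogeneous_1_eval[OF l(1)] by metis
  with l(2) assms show "2 \<le> quotient_dim (ideal.span (insert (l - 1) I))" by metis
qed

lemma scheme_length_le:
  assumes "\<And>u. u \<in> zero_set I \<Longrightarrow> u \<noteq> 0 \<Longrightarrow> dot c u \<noteq> 0"
    and "quotient_dim (ideal.span (insert (lin_form c - 1) I)) \<le> d"
  shows "scheme_length I \<le> d"
  unfolding scheme_length_def using assms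
  by (intro INF_lower2[of "lin_form c"]) (auto simp: homogeneous_lin_form eval_lin_form simp del: One_nat_def)

section \<open>Scrolls as degeneracy loci of pencils\<close>

text \<open>
  The ruling over \<open>(s, t)\<close> is the kernel of \<open>t A - s B\<close>.  The rulings are spanned
  by polynomial curves, which provide the tangent vectors of the scroll.
\<close>

locale scroll_pencil =
  fixes n :: nat and \<phi> :: "nat \<Rightarrow> 'k::alg_closed_field \<times> 'k \<Rightarrow> 'k ^ 'v::finite"
    and A B :: "'k ^ 'v ^ 'v"
  assumes ruling_iff:
      "(s, t) \<noteq> (0, 0) \<Longrightarrow> u \<in> ruling n \<phi> (s, t) \<longleftrightarrow> t *s (A *v u) = s *s (B *v u)"
    and pencil_inj: "A *v u = 0 \<Longrightarrow> B *v u = 0 \<Longrightarrow> u = 0"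
    and P1_maps: "i < n \<Longrightarrow> \<exists>d c. \<phi> i = P1_map d c"

begin

abbreviation "X \<equiv> scroll n \<phi>"

lemma in_X_iff: "u \<in> X \<longleftrightarrow> (\<exists>s t. (s, t) \<noteq> (0, 0) \<and> t *s (A *v u) = s *s (B *v u))"
proof -
  have "u \<in> X \<longleftrightarrow> (\<exists>s t. (s, t) \<noteq> (0, 0) \<and> u \<in> ruling n \<phi> (s, t))"
    unfolding scroll_def by (simp only: UN_iff mem_Collect_eq Bex_def split_paired_Ex)
  also have "\<dots> \<longleftrightarrow> (\<exists>s t. (s, t) \<noteq> (0, 0) \<and> t *s (A *v u) = s *s (B *v u))"
    by (intro arg_cong[where f = Ex] ext conj_cong refl ruling_iff)
  finally show ?thesis .
qed

lemma in_XE: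
  assumes "u \<in> X"
  obtains s t w where "(s, t) \<noteq> (0, 0)" "A *v u = s *s w" "B *v u = t *s w"
  using assms scale_pairs_eq unfolding in_X_iff by metis

lemma in_XI: "(s, t) \<noteq> (0, 0) \<Longrightarrow> A *v u = s *s w \<Longrightarrow> B *v u = t *s w \<Longrightarrow> u \<in> X"
  unfolding in_X_iff by (intro exI[of _ s] exI[of _ t]) (simp add: mult.commute)

lemma X_scale: "u \<in> X \<Longrightarrow> c *s u \<in> X"
  by (erule in_XE, rule in_XI[where w = "c *s _"]) (auto simp: vec.scale ac_simps)

lemma zero_in_X: "0 \<in> X"
  by (rule in_XI[of 1 0 _ 0]) auto

text \<open>
  For linear forms \<open>g, h\<close> this is the \<open>2 \<times> 2\<close> minor of the pair \<open>A u, B u\<close>, a quadric through the scroll.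
\<close>

definition minor :: "'k ^ 'v \<Rightarrow> 'k ^ 'v \<Rightarrow> ('v, 'k) mpol" where
  "minor g h = lin_form (g v* A) * lin_form (h v* B) - lin_form (h v* A) * lin_form (g v* B)"

lemma eval_minor:
  "eval (minor g h) u = dot g (A *v u) * dot h (B *v u) - dot h (A *v u) * dot g (B *v u)"
  by (simp add: minor_def eval_simps eval_lin_form dot_matrix_vector)

lemma homogeneous_minor: "homogeneous 2 (minor g h)"
  unfolding minor_def one_add_one[symmetric]
  by (intro homogeneous_diff homogeneous_mult homogeneous_lin_form)

lemma minor_in_vanishing_ideal: "minor g h \<in> vanishing_ideal X"
  by (auto simp: vanishing_ideal_def eval_minor dot_simps elim!: in_XE)

text \<open>
  The assumption on \<open>v\<close> is the equation \<open>t A u = s B u\<close> with \<open>u, s, t\<close> replaced by \<open>q + T v\<close>, \<open>s + T s'\<close>,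
  \<open>t + T t'\<close> and differentiated at \<open>T = 0\<close>.  To
  realise \<open>v\<close> by a curve on the scroll, keep the coefficients of \<open>q\<close> with respect to the curves \<open>\<phi> i\<close> and move the
  point of the projective line.  The velocity of this curve solves the same inhomogeneous equation as \<open>v\<close>, so both differ by
  an element of the ruling of \<open>q\<close>, and this is corrected by moving within the rulings.
\<close>

lemma tangent_to_X:
  assumes st: "(s, t) \<noteq> (0, 0)" and q: "A *v q = s *s w" "B *v q = t *s w"
    and v: "t *s (A *v v) - s *s (B *v v) = \<kappa> *s w" and f: "f \<in> vanishing_ideal X"
  shows "jet_zero q v f"
proof -
  obtain d c where \<phi>: "\<And>i. i < n \<Longrightarrow> \<phi> i = P1_map (d i) (c i)" using P1_maps by metis
  \<comment> \<open>The point of the projective line has to move with speed \<open>\<kappa>\<close>; one of its coordinates is kept constant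
    and nonzero, so that it is defined for all \<open>T\<close>.\<close>
  obtain s' t' where st': "\<kappa> = s' * t - t' * s" "\<And>T. (s + T * s', t + T * t') \<noteq> (0, 0)"
  proof (cases "t = 0")
    case True
    with st show thesis by (intro that[of 0 "- \<kappa> / s"]) auto
  next
    case False
    then show thesis by (intro that[of "\<kappa> / t" 0]) auto
  qed
  define \<gamma> :: "(nat \<Rightarrow> 'k) \<Rightarrow> 'k poly ^ 'v" where
    "\<gamma> lam = (\<chi> v. \<Sum>i<n. smult (lam i) (\<Sum>j\<le>d i. smult (c i j $ v) ([:s, s':] ^ (d i - j) * [:t, t':] ^ j)))" for lam
  have curve: "curve_at (\<gamma> lam) T = (\<Sum>i<n. lam i *s \<phi> i (s + T * s', t + T * t'))" for lam T
    by (auto simp: vec_eq_iff curve_at_def \<gamma>_def poly_sum \<phi> P1_map_def ac_simps intro!: sum.cong)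
  have curve_in: "curve_at (\<gamma> lam) T \<in> ruling n \<phi> (s + T * s', t + T * t')" for lam T
    unfolding curve ruling_def by (intro vec.span_sum vec.span_scale vec.span_base) auto
  have combination: "\<exists>lam. u = curve_at (\<gamma> lam) 0" if "u \<in> ruling n \<phi> (s, t)" for u
    using that in_span_image_iff[of "{..<n}" u "\<lambda>i. \<phi> i (s, t)"] by (simp add: ruling_def curve)
  have "q \<in> ruling n \<phi> (s, t)" using st q by (simp add: ruling_iff mult.commute)
  then obtain lam where lam: "q = curve_at (\<gamma> lam) 0" using combination by blast
  define \<gamma>1 where "\<gamma>1 = (\<chi> i. coeff (\<gamma> lam $ i) 1)"
  have \<gamma>0: "coeff (\<gamma> lam $ i) 0 = q $ i" for i by (simp add: lam curve_at_def poly_0_coeff_0)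
  have "t *s (A *v \<gamma>1) + t' *s (A *v q) = s *s (B *v \<gamma>1) + s' *s (B *v q)"
  proof -
    define mul :: "'k ^ 'v ^ 'v \<Rightarrow> 'v \<Rightarrow> 'k poly" where
      "mul M i = (\<Sum>j\<in>UNIV. smult (M $ i $ j) (\<gamma> lam $ j))" for M i
    have mul: "poly (mul M i) T = (M *v curve_at (\<gamma> lam) T) $ i" for M i T
      by (simp add: mul_def poly_sum matrix_vector_mult_def curve_at_def)
    have mul_coeff: "coeff (mul M i) 0 = (M *v q) $ i" "coeff (mul M i) 1 = (M *v \<gamma>1) $ i" for M i
      by (simp_all add: mul_def coeff_sum matrix_vector_mult_def \<gamma>1_def \<gamma>0 del: One_nat_def)
    have "[:t, t':] * mul A i = [:s, s':] * mul B i" for i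
    proof (rule poly_eqI_values)
      fix T
      show "poly ([:t, t':] * mul A i) T = poly ([:s, s':] * mul B i) T"
        using curve_in[of lam T, unfolded ruling_iff[OF st'(2)]] by (simp add: mul vec_eq_iff algebra_simps)
    qed
    then have "coeff ([:t, t':] * mul A i) 1 = coeff ([:s, s':] * mul B i) 1" for i by simp
    then show ?thesis by (simp add: vec_eq_iff mul_coeff mul_coeff(2)[unfolded One_nat_def])
  qed
  then have "t *s (A *v \<gamma>1) - s *s (B *v \<gamma>1) = s' *s (B *v q) - t' *s (A *v q)"
    by (simp add: algebra_simps)
  also have "\<dots> = \<kappa> *s w" by (simp add: q st'(1) vec_eq_iff algebra_simps)
  finally have "t *s (A *v (v - \<gamma>1)) = s *s (B *v (v - \<gamma>1))"
    using v by (simp add: vec.diff vec_eq_iff algebra_simps)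
  then obtain \<mu> where \<mu>: "v - \<gamma>1 = curve_at (\<gamma> \<mu>) 0"
    using combination st by (auto simp: ruling_iff)
  define \<delta> where "\<delta> = (\<chi> i. \<gamma> lam $ i + [:0, 1:] * \<gamma> \<mu> $ i)"
  have "curve_at \<delta> T = curve_at (\<gamma> lam) T + T *s curve_at (\<gamma> \<mu>) T" for T
    by (simp add: \<delta>_def curve_at_def vec_eq_iff)
  then have "curve_at \<delta> T \<in> ruling n \<phi> (s + T * s', t + T * t')" for T
    using curve_in by (simp add: ruling_def vec.span_add vec.span_scale)
  then have "curve_at \<delta> T \<in> X" for T
    unfolding scroll_def using st'(2) by blast
  then have "pullback f \<delta> = 0"
    using f by (intro poly_eqI_values) (simp add: poly_pullback vanishing_ideal_def)
  moreover have "coeff (\<delta> $ i) 0 = coeff (tangent_line q v $ i) 0"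
    "coeff (\<delta> $ i) 1 = coeff (tangent_line q v $ i) 1" for i
    using arg_cong[OF \<mu>, of "\<lambda>x. x $ i"]
    by (simp_all add: \<delta>_def tangent_line_def \<gamma>0 \<gamma>1_def curve_at_def poly_0_coeff_0 algebra_simps)
  ultimately show ?thesis
    using jet_zero_cong[of \<delta> "tangent_line q v" f] by (simp add: jet_zero_def)
qed

end

section \<open>The quadric of a point outside the scroll\<close>

text \<open>
  A point \<open>p\<close> lies outside the scroll iff \<open>A p\<close> and \<open>B p\<close> are independent, that is, iff there are linear forms
  \<open>g, h\<close> dual to them.
\<close>

locale scroll_point = scroll_pencil n \<phi> A B
  for n :: nat and \<phi> :: "nat \<Rightarrow> 'k::alg_closed_field \<times> 'k \<Rightarrow> 'k ^ 'v::finite"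
    and A B :: "'k ^ 'v ^ 'v" +
  fixes p g h :: "'k ^ 'v"
  assumes dual: "dot g (A *v p) = 1" "dot g (B *v p) = 0" "dot h (A *v p) = 0" "dot h (B *v p) = 1"

lemma (in scroll_pencil) scroll_point_exists:
  assumes "p \<notin> X"
  obtains g h where "scroll_point n \<phi> A B p g h"
proof -
  have "A *v p \<notin> vec.span {B *v p, B *v p}"
  proof
    assume "A *v p \<in> vec.span {B *v p, B *v p}"
    then obtain c where "A *v p = c *s (B *v p)" by (auto simp: vec.span_singleton)
    then have "p \<in> X" by (intro in_XI[of c 1 _ "B *v p"]) auto
    with assms show False ..
  qed
  then obtain g where g: "dot g (A *v p) = 1" "dot g (B *v p) = 0" by (rule dual_pair)
  have "B *v p \<notin> vec.span {A *v p, A *v p}"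
  proof
    assume "B *v p \<in> vec.span {A *v p, A *v p}"
    then obtain c where "B *v p = c *s (A *v p)" by (auto simp: vec.span_singleton)
    then have "p \<in> X" by (intro in_XI[of 1 c _ "A *v p"]) auto
    with assms show False ..
  qed
  then obtain h where h: "dot h (B *v p) = 1" "dot h (A *v p) = 0" by (rule dual_pair)
  show thesis by (rule that[of g h], unfold_locales) (use g h in auto)
qed

text \<open>
  A point \<open>p\<close> lies outside the scroll iff \<open>A p\<close> and \<open>B p\<close> are independent, that is, iff there are linear forms
  \<open>g, h\<close> dual to them.
\<close>

context scroll_point

begin

abbreviation "\<alpha> \<equiv> A *v p"

abbreviation "\<beta> \<equiv> B *v p"

definition "y0 u = dot g (A *v u)"

definition "y1 u = dot h (A *v u)"

definition "y2 u = dot g (B *v u)"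

definition "y3 u = dot h (B *v u)"

lemmas y_defs = y0_def y1_def y2_def y3_def

text \<open>
  The vectors \<open>u\<close> for which \<open>A u\<close> and \<open>B u\<close> lie in the plane spanned by \<open>A p\<close> and \<open>B p\<close>.  The rows of the
  \<open>2 \<times> 2\<close> matrix of \<open>u\<close> are \<open>(y0 u, y1 u)\<close> and \<open>(y2 u, y3 u)\<close>.
\<close>

definition U :: "('k ^ 'v) set" where
  "U = {u. A *v u = y0 u *s \<alpha> + y1 u *s \<beta> \<and> B *v u = y2 u *s \<alpha> + y3 u *s \<beta>}"

text \<open>
  On \<open>U\<close> this is the determinant of the matrix of \<open>u\<close>.
\<close>

definition F :: "('v, 'k) mpol" where "F = minor g h"

definition polar :: "'k ^ 'v \<Rightarrow> 'k ^ 'v \<Rightarrow> 'k" where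
  "polar u v = y0 u * y3 v + y3 u * y0 v - y1 u * y2 v - y2 u * y1 v"

lemma y_add: "y0 (u + v) = y0 u + y0 v" "y1 (u + v) = y1 u + y1 v"
    "y2 (u + v) = y2 u + y2 v" "y3 (u + v) = y3 u + y3 v"
  and y_scale: "y0 (c *s u) = c * y0 u" "y1 (c *s u) = c * y1 u"
    "y2 (c *s u) = c * y2 u" "y3 (c *s u) = c * y3 u"
  and y_diff: "y0 (u - v) = y0 u - y0 v" "y1 (u - v) = y1 u - y1 v"
    "y2 (u - v) = y2 u - y2 v" "y3 (u - v) = y3 u - y3 v"
  and y_zero: "y0 0 = 0" "y1 0 = 0" "y2 0 = 0" "y3 0 = 0"
  and y_p: "y0 p = 1" "y1 p = 0" "y2 p = 0" "y3 p = 1"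
  by (simp_all add: y_defs vec.add vec.scale vec.diff dot_simps dual)

lemmas y_simps = y_add y_scale y_diff y_zero y_p

lemma eval_F: "eval F u = y0 u * y3 u - y1 u * y2 u"
  by (simp add: F_def eval_minor y_defs)

lemma eval_F_p: "eval F p = 1"
  by (simp add: eval_F y_simps)

lemma eval_F_combination:
  "eval F (c *s u + d *s v) = c * c * eval F u + c * d * polar u v + d * d * eval F v"
  by (simp add: eval_F y_simps polar_def algebra_simps)

lemma polar_commute: "polar u v = polar v u"
  by (simp add: polar_def algebra_simps)

lemma polar_combination: "polar e (c *s u + d *s v) = c * polar e u + d * polar e v"
  by (simp add: polar_def y_simps algebra_simps)

lemma F_in_vanishing_ideal: "F \<in> vanishing_ideal X"
  unfolding F_def by (rule minor_in_vanishing_ideal)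

lemma p_notin_X: "p \<notin> X"
  using F_in_vanishing_ideal eval_F_p by (force simp: vanishing_ideal_def)

lemma p_nonzero: "p \<noteq> 0"
  using p_notin_X zero_in_X by blast

lemma p_in_U: "p \<in> U"
  by (simp add: U_def y_simps)

lemma subspace_U: "vec.subspace U"
  unfolding vec.subspace_def U_def
  by (auto simp: y_simps vec.add vec.scale vec_eq_iff algebra_simps)

lemma U_combination: "u \<in> U \<Longrightarrow> v \<in> U \<Longrightarrow> c *s u + d *s v \<in> U"
  by (intro vec.subspace_add vec.subspace_scale subspace_U)

text \<open>
  A vector is determined by \<open>A u\<close> and \<open>B u\<close>, so \<open>U\<close> embeds into the \<open>2 \<times> 2\<close> matrices.
\<close>

lemma U_eqI:
  assumes "u \<in> U" "v \<in> U" "y0 u = y0 v" "y1 u = y1 v" "y2 u = y2 v" "y3 u = y3 v"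
  shows "u = v"
  using pencil_inj[of "u - v"] assms by (simp add: U_def vec.diff)

lemma in_UI:
  assumes "A *v u = a *s \<alpha> + b *s \<beta>" "B *v u = c *s \<alpha> + d *s \<beta>"
  shows "u \<in> U" "y0 u = a" "y1 u = b" "y2 u = c" "y3 u = d"
proof -
  show y: "y0 u = a" "y1 u = b" "y2 u = c" "y3 u = d"
    by (simp_all add: y_defs assms dot_simps dual)
  show "u \<in> U" unfolding U_def using assms by (simp add: y)
qed

lemma in_X_iff_F:
  assumes u: "u \<in> U" shows "u \<in> X \<longleftrightarrow> eval F u = 0"
proof
  assume "u \<in> X"
  then show "eval F u = 0" using F_in_vanishing_ideal by (simp add: vanishing_ideal_def)
next
  assume "eval F u = 0"
  then have det: "y0 u * y3 u = y1 u * y2 u" by (simp add: eval_F)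
  obtain s t where st: "(s, t) \<noteq> (0, 0)" "t * y0 u = s * y2 u" "t * y1 u = s * y3 u"
  proof (cases "(y0 u, y2 u) \<noteq> (0, 0)")
    case True
    then show thesis using det by (intro that[of "y0 u" "y2 u"]) (auto simp: algebra_simps)
  next
    case F: False
    show thesis
    proof (cases "(y1 u, y3 u) \<noteq> (0, 0)")
      case True
      then show thesis using F by (intro that[of "y1 u" "y3 u"]) (auto simp: algebra_simps)
    next
      case False
      then show thesis using F by (intro that[of 1 0]) auto
    qed
  qed
  have "A *v u = y0 u *s \<alpha> + y1 u *s \<beta>" "B *v u = y2 u *s \<alpha> + y3 u *s \<beta>"
    using u by (simp_all add: U_def)
  then have "t *s (A *v u) = s *s (B *v u)"
    using st(2,3) by (simp add: vec.scale_right_distrib)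
  with st(1) show "u \<in> X" unfolding in_X_iff by blast
qed

text \<open>
  A matrix of determinant 0 is a product of a column \<open>(s, t)\<close> and a row \<open>(a, b)\<close>; the column is the point of the
  projective line under \<open>q\<close>, the row is the position of \<open>w\<close> in the plane.
\<close>

lemma in_X_U_E:
  assumes "q \<in> X" "q \<in> U" "q \<noteq> 0"
  obtains s t w a b where "(s, t) \<noteq> (0, 0)" "A *v q = s *s w" "B *v q = t *s w"
    "w = a *s \<alpha> + b *s \<beta>" "(a, b) \<noteq> (0, 0)"
    "y0 q = s * a" "y1 q = s * b" "y2 q = t * a" "y3 q = t * b"
proof -
  obtain s t w where st: "(s, t) \<noteq> (0, 0)" and q: "A *v q = s *s w" "B *v q = t *s w"
    using in_XE[OF assms(1)] by metis
  have U: "A *v q = y0 q *s \<alpha> + y1 q *s \<beta>" "B *v q = y2 q *s \<alpha> + y3 q *s \<beta>"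
    using assms(2) by (simp_all add: U_def)
  have "\<exists>a b. w = a *s \<alpha> + b *s \<beta>"
  proof (cases "s = 0")
    case True
    with st have "w = inverse t *s (B *v q)" by (simp add: q)
    then show ?thesis unfolding U by (metis vec.scale_right_distrib vec.scale_scale)
  next
    case False
    then have "w = inverse s *s (A *v q)" by (simp add: q)
    then show ?thesis unfolding U by (metis vec.scale_right_distrib vec.scale_scale)
  qed
  then obtain a b where w: "w = a *s \<alpha> + b *s \<beta>" by blast
  have "w \<noteq> 0" using pencil_inj[of q] assms(3) q by auto
  then have ab: "(a, b) \<noteq> (0, 0)" using w by auto
  have "A *v q = (s * a) *s \<alpha> + (s * b) *s \<beta>" "B *v q = (t * a) *s \<alpha> + (t * b) *s \<beta>"
    by (simp_all add: q w vec.scale_right_distrib)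
  note in_UI(2-5)[OF this]
  with that st q w ab show thesis by blast
qed

section \<open>The secant cone\<close>

text \<open>
  On the line, \<open>F\<close> restricts to \<open>\<mu> (\<mu> + \<nu> \<tau>)\<close> with \<open>\<tau> = polar p q\<close>.  If \<open>\<tau> \<noteq> 0\<close>, the second zero is another
  point of the scroll, because \<open>F\<close> cuts out the scroll in \<open>U\<close>.  If \<open>\<tau> = 0\<close>, the line is tangent to the scroll at \<open>q\<close>:
  for \<open>A q = s w\<close> and \<open>B q = t w\<close> with \<open>w = a A p + b B p\<close>, the equation \<open>\<tau> = s a + t b = 0\<close> says that \<open>w\<close> is proportional
  to \<open>t A p - s B p\<close>.
\<close>

lemma line_length_ge_2:
  assumes q: "q \<in> X" "q \<in> U" "q \<noteq> 0"
  shows "2 \<le> scheme_length (scheme_inter (vanishing_ideal X) (vanishing_ideal (vec.span {p, q})))"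
    (is "2 \<le> scheme_length ?Z")
proof (rule scheme_length_ge_2I)
  fix c and l :: "('v, 'k) mpol"
  assume adm: "\<And>u. u \<in> zero_set ?Z \<Longrightarrow> u \<noteq> 0 \<Longrightarrow> dot c u \<noteq> 0" and l: "\<And>u. eval l u = dot c u"
  let ?L = "vec.span {p, q}"
  have zero: "f \<in> ?Z \<Longrightarrow> u \<in> X \<Longrightarrow> u \<in> ?L \<Longrightarrow> u \<noteq> 0 \<Longrightarrow> eval f u = 0" for f u
    using eval_scheme_inter_vanishing by blast
  have cq: "dot c q \<noteq> 0"
    using q by (intro adm) (auto simp: zero_set_def intro: zero vec.span_base)
  have p_q: "p \<noteq> k *s q" for k using p_notin_X X_scale[OF q(1)] by metis
  let ?q = "inverse (dot c q) *s q"
  have q': "?q \<in> X" "?q \<in> ?L" "?q \<noteq> 0" "dot c ?q = 1"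
    using q cq by (auto simp: X_scale vec.span_scale vec.span_base dot_scale)
  show "2 \<le> quotient_dim (ideal.span (insert (l - 1) ?Z))"
  proof (cases "polar p q = 0")
    case False
    \<comment> \<open>the second zero of \<open>\<mu> (\<mu> + \<nu> polar p q)\<close> on the line\<close>
    define e where "e = polar p q *s p + (- 1) *s q"
    have "eval F e = 0"
      unfolding e_def eval_F_combination using q by (simp add: eval_F_p in_X_iff_F[symmetric])
    moreover have "e \<in> U" unfolding e_def by (rule U_combination[OF p_in_U q(2)])
    ultimately have e: "e \<in> X" "e \<in> ?L"
      by (simp add: in_X_iff_F, unfold e_def in_span_pair, blast)
    have e_q: "e \<noteq> k *s q" for k
    proof
      assume "e = k *s q"
      then have "polar p q *s p = (k + 1) *s q" by (simp add: e_def algebra_simps)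
      from arg_cong[OF this, of "\<lambda>x. inverse (polar p q) *s x"]
      have "p = (inverse (polar p q) * (k + 1)) *s q" using False by (simp add: algebra_simps)
      with p_q show False by blast
    qed
    then have "e \<noteq> 0" using e_q[of 0] by simp
    then have ce: "dot c e \<noteq> 0"
      using e by (intro adm) (auto simp: zero_set_def intro: zero)
    let ?e = "inverse (dot c e) *s e"
    show ?thesis
    proof (rule quotient_dim_ge_2_points)
      show "?q \<noteq> ?e"
      proof
        assume "?q = ?e"
        have "e = dot c e *s ?e" using ce by simp
        also have "\<dots> = (dot c e * inverse (dot c q)) *s q"
          by (simp only: \<open>?q = ?e\<close>[symmetric] vec.scale_scale)
        finally have "e = (dot c e * inverse (dot c q)) *s q" .
        with e_q show False by blast
      qed
      fix f assume f: "f \<in> ideal.span (insert (l - 1) ?Z)"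
      have "eval f x = 0" if "x \<in> X" "x \<in> ?L" "x \<noteq> 0" "dot c x = 1" for x
        using f by (rule eval_span_zero[rotated]) (use that zero l in \<open>auto simp: eval_simps\<close>)
      then show "eval f ?q = 0 \<and> eval f ?e = 0"
        using q' e ce \<open>e \<noteq> 0\<close> by (simp add: X_scale vec.span_scale dot_scale)
    qed
  next
    case True
    obtain s t w a b where st: "(s, t) \<noteq> (0, 0)" and Aq: "A *v q = s *s w" "B *v q = t *s w"
      and w: "w = a *s \<alpha> + b *s \<beta>" and ab: "(a, b) \<noteq> (0, 0)"
      and y: "y0 q = s * a" "y1 q = s * b" "y2 q = t * a" "y3 q = t * b"
      using in_X_U_E[OF q] by metis
    have orth: "s * a + t * b = 0" using True by (simp add: polar_def y y_simps algebra_simps)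
    obtain \<rho> where \<rho>: "a = \<rho> * t" "b = - (\<rho> * s)"
    proof (cases "t = 0")
      case True
      with st orth have "a = 0" "s \<noteq> 0" by auto
      then show thesis using True by (intro that[of "- b / s"]) auto
    next
      case False
      then have "b = - (s * a) / t" using orth by (simp add: field_simps eq_neg_iff_add_eq_0)
      then show thesis using False by (intro that[of "a / t"]) auto
    qed
    then have "\<rho> \<noteq> 0" using ab by auto
    then have tangent_p: "t *s \<alpha> - s *s \<beta> = inverse \<rho> *s w"
      by (simp add: w \<rho> vec_eq_iff field_simps)
    \<comment> \<open>The chart \<open>l = 1\<close> requires the base point normalised and the tangent vector in the kernel of \<open>l\<close>.\<close>
    let ?v = "p - (dot c p * inverse (dot c q)) *s q"
    have v: "t *s (A *v ?v) - s *s (B *v ?v) = dot c q * inverse \<rho> *s (inverse (dot c q) *s w)"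
      using tangent_p cq by (simp add: vec.diff vec.scale Aq vec_eq_iff algebra_simps)
    have v': "?v \<noteq> 0" "?v \<in> ?L" "dot c ?v = 0"
      using p_q cq by (auto simp: vec.span_diff vec.span_scale vec.span_base dot_simps)
    have jet: "jet_zero ?q ?v f" if "f \<in> vanishing_ideal X" for f
      by (rule tangent_to_X[OF st _ _ v that]) (simp_all add: vec.scale Aq ac_simps)
    show ?thesis
    proof (rule quotient_dim_ge_2_tangent)
      fix f assume "f \<in> ideal.span (insert (l - 1) ?Z)"
      then show "jet_zero ?q ?v f"
      proof (rule jet_zero_span[rotated])
        fix f assume "f \<in> insert (l - 1) ?Z"
        then show "jet_zero ?q ?v f"
          using jet_zero_dehomogenisation[OF l q'(4) v'(3)]
            jet_zero_scheme_inter[OF jet jet_zero_vanishing_subspace[OF vec.subspace_span q'(2) v'(2)] q'(3)]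
          by auto
      qed
    qed (use v' in auto)
  qed
qed

text \<open>
  Let \<open>w\<close> be the common direction of \<open>A q\<close> and \<open>B q\<close>.  If \<open>q\<close> is not in \<open>U\<close>, then \<open>A p\<close>, \<open>B p\<close> and \<open>w\<close> are
  independent, and suitable minors restrict to \<open>\<mu>\<^sup>2\<close> and \<open>\<mu> \<nu>\<close> on the line.  So the saturation contains the
  linear form \<open>\<mu>\<close>, and the intersection is the reduced point \<open>q\<close>.
\<close>

lemma line_length_le_1:
  assumes q: "q \<in> X" "q \<notin> U" "q \<noteq> 0"
  shows "scheme_length (scheme_inter (vanishing_ideal X) (vanishing_ideal (vec.span {p, q}))) \<le> 1"
    (is "scheme_length ?Z \<le> 1")
proof -
  let ?L = "vec.span {p, q}"
  obtain s t w where st: "(s, t) \<noteq> (0, 0)" and Aq: "A *v q = s *s w" "B *v q = t *s w"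
    using in_XE[OF q(1)] by metis
  have w: "w \<notin> vec.span {\<alpha>, \<beta>}"
  proof
    assume "w \<in> vec.span {\<alpha>, \<beta>}"
    then obtain a b where "w = a *s \<alpha> + b *s \<beta>" by (auto simp: in_span_pair)
    then have "q \<in> U" by (intro in_UI(1)[of _ "s * a" "s * b" "t * a" "t * b"])
      (simp_all add: Aq vec.scale_right_distrib)
    with q show False by simp
  qed
  obtain k where k: "dot k w = 1" "dot k \<alpha> = 0" "dot k \<beta> = 0" using dual_pair[OF w] by metis
  \<comment> \<open>functionals dual to \<open>\<alpha>, \<beta>, w\<close>\<close>
  define g' where "g' = g - dot g w *s k"
  define h' where "h' = h - dot h w *s k"
  have gh': "dot g' \<alpha> = 1" "dot g' \<beta> = 0" "dot g' w = 0" "dot h' \<alpha> = 0" "dot h' \<beta> = 1" "dot h' w = 0"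
    by (simp_all add: g'_def h'_def dot_commute[of "_ - _"] dot_simps dot_commute[of _ k] dot_commute[of _ g]
        dot_commute[of _ h] dual k)
  have on_L: "eval (minor g' h') (\<mu> *s p + \<nu> *s q) = \<mu> * \<mu>"
    "eval (minor g' k) (\<mu> *s p + \<nu> *s q) = \<mu> * \<nu> * t"
    "eval (minor h' k) (\<mu> *s p + \<nu> *s q) = - (\<mu> * \<nu> * s)" for \<mu> \<nu>
    by (simp_all add: eval_minor vec.add vec.scale Aq dot_simps gh' k)
  \<comment> \<open>Both \<open>t \<mu> \<nu>\<close> and \<open>- s \<mu> \<nu>\<close> are available, and one of \<open>s, t\<close> is nonzero.\<close>
  obtain r1 r2 where r: "r1 * t - r2 * s = 1"
  proof (cases "t = 0")
    case True
    then show thesis using st by (intro that[of 0 "- inverse s"]) auto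
  next
    case False
    then show thesis by (intro that[of "inverse t" 0]) auto
  qed
  have p_q: "p \<notin> vec.span {q, q}"
    using p_notin_X X_scale[OF q(1)] by (auto simp: vec.span_singleton)
  obtain m where m: "dot m p = 1" "dot m q = 0" using dual_pair[OF p_q] by metis
  have q_p: "q \<notin> vec.span {p, p}"
  proof
    assume "q \<in> vec.span {p, p}"
    then obtain c where c: "q = c *s p" by (auto simp: vec.span_singleton)
    then have "p = inverse c *s q" using q(3) by auto
    then show False using p_notin_X X_scale[OF q(1)] by metis
  qed
  obtain c where c: "dot c q = 1" "dot c p = 0" using dual_pair[OF q_p] by metis
  have m_in: "lin_form m \<in> ?Z"
  proof -
    have "Poly_Mapping.single x 1 * lin_form m \<in> ideal.span (vanishing_ideal X \<union> vanishing_ideal ?L)"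
      if "monom_deg x = 1" for x
    proof -
      obtain i where i: "x = Poly_Mapping.single i 1" using monom_deg_1[OF \<open>monom_deg x = 1\<close>] .
      let ?C = "\<lambda>r. Poly_Mapping.single 0 r :: ('v, 'k) mpol"
      let ?G = "?C (p $ i) * minor g' h' + ?C (q $ i * r1) * minor g' k + ?C (q $ i * r2) * minor h' k"
      have G: "?G \<in> ideal.span (vanishing_ideal X \<union> vanishing_ideal ?L)"
        by (intro ideal.span_add ideal.span_scale ideal.span_base UnI1 minor_in_vanishing_ideal)
      have diff: "Poly_Mapping.single x 1 * lin_form m - ?G \<in> vanishing_ideal ?L"
      proof -
        have "eval (Poly_Mapping.single x 1 * lin_form m - ?G) (\<mu> *s p + \<nu> *s q) = 0" for \<mu> \<nu>
        proof -
          have "eval (Poly_Mapping.single x 1 * lin_form m) (\<mu> *s p + \<nu> *s q) = (\<mu> * p $ i + \<nu> * q $ i) * \<mu>"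
            unfolding i eval_mult eval_single prod_power_single by (simp add: eval_lin_form dot_simps m)
          moreover have "eval ?G (\<mu> *s p + \<nu> *s q)
            = p $ i * (\<mu> * \<mu>) + q $ i * \<mu> * \<nu> * (r1 * t - r2 * s)"
            unfolding eval_add eval_mult eval_const on_L by (simp add: algebra_simps)
          ultimately show ?thesis by (simp add: eval_diff r algebra_simps)
        qed
        then show ?thesis by (auto simp: vanishing_ideal_def in_span_pair)
      qed
      from ideal.span_add[OF G ideal.span_base[OF UnI2[OF diff]]] show ?thesis by simp
    qed
    then show ?thesis unfolding scheme_inter_def saturation_def by blast
  qed
  have adm: "dot c u \<noteq> 0" if "u \<in> zero_set ?Z" "u \<noteq> 0" for u
  proof -
    have "u \<in> ?L" using that zero_set_scheme_inter_subset[of X ?L] zero_set_vanishing_ideal_subspace[OF vec.subspace_span] by blast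
    then obtain \<mu> \<nu> where u: "u = \<mu> *s p + \<nu> *s q" by (auto simp: in_span_pair)
    have "eval (lin_form m) u = 0" using m_in that by (auto simp: zero_set_def)
    then have "\<mu> = 0" by (simp add: eval_lin_form u dot_simps m)
    then show ?thesis using that(2) by (auto simp: u dot_simps c)
  qed
  have "quotient_dim (ideal.span (insert (lin_form c - 1) ?Z)) \<le> enat CARD(1)"
  proof (rule quotient_dim_le[where b = "\<lambda>_. 1"])
    fix f :: "('v, 'k) mpol"
    let ?J = "ideal.span (insert (lin_form c - 1) ?Z)"
    \<comment> \<open>\<open>u = q + (l u - 1) q + m u p\<close> on the line, and both correction terms are in the ideal\<close>
    obtain h1 where h1: "polyfun h1"
      "\<And>u. eval f (q + (dot c u - 1) *s q + dot m u *s p) = eval f (q + (dot c u - 1) *s q) + dot m u * h1 u"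
    proof -
      have "polyfun (\<lambda>u. (q + (dot c u - 1) *s q) $ i)" for i
        by (simp, intro polyfun_add polyfun_mult polyfun_diff polyfun_const polyfun_dot)
      from polyfun_shift[OF polyfun_eval this polyfun_dot[of m], of f p] that show thesis by blast
    qed
    obtain h2 where h2: "polyfun h2"
      "\<And>u. eval f (q + (dot c u - 1) *s q) = eval f q + (dot c u - 1) * h2 u"
      using polyfun_shift[where g = "eval f" and a = "\<lambda>_. q" and b = "\<lambda>u. dot c u - 1" and e = q,
          OF polyfun_eval polyfun_const polyfun_diff[OF polyfun_dot polyfun_const]]
      by blast
    obtain H1 H2 where H: "h1 = eval H1" "h2 = eval H2" using h1(1) h2(1) by (auto simp: polyfun_def)
    have "f - Poly_Mapping.single 0 (eval f q) - H2 * (lin_form c - 1) - H1 * lin_form m \<in> vanishing_ideal ?L"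
    proof -
      have "eval f (\<mu> *s p + \<nu> *s q) = eval f q + (\<nu> - 1) * h2 (\<mu> *s p + \<nu> *s q) + \<mu> * h1 (\<mu> *s p + \<nu> *s q)" for \<mu> \<nu>
      proof -
        have "q + (\<nu> - 1) *s q + \<mu> *s p = \<mu> *s p + \<nu> *s q" by (simp add: algebra_simps)
        then show ?thesis using h1(2)[of "\<mu> *s p + \<nu> *s q"] h2(2)[of "\<mu> *s p + \<nu> *s q"]
          by (simp add: dot_simps m c add.commute[of "\<mu> *s p"])
      qed
      then show ?thesis
        by (auto simp: vanishing_ideal_def in_span_pair eval_simps eval_lin_form dot_simps m c H algebra_simps)
    qed
    then have "(f - Poly_Mapping.single 0 (eval f q) - H2 * (lin_form c - 1) - H1 * lin_form m)
        + H2 * (lin_form c - 1) + H1 * lin_form m \<in> ?J"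
      using scheme_inter_superset(2)[of "vanishing_ideal ?L" "vanishing_ideal X"] m_in
      by (intro ideal.span_add ideal.span_scale ideal.span_base) auto
    then show "\<exists>d. f - (\<Sum>i\<in>(UNIV :: 1 set). Poly_Mapping.single 0 (d i) * 1) \<in> ?J"
      by (intro exI[of _ "\<lambda>_. eval f q"]) simp
  qed (rule ideal.subspace_span)
  then have "quotient_dim (ideal.span (insert (lin_form c - 1) ?Z)) \<le> 1" by (simp add: one_enat_def)
  with adm show ?thesis by (rule scheme_length_le)
qed

text \<open>
  The restriction of \<open>F\<close> to the line through \<open>p\<close> and \<open>u\<close> has a zero since the field is algebraically closed, and
  it is not at \<open>p\<close>.
\<close>

lemma point_on_secant:
  assumes u: "u \<in> U" "u \<notin> vec.span {p}"
  obtains q where "q \<in> X" "q \<in> U" "q \<noteq> 0" "u \<in> vec.span {p, q}"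
proof -
  let ?P = "[:eval F u, polar p u, 1:]"
  obtain \<mu> where "poly ?P \<mu> = 0" using alg_closed_imp_poly_has_root[of ?P] by auto
  then have F0: "eval F (\<mu> *s p + 1 *s u) = 0"
    unfolding eval_F_combination by (simp add: eval_F_p algebra_simps)
  have U: "\<mu> *s p + 1 *s u \<in> U" by (rule U_combination[OF p_in_U u(1)])
  have "\<mu> *s p + 1 *s u \<noteq> 0"
  proof
    assume "\<mu> *s p + 1 *s u = 0"
    then have "u = (- \<mu>) *s p" by (simp add: eq_neg_iff_add_eq_0 add.commute)
    then show False using u(2) vec.span_scale[OF vec.span_base[of p "{p}"], of "- \<mu>"] by simp
  qed
  moreover have "u \<in> vec.span {p, \<mu> *s p + 1 *s u}"
    unfolding in_span_pair by (rule exI[of _ "- \<mu>"], rule exI[of _ 1]) simp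
  ultimately show thesis using that U F0 in_X_iff_F[OF U] by blast
qed

lemma secant_cone_eq_U:
  assumes "\<not> U \<subseteq> vec.span {p}"
  shows "secant_cone X p = U"
proof -
  let ?Q = "{q \<in> X. q \<noteq> 0 \<and>
     2 \<le> scheme_length (scheme_inter (vanishing_ideal X) (vanishing_ideal (vec.span {p, q})))}"
  have "\<not> 2 \<le> (x :: enat)" if "x \<le> 1" for x
    using that by (metis not_le one_less_numeral_iff order.strict_trans1 semiring_norm(76))
  then have Q: "?Q = X \<inter> U - {0}" using line_length_ge_2 line_length_le_1 by blast
  have reach: "\<exists>q\<in>?Q. u \<in> vec.span {p, q}" if "u \<in> U" "u \<notin> vec.span {p}" for u
    unfolding Q using point_on_secant[OF that] by (metis DiffI IntI singletonD)
  obtain u0 where u0: "u0 \<in> U" "u0 \<notin> vec.span {p}" using assms by blast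
  then obtain q0 where q0: "q0 \<in> ?Q" using reach by blast
  have "(\<Union>q\<in>?Q. vec.span {p, q}) = U"
  proof
    show "(\<Union>q\<in>?Q. vec.span {p, q}) \<subseteq> U"
    proof (rule UN_least)
      fix q assume "q \<in> ?Q"
      then have "q \<in> U" unfolding Q by simp
      then show "vec.span {p, q} \<subseteq> U" using p_in_U by (intro vec.span_minimal subspace_U) auto
    qed
    show "U \<subseteq> (\<Union>q\<in>?Q. vec.span {p, q})"
    proof
      fix u assume "u \<in> U"
      show "u \<in> (\<Union>q\<in>?Q. vec.span {p, q})"
      proof (cases "u \<in> vec.span {p}")
        case True
        then have "u \<in> vec.span {p, q0}" using vec.span_mono[of "{p}" "{p, q0}"] by blast
        then show ?thesis using q0 by blast
      qed (use reach \<open>u \<in> U\<close> in blast)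
    qed
  qed
  moreover have "?Q \<noteq> {}" using q0 by blast
  ultimately show ?thesis unfolding secant_cone_def by (simp only: Let_def if_False)
qed

section \<open>Reduced secant loci\<close>

abbreviation "Z \<equiv> scheme_inter (vanishing_ideal X) (vanishing_ideal U)"

text \<open>
  The homogeneous ideal by which \<open>F = 0\<close> is a quadric hypersurface in the linear space of \<open>U\<close>.
\<close>

definition quadric_ideal :: "('v, 'k) mpol set" where
  "quadric_ideal = ideal.span (insert F (vanishing_ideal U))"

lemma y_dot: "y0 u = dot (g v* A) u" "y1 u = dot (h v* A) u" "y2 u = dot (g v* B) u" "y3 u = dot (h v* B) u"
  by (simp_all add: y_defs dot_matrix_vector)

lemma quadric_idealI:
  "polyfun r \<Longrightarrow> (\<And>u. u \<in> U \<Longrightarrow> eval f u = eval F u * r u) \<Longrightarrow> f \<in> quadric_ideal"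
  unfolding quadric_ideal_def by (rule mem_span_insert_vanishing)

lemma saturation_quadric_ideal_subset: "saturation quadric_ideal \<subseteq> Z"
  unfolding quadric_ideal_def scheme_inter_def
  by (intro saturation_mono ideal.span_mono) (use F_in_vanishing_ideal in auto)

lemma Z_vanishes:
  assumes q: "q \<in> X \<inter> U" "q \<noteq> 0" shows "Z \<subseteq> vanishing_ideal (X \<inter> U)"
proof
  fix f assume f: "f \<in> Z"
  have nz: "eval f u = 0" if "u \<in> X \<inter> U" "u \<noteq> 0" for u
    using eval_scheme_inter_vanishing[of u X U f] that f by blast
  have "eval f 0 = 0"
    by (rule eval_0_of_line[of f q], rule nz) (use q in \<open>auto simp: X_scale vec.subspace_scale[OF subspace_U]\<close>)
  with nz show "f \<in> vanishing_ideal (X \<inter> U)" unfolding vanishing_ideal_def by blast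
qed

lemma zero_set_Z:
  assumes "q \<in> X \<inter> U" "q \<noteq> 0" shows "zero_set Z = X \<inter> U"
proof
  show "zero_set Z \<subseteq> X \<inter> U"
  proof
    fix u assume "u \<in> zero_set Z"
    then have "u \<in> zero_set (vanishing_ideal X)" "u \<in> U"
      using zero_set_scheme_inter_subset[of X U] zero_set_vanishing_ideal_subspace[OF subspace_U] by auto
    moreover from this have "eval F u = 0" using F_in_vanishing_ideal by (simp add: zero_set_def)
    ultimately show "u \<in> X \<inter> U" by (simp add: in_X_iff_F)
  qed
  show "X \<inter> U \<subseteq> zero_set Z"
    using Z_vanishes[OF assms] by (auto simp: zero_set_def vanishing_ideal_def)
qed

text \<open>
  The secant locus is squeezed between the quadric in \<open>U\<close> and its set of points.
\<close>

lemma Z_reduced: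
  assumes "q \<in> X \<inter> U" "q \<noteq> 0"
    and red: "\<And>f. f \<in> vanishing_ideal (X \<inter> U) \<Longrightarrow> f \<in> saturation quadric_ideal"
  shows "Z = vanishing_ideal (X \<inter> U)" "Z = saturation quadric_ideal"
  using Z_vanishes[OF assms(1,2)] saturation_quadric_ideal_subset red by auto

text \<open>
  The coefficients of the linear form \<open>polar e\<close>, whose zero set is the tangent hyperplane if \<open>e\<close> is
  on the quadric.
\<close>

definition polar_vec :: "'k ^ 'v \<Rightarrow> 'k ^ 'v" where
  "polar_vec e = y0 e *s (h v* B) + y3 e *s (g v* A) - y1 e *s (g v* B) - y2 e *s (h v* A)"

lemma dot_polar_vec: "dot (polar_vec e) u = polar e u"
  by (simp add: polar_vec_def polar_def dot_lin_form_coeffs y_dot)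

abbreviation "polar_form e \<equiv> lin_form (polar_vec e)"

lemma eval_polar_form: "eval (polar_form e) u = polar e u"
  by (simp add: eval_lin_form dot_polar_vec)

text \<open>
  The line through \<open>e\<close> and \<open>u\<close> meets the quadric again in \<open>\<rho> u = polar e u \<cdot> u - F u \<cdot> e\<close>.  Every homogeneous part of
  \<open>f\<close>, of degree \<open>d\<close>, vanishes at \<open>\<rho> u\<close>, so by Taylor expansion \<open>F\<close> divides its value at \<open>polar e u \<cdot> u\<close>, which is
  \<open>(polar e u)\<^sup>d\<close> times its value at \<open>u\<close>.
\<close>

lemma polar_form_in_radical_colon:
  assumes e: "e \<in> X \<inter> U" and f: "f \<in> vanishing_ideal (X \<inter> U)"
  shows "polar_form e \<in> radical_colon quadric_ideal f"
proof -
  obtain D where D: "f = (\<Sum>d\<le>D. homogeneous_part d f)" using sum_homogeneous_part by blast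
  have part_zero: "eval (homogeneous_part d f) x = 0" if "d \<le> D" "x \<in> X \<inter> U" for d x
    by (rule eval_homogeneous_part_cone[OF D that(1)])
      (use that(2) f in \<open>auto simp: vanishing_ideal_def X_scale vec.subspace_scale[OF subspace_U]\<close>)
  define \<rho> where "\<rho> u = polar e u *s u + eval F u *s (- e)" for u
  have \<rho>: "\<rho> u \<in> X \<inter> U" if u: "u \<in> U" for u
  proof -
    have \<rho>': "\<rho> u = polar e u *s u + (- eval F u) *s e" by (simp add: \<rho>_def)
    have "eval F (\<rho> u) = 0"
      using e in_X_iff_F[of e] unfolding \<rho>' eval_F_combination
      by (simp add: polar_commute[of u e] algebra_simps)
    moreover have "\<rho> u \<in> U" unfolding \<rho>' using u e by (intro U_combination) auto
    ultimately show ?thesis by (simp add: in_X_iff_F)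
  qed
  have "\<exists>r. polyfun r \<and> (\<forall>u\<in>U. polar e u ^ d * eval (homogeneous_part d f) u = eval F u * r u)"
    if d: "d \<le> D" for d
  proof -
    have "polyfun (\<lambda>u. (polar e u *s u) $ i)" for i
      by (simp add: dot_polar_vec[symmetric], intro polyfun_mult polyfun_dot polyfun_coord)
    from polyfun_shift[OF polyfun_eval this polyfun_eval, of "homogeneous_part d f" F "- e"]
    obtain r where r: "polyfun r" "\<And>u. eval (homogeneous_part d f) (\<rho> u)
        = eval (homogeneous_part d f) (polar e u *s u) + eval F u * r u"
      unfolding \<rho>_def by blast
    have "polar e u ^ d * eval (homogeneous_part d f) u = eval F u * - r u" if "u \<in> U" for u
      using r(2)[of u] part_zero[OF d \<rho>[OF that]]
      by (simp add: eval_homogeneous_part_scale eq_neg_iff_add_eq_0)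
    then show ?thesis using polyfun_uminus[OF r(1)] by blast
  qed
  then obtain r where r: "\<And>d. d \<le> D \<Longrightarrow> polyfun (r d)"
    "\<And>d u. d \<le> D \<Longrightarrow> u \<in> U \<Longrightarrow> polar e u ^ d * eval (homogeneous_part d f) u = eval F u * r d u"
    by metis
  have "polar_form e ^ D * f \<in> quadric_ideal"
  proof (rule quadric_idealI)
    show "polyfun (\<lambda>u. \<Sum>d\<le>D. dot (polar_vec e) u ^ (D - d) * r d u)"
      by (intro polyfun_sum polyfun_mult polyfun_power polyfun_dot) (simp add: r)
    fix u assume u: "u \<in> U"
    have "eval (polar_form e ^ D * f) u = (\<Sum>d\<le>D. polar e u ^ D * eval (homogeneous_part d f) u)"
      by (subst (1) D) (simp only: eval_mult eval_power eval_polar_form eval_sum sum_distrib_left)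
    also have "\<dots> = (\<Sum>d\<le>D. polar e u ^ (D - d) * (polar e u ^ d * eval (homogeneous_part d f) u))"
      by (intro sum.cong refl) (simp add: mult.assoc[symmetric] power_add[symmetric])
    also have "\<dots> = (\<Sum>d\<le>D. polar e u ^ (D - d) * (eval F u * r d u))"
      by (intro sum.cong refl) (simp add: r u)
    also have "\<dots> = eval F u * (\<Sum>d\<le>D. dot (polar_vec e) u ^ (D - d) * r d u)"
      by (simp add: sum_distrib_left dot_polar_vec ac_simps)
    finally show "eval (polar_form e ^ D * f) u = eval F u * (\<Sum>d\<le>D. dot (polar_vec e) u ^ (D - d) * r d u)" .
  qed
  then show ?thesis by (auto simp: radical_colon_def)
qed

lemma subspace_quadric_ideal: "ideal.subspace quadric_ideal"
  unfolding quadric_ideal_def by (rule ideal.subspace_span)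

lemma radical_colon_transfer:
  assumes "c \<in> radical_colon quadric_ideal f" "\<And>u. u \<in> U \<Longrightarrow> eval c' u = eval c u"
  shows "c' \<in> radical_colon quadric_ideal f"
proof -
  have "c' - c \<in> quadric_ideal"
    unfolding quadric_ideal_def using assms(2)
    by (intro ideal.span_base) (simp add: vanishing_ideal_def eval_diff)
  then have "(c' - c) + c \<in> radical_colon quadric_ideal f"
    by (intro radical_colon_add[OF subspace_quadric_ideal] radical_colon_superset[OF subspace_quadric_ideal] assms(1))
  then show ?thesis by simp
qed

text \<open>
  If the elements of the radical provide linear coordinates on \<open>U\<close>, then all variables lie in it.
\<close>

lemma saturation_quadric_idealI:
  assumes S: "finite S" and c: "\<And>x. x \<in> S \<Longrightarrow> c x \<in> radical_colon quadric_ideal f"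
    and U: "\<And>u. u \<in> U \<Longrightarrow> u = (\<Sum>x\<in>S. eval (c x) u *s e x)"
  shows "f \<in> saturation quadric_ideal"
proof (rule saturationI_radical_colon[OF subspace_quadric_ideal])
  fix v
  let ?c = "\<Sum>x\<in>S. Poly_Mapping.single 0 (e x $ v) * c x"
  show "Poly_Mapping.single (Poly_Mapping.single v 1) 1 \<in> radical_colon quadric_ideal f"
  proof (rule radical_colon_transfer)
    show "?c \<in> radical_colon quadric_ideal f"
      by (intro radical_colon_sum[OF subspace_quadric_ideal] radical_colon_mult[OF subspace_quadric_ideal] c)
    fix u assume "u \<in> U"
    then have "u $ v = (\<Sum>x\<in>S. eval (c x) u *s e x) $ v" using U by metis
    then show "eval (Poly_Mapping.single (Poly_Mapping.single v 1) 1) u = eval ?c u"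
      unfolding eval_single prod_power_single by (simp add: eval_simps mult.commute)
  qed
qed

text \<open>
  A tangent vector of the secant locus at \<open>u\<close> is a vector of \<open>U\<close> on which the derivative \<open>polar u\<close> of \<open>F\<close> vanishes.
  These form a hyperplane of \<open>U\<close> unless \<open>polar u\<close> is zero on \<open>U\<close>.
\<close>

lemma smooth_quadric_Z:
  assumes q: "q \<in> X \<inter> U" "q \<noteq> 0"
    and red: "\<And>f. f \<in> vanishing_ideal (X \<inter> U) \<Longrightarrow> f \<in> saturation quadric_ideal"
    and nondeg: "\<And>u. u \<in> X \<inter> U \<Longrightarrow> u \<noteq> 0 \<Longrightarrow> \<exists>e\<in>U. polar u e \<noteq> 0"
  shows "smooth_quadric_in U Z"
  unfolding smooth_quadric_in_def
proof (intro conjI ballI impI exI)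
  show "homogeneous 2 F" unfolding F_def by (rule homogeneous_minor)
  show "F \<notin> vanishing_ideal U" using p_in_U eval_F_p by (force simp: vanishing_ideal_def)
  show Z: "Z = saturation (ideal.span (insert F (vanishing_ideal U)))"
    using Z_reduced(2)[OF q red] by (simp add: quadric_ideal_def)
  fix u assume "u \<in> zero_set Z" and u0: "u \<noteq> 0"
  then have u: "u \<in> X" "u \<in> U" using zero_set_Z[OF q] by auto
  have jet_F: "jet_zero u w F" if "polar u w = 0" for w
  proof -
    have "pullback F (tangent_line u w) = [:0, 0, eval F w:]"
      using eval_F_combination[of 1 u _ w] u that
      by (intro poly_eqI_values) (simp add: poly_pullback curve_at_tangent_line in_X_iff_F)
    then show ?thesis by (simp add: jet_zero_def)
  qed
  have deriv: "w \<in> tangent_space Z u \<longleftrightarrow> (\<forall>f\<in>Z. jet_zero u w f)" for w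
    using \<open>u \<in> zero_set Z\<close> by (auto simp: tangent_space_def jet_zero_iff zero_set_def)
  have "tangent_space Z u = {w \<in> U. dot (polar_vec u) w = 0}"
  proof (intro set_eqI iffI)
    fix w assume "w \<in> tangent_space Z u"
    then have jet: "jet_zero u w f" if "f \<in> Z" for f using deriv that by blast
    have "w \<in> U"
    proof (rule ccontr)
      assume "w \<notin> U"
      then obtain c where c: "\<And>u. u \<in> U \<Longrightarrow> dot c u = 0" "dot c w = 1"
        using separating_functional[OF subspace_U] by blast
      then have "lin_form c \<in> vanishing_ideal U" by (simp add: vanishing_ideal_def eval_lin_form)
      then have "jet_zero u w (lin_form c)" by (intro jet subsetD[OF scheme_inter_superset(2)])
      moreover have "pullback (lin_form c) (tangent_line u w) = [:0, 1:]"
        by (rule poly_eqI_values) (simp add: poly_pullback curve_at_tangent_line eval_lin_form dot_simps c u)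
      ultimately show False by (simp add: jet_zero_def)
    qed
    moreover have "polar u w = 0"
    proof -
      have "pullback F (tangent_line u w) = [:0, polar u w, eval F w:]"
        using eval_F_combination[of 1 u _ w] u
        by (intro poly_eqI_values) (simp add: poly_pullback curve_at_tangent_line in_X_iff_F algebra_simps)
      moreover have "F \<in> Z" by (rule subsetD[OF scheme_inter_superset(1) F_in_vanishing_ideal])
      ultimately show ?thesis using jet[of F] by (simp add: jet_zero_def)
    qed
    ultimately show "w \<in> {w \<in> U. dot (polar_vec u) w = 0}" by (simp add: dot_polar_vec)
  next
    fix w assume w: "w \<in> {w \<in> U. dot (polar_vec u) w = 0}"
    have base: "jet_zero u w f" if "f \<in> insert F (vanishing_ideal U)" for f
      using that jet_F w jet_zero_vanishing_subspace[OF subspace_U u(2)] by (auto simp: dot_polar_vec)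
    have "jet_zero u w f" if "f \<in> Z" for f
      by (rule jet_zero_saturation[OF jet_zero_span[OF base] u0]) (use that Z in simp_all)
    then show "w \<in> tangent_space Z u" using deriv by blast
  qed
  moreover obtain e where "e \<in> U" "polar u e \<noteq> 0" using nondeg u u0 by blast
  ultimately show "vec.dim (tangent_space Z u) = vec.dim U - 1"
    using dim_hyperplane[OF subspace_U, of e "polar_vec u"] by (simp add: dot_polar_vec)
qed

section \<open>The linear space of the secant cone\<close>

definition coord :: "'k ^ 'v ^ 4" where
  "coord = vector [g v* A, h v* A, g v* B, h v* B]"

lemma coord_nth:
  "(coord *v u) $ 1 = y0 u" "(coord *v u) $ 2 = y1 u" "(coord *v u) $ 3 = y2 u" "(coord *v u) $ 4 = y3 u"
  by (simp_all add: matrix_vector_nth coord_def vector_4 y_dot)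

lemma coord_eq_iff: "coord *v u = vector [a, b, c, d] \<longleftrightarrow> y0 u = a \<and> y1 u = b \<and> y2 u = c \<and> y3 u = d"
  by (simp add: vec_eq_iff forall_4 coord_nth vector_4)

lemma dim_coord_image: "vec.dim ((*v) coord ` U) = vec.dim U"
proof (rule vec.dim_image_eq)
  show "inj_on ((*v) coord) (vec.span U)"
    unfolding vec.span_eq_iff[THEN iffD2, OF subspace_U]
    by (rule inj_onI) (auto simp: vec_eq_iff[where 'b = 4] forall_4 coord_nth intro: U_eqI)
qed simp

lemma dim_U_le: "vec.dim U \<le> 4"
  using vec.dim_subset[of "(*v) coord ` U" UNIV]
  by (simp add: dim_coord_image vec_dim_card card_cart_basis)

lemma subspace_coord_image: "vec.subspace ((*v) coord ` U)"
  using subspace_U by (rule vec.subspace_image)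

lemma coord_surj:
  assumes "vec.dim U = 4"
  obtains u where "u \<in> U" "y0 u = a" "y1 u = b" "y2 u = c" "y3 u = d"
proof -
  have "(*v) coord ` U = UNIV"
    using assms by (intro vec.subspace_dim_equal subspace_coord_image)
      (auto simp: dim_coord_image vec_dim_card card_cart_basis)
  then have "vector [a, b, c, d] \<in> (*v) coord ` U" by simp
  then show thesis using that by (auto simp: coord_eq_iff eq_commute[of "vector _"])
qed

text \<open>
  A space of matrices of dimension 3 is the zero set of a single linear form.
\<close>

lemma coord_relation:
  assumes "vec.dim U = 3"
  obtains n0 n1 n2 n3 where "(n0, n1, n2, n3) \<noteq> (0, 0, 0, 0)"
    "\<And>u. u \<in> U \<Longrightarrow> n0 * y0 u + n1 * y1 u + n2 * y2 u + n3 * y3 u = 0"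
    "\<And>a b c d. n0 * a + n1 * b + n2 * c + n3 * d = 0 \<Longrightarrow>
       \<exists>u\<in>U. y0 u = a \<and> y1 u = b \<and> y2 u = c \<and> y3 u = d"
proof -
  let ?Y = "(*v) coord ` U"
  have "?Y \<noteq> UNIV"
  proof
    assume "?Y = UNIV"
    then have "vec.dim U = 4" using dim_coord_image by (simp add: vec_dim_card card_cart_basis)
    with assms show False by simp
  qed
  then obtain e where "e \<notin> ?Y" by blast
  then obtain m where m: "\<And>u. u \<in> ?Y \<Longrightarrow> dot m u = 0" "dot m e = 1"
    using separating_functional[OF subspace_coord_image] by blast
  have "vec.dim {u \<in> UNIV. dot m u = 0} = 3"
    using m(2) by (subst dim_hyperplane[of _ e]) (auto simp: vec_dim_card card_cart_basis)
  then have Y: "?Y = {u. dot m u = 0}"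
    using subspace_hyperplane[OF vec.subspace_UNIV, of m] m(1) assms
    by (intro vec.subspace_dim_equal subspace_coord_image) (auto simp: dim_coord_image)
  show thesis
  proof
    show "(m $ 1, m $ 2, m $ 3, m $ 4) \<noteq> (0, 0, 0, 0)" using m(2) by (auto simp: dot_4)
    show "m $ 1 * y0 u + m $ 2 * y1 u + m $ 3 * y2 u + m $ 4 * y3 u = 0" if "u \<in> U" for u
      using m(1)[of "coord *v u"] that by (simp add: dot_4 coord_nth)
    show "\<exists>u\<in>U. y0 u = a \<and> y1 u = b \<and> y2 u = c \<and> y3 u = d"
      if "m $ 1 * a + m $ 2 * b + m $ 3 * c + m $ 4 * d = 0" for a b c d
    proof -
      have "vector [a, b, c, d] \<in> ?Y" unfolding Y using that by (simp add: dot_4 vector_4)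
      then show ?thesis by (auto simp: coord_eq_iff eq_commute[of "vector _"])
    qed
  qed
qed

section \<open>Classification of the secant loci\<close>

text \<open>
  Here \<open>U\<close> consists of all \<open>2 \<times> 2\<close> matrices, and the elementary matrices are four points of the quadric whose
  polar forms are the four coordinates up to sign.
\<close>

lemma smooth_quadric_surface:
  assumes "vec.dim U = 4"
  shows "smooth_quadric_in U Z"
proof -
  obtain e0 where e0: "e0 \<in> U" "y0 e0 = 1" "y1 e0 = 0" "y2 e0 = 0" "y3 e0 = 0" by (rule coord_surj[OF assms])
  obtain e1 where e1: "e1 \<in> U" "y0 e1 = 0" "y1 e1 = 1" "y2 e1 = 0" "y3 e1 = 0" by (rule coord_surj[OF assms])
  obtain e2 where e2: "e2 \<in> U" "y0 e2 = 0" "y1 e2 = 0" "y2 e2 = 1" "y3 e2 = 0" by (rule coord_surj[OF assms])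
  obtain e3 where e3: "e3 \<in> U" "y0 e3 = 0" "y1 e3 = 0" "y2 e3 = 0" "y3 e3 = 1" by (rule coord_surj[OF assms])
  note e = e0 e1 e2 e3
  have polar_e: "polar e0 u = y3 u" "polar e1 u = - y2 u" "polar e2 u = - y1 u" "polar e3 u = y0 u" for u
    by (simp_all add: polar_def e)
  have in_X: "e0 \<in> X \<inter> U" "e1 \<in> X \<inter> U" "e2 \<in> X \<inter> U" "e3 \<in> X \<inter> U"
    by (simp_all add: in_X_iff_F eval_F e)
  show ?thesis
  proof (rule smooth_quadric_Z[OF in_X(1)])
    show "e0 \<noteq> 0" using e0 by (auto simp: y_simps)
    show "\<exists>e\<in>U. polar u e \<noteq> 0" if "u \<in> X \<inter> U" "u \<noteq> 0" for u
    proof (rule ccontr)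
      assume "\<not> (\<exists>e\<in>U. polar u e \<noteq> 0)"
      then have "polar e0 u = 0" "polar e1 u = 0" "polar e2 u = 0" "polar e3 u = 0"
        using e by (simp_all add: polar_commute[of _ u])
      then have "u = 0" using that
        by (intro U_eqI) (simp_all add: polar_e y_simps vec.subspace_0[OF subspace_U])
      with that show False by simp
    qed
    fix f assume f: "f \<in> vanishing_ideal (X \<inter> U)"
    let ?L = "[(polar_form e3, e0), (polar_form e2, - e1), (polar_form e1, - e2), (polar_form e0, e3)]"
    show "f \<in> saturation quadric_ideal"
    proof (rule saturation_quadric_idealI[of "{..<4::nat}" "\<lambda>i. fst (?L ! i)" f "\<lambda>i. snd (?L ! i)"])
      show "fst (?L ! i) \<in> radical_colon quadric_ideal f" if "i \<in> {..<4}" for i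
        using that polar_form_in_radical_colon[OF in_X(1) f] polar_form_in_radical_colon[OF in_X(2) f]
          polar_form_in_radical_colon[OF in_X(3) f] polar_form_in_radical_colon[OF in_X(4) f]
        by (auto simp: less_Suc_eq numeral_eq_Suc)
      fix u assume u: "u \<in> U"
      have "u = y0 u *s e0 + y1 u *s e1 + y2 u *s e2 + y3 u *s e3"
        using u e by (intro U_eqI) (simp_all add: y_simps vec.subspace_add[OF subspace_U] vec.subspace_scale[OF subspace_U])
      then show "u = (\<Sum>i\<in>{..<4}. eval (fst (?L ! i)) u *s snd (?L ! i))"
        by (simp add: numeral_eq_Suc eval_polar_form polar_e)
    qed simp
  qed
qed

text \<open>
  Let the relation between the coordinates be \<open>trace (N y) = 0\<close> with an invertible matrix \<open>N\<close>.  Then \<open>z = N y\<close> is traceless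
  and the determinant becomes \<open>- (z0\<^sup>2 + z1 z2)\<close>, a smooth conic in every characteristic.  The polar forms of the two points
  \<open>z0 = z1 = 0\<close> and \<open>z0 = z2 = 0\<close> are \<open>z1\<close> and \<open>z2\<close> up to sign.  In characteristic 2 the form \<open>z0\<close> is not a
  polar form, but in every characteristic the equation expresses its square by \<open>z1\<close> and \<open>F\<close>.
\<close>

lemma smooth_conic:
  assumes rel: "\<And>u. u \<in> U \<Longrightarrow> n0 * y0 u + n1 * y1 u + n2 * y2 u + n3 * y3 u = 0"
    and surj: "\<And>a b c d. n0 * a + n1 * b + n2 * c + n3 * d = 0 \<Longrightarrow>
       \<exists>u\<in>U. y0 u = a \<and> y1 u = b \<and> y2 u = c \<and> y3 u = d"
    and det: "n0 * n3 - n1 * n2 \<noteq> 0"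
  shows "smooth_quadric_in U Z"
proof -
  let ?D = "n0 * n3 - n1 * n2"
  \<comment> \<open>the product of the matrices of \<open>n\<close> and \<open>y\<close> is traceless on \<open>U\<close>\<close>
  define z0 where "z0 u = n0 * y0 u + n2 * y2 u" for u
  define z1 where "z1 u = n0 * y1 u + n2 * y3 u" for u
  define z2 where "z2 u = n1 * y0 u + n3 * y2 u" for u
  have z3: "n1 * y1 u + n3 * y3 u = - z0 u" if "u \<in> U" for u
    using rel[OF that] by (simp add: z0_def eq_neg_iff_add_eq_0 algebra_simps)
  have y_z: "?D * y0 u = n3 * z0 u - n2 * z2 u" "?D * y1 u = n3 * z1 u + n2 * z0 u"
    "?D * y2 u = n0 * z2 u - n1 * z0 u" "?D * y3 u = - n1 * z1 u - n0 * z0 u" if "u \<in> U" for u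
  proof -
    have z0: "z0 u = - (n1 * y1 u + n3 * y3 u)" using z3[OF that] by simp
    show "?D * y0 u = n3 * z0 u - n2 * z2 u" "?D * y2 u = n0 * z2 u - n1 * z0 u"
      by (simp_all add: z0_def z2_def algebra_simps)
    show "?D * y1 u = n3 * z1 u + n2 * z0 u" "?D * y3 u = - n1 * z1 u - n0 * z0 u"
      by (simp_all add: z0 z1_def algebra_simps)
  qed
  have F_z: "?D * eval F u = - (z0 u * z0 u + z1 u * z2 u)" if "u \<in> U" for u
  proof -
    have "?D * eval F u = z0 u * (n1 * y1 u + n3 * y3 u) - z1 u * z2 u"
      by (simp add: eval_F z0_def z1_def z2_def algebra_simps)
    then show ?thesis by (simp add: z3[OF that])
  qed
  \<comment> \<open>\<open>e0, e1, e2\<close> is the basis dual to \<open>z0, z1, z2\<close> up to the factor \<open>?D\<close>.\<close>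
  obtain e0 where e0: "e0 \<in> U" "y0 e0 = n3" "y1 e0 = n2" "y2 e0 = - n1" "y3 e0 = - n0"
    using surj[of n3 n2 "- n1" "- n0"] by (auto simp: mult.commute)
  obtain e1 where e1: "e1 \<in> U" "y0 e1 = 0" "y1 e1 = n3" "y2 e1 = 0" "y3 e1 = - n1"
    using surj[of 0 n3 0 "- n1"] by (auto simp: mult.commute)
  obtain e2 where e2: "e2 \<in> U" "y0 e2 = - n2" "y1 e2 = 0" "y2 e2 = n0" "y3 e2 = 0"
    using surj[of "- n2" 0 n0 0] by (auto simp: mult.commute)
  note e = e0 e1 e2
  have expand: "?D *s u = z0 u *s e0 + z1 u *s e1 + z2 u *s e2" if "u \<in> U" for u
    using that e y_z[OF that]
    by (intro U_eqI) (simp_all add: y_simps vec.subspace_add[OF subspace_U] vec.subspace_diff[OF subspace_U]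
        vec.subspace_scale[OF subspace_U] algebra_simps)
  have polar_e: "polar e1 u = - z2 u" "polar e2 u = - z1 u" for u
    by (simp_all add: polar_def e z1_def z2_def)
  have in_X: "e1 \<in> X \<inter> U" "e2 \<in> X \<inter> U"
    by (simp_all add: in_X_iff_F eval_F e)
  show ?thesis
  proof (rule smooth_quadric_Z[OF in_X(1)])
    show "e1 \<noteq> 0" using e1 det by (auto simp: y_simps)
    show "\<exists>e\<in>U. polar u e \<noteq> 0" if u: "u \<in> X \<inter> U" "u \<noteq> 0" for u
    proof (rule ccontr)
      assume "\<not> (\<exists>e\<in>U. polar u e \<noteq> 0)"
      then have "polar e1 u = 0" "polar e2 u = 0"
        using e by (simp_all add: polar_commute[of _ u])
      then have z: "z1 u = 0" "z2 u = 0" by (simp_all add: polar_e)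
      moreover have "eval F u = 0" using u by (simp add: in_X_iff_F[symmetric])
      ultimately have "z0 u = 0" using F_z[of u] u by simp
      then have "?D *s u = 0" using expand[of u] z u by simp
      with det u show False by simp
    qed
    fix f assume f: "f \<in> vanishing_ideal (X \<inter> U)"
    note R1 = polar_form_in_radical_colon[OF in_X(1) f] and R2 = polar_form_in_radical_colon[OF in_X(2) f]
    let ?C = "\<lambda>r. Poly_Mapping.single 0 r :: ('v, 'k) mpol"
    define l0 where "l0 = lin_form (n0 *s (g v* A) + n2 *s (g v* B))"
    have l0: "eval l0 u = z0 u" for u
      by (simp add: l0_def eval_lin_form dot_lin_form_coeffs z0_def y_dot)
    have F_in: "F \<in> radical_colon quadric_ideal f"
      by (rule radical_colon_superset[OF subspace_quadric_ideal])
        (simp add: quadric_ideal_def ideal.span_base)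
    have "l0 * l0 \<in> radical_colon quadric_ideal f"
    proof (rule radical_colon_transfer)
      show "?C (- ?D) * F + (?C (- 1) * polar_form e2) * polar_form e1 \<in> radical_colon quadric_ideal f"
        by (intro radical_colon_add[OF subspace_quadric_ideal] radical_colon_mult[OF subspace_quadric_ideal] F_in R1)
      fix u assume "u \<in> U"
      then show "eval (l0 * l0) u = eval (?C (- ?D) * F + (?C (- 1) * polar_form e2) * polar_form e1) u"
        using F_z[of u] by (simp add: eval_simps l0 eval_polar_form polar_e algebra_simps)
    qed
    then have R0: "l0 \<in> radical_colon quadric_ideal f"
      by (rule radical_colon_square[OF subspace_quadric_ideal])
    let ?L = "[(l0, inverse ?D *s e0), (polar_form e2, - inverse ?D *s e1), (polar_form e1, - inverse ?D *s e2)]"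
    show "f \<in> saturation quadric_ideal"
    proof (rule saturation_quadric_idealI[of "{..<3::nat}" "\<lambda>i. fst (?L ! i)" f "\<lambda>i. snd (?L ! i)"])
      show "fst (?L ! i) \<in> radical_colon quadric_ideal f" if "i \<in> {..<3}" for i
        using that R0 R1 R2 by (auto simp: less_Suc_eq numeral_eq_Suc)
      fix u assume u: "u \<in> U"
      have "u = inverse ?D *s (?D *s u)" by (simp only: vec.scale_scale left_inverse[OF det] vec.scale_one)
      also have "\<dots> = inverse ?D *s (z0 u *s e0 + z1 u *s e1 + z2 u *s e2)" using expand[OF u] by simp
      also have "\<dots> = (\<Sum>i\<in>{..<3}. eval (fst (?L ! i)) u *s snd (?L ! i))"
        by (simp add: numeral_eq_Suc eval_polar_form polar_e l0 vec_eq_iff algebra_simps)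
      finally show "u = (\<Sum>i\<in>{..<3}. eval (fst (?L ! i)) u *s snd (?L ! i))" .
    qed simp
  qed
qed

text \<open>
  A polynomial that vanishes on \<open>l = 0\<close> and on \<open>m = 0\<close> is divided first by \<open>l\<close> and then by \<open>m\<close>; the vectors \<open>el\<close>
  and \<open>em\<close> are the directions of the two projections.
\<close>

lemma pair_of_lines_reduced:
  assumes e: "el \<in> U" "em \<in> U" "dot l el = 1" "dot l em = 0" "dot m el = 0" "dot m em = 1"
    and F: "\<And>u. u \<in> U \<Longrightarrow> eval F u = - (dot l u * dot m u)"
    and f: "f \<in> vanishing_ideal (X \<inter> U)"
  shows "f \<in> quadric_ideal"
proof -
  have zero: "eval f u = 0" if "u \<in> U" "dot l u = 0 \<or> dot m u = 0" for u
    using that f F[of u] by (auto simp: vanishing_ideal_def in_X_iff_F)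
  have comp: "polyfun (\<lambda>u. (u - dot c u *s e) $ i)" for c e :: "'k ^ 'v" and i
    by (simp, intro polyfun_diff polyfun_mult polyfun_coord polyfun_dot polyfun_const)
  obtain r where r: "polyfun r"
    "\<And>u. eval f (u - dot l u *s el + dot l u *s el) = eval f (u - dot l u *s el) + dot l u * r u"
    using polyfun_shift[where g = "eval f" and a = "\<lambda>u. u - dot l u *s el" and b = "dot l" and e = el,
        OF polyfun_eval comp polyfun_dot] by blast
  have f_r: "eval f u = dot l u * r u" if "u \<in> U" for u
    using r(2)[of u] zero[of "u - dot l u *s el"] that e
    by (simp add: vec.subspace_diff[OF subspace_U] vec.subspace_scale[OF subspace_U] dot_simps)
  obtain r' where r': "polyfun r'"
    "\<And>u. r (u - dot m u *s em + dot m u *s em) = r (u - dot m u *s em) + dot m u * r' u"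
    using polyfun_shift[where g = r and a = "\<lambda>u. u - dot m u *s em" and b = "dot m" and e = em,
        OF r(1) comp polyfun_dot] by blast
  show ?thesis
  proof (rule quadric_idealI)
    show "polyfun (\<lambda>u. - r' u)" by (rule polyfun_uminus[OF r'(1)])
    fix u assume u: "u \<in> U"
    let ?v = "u - dot m u *s em"
    have v: "?v \<in> U" using u e by (simp add: vec.subspace_diff[OF subspace_U] vec.subspace_scale[OF subspace_U])
    have "dot l u * r ?v = dot l ?v * r ?v" by (simp add: dot_simps e)
    also have "\<dots> = 0" using f_r[OF v] zero[OF v] by (simp add: dot_simps e)
    finally have "eval f u = dot l u * (dot m u * r' u)"
      using f_r[OF u] r'(2)[of u] by (simp add: distrib_left)
    then show "eval f u = eval F u * - r' u" by (simp add: F[OF u])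
  qed
qed

text \<open>
  The relation has rank 1, so it reads \<open>a\<^sup>T y c = 0\<close> for nonzero vectors \<open>a, c\<close>.  After completing \<open>a\<close> and \<open>c\<close> to
  unimodular matrices with second vectors \<open>b, d\<close>, the determinant on \<open>U\<close> is minus the product of
  \<open>l = a\<^sup>T y d\<close> and \<open>m = b\<^sup>T y c\<close>.  On \<open>l = 0\<close> also \<open>a\<^sup>T y = 0\<close>, a fixed linear relation between \<open>A u\<close> and \<open>B u\<close>, so this
  line lies in a ruling.  On \<open>m = 0\<close> also \<open>y c = 0\<close>, so \<open>A u\<close> and \<open>B u\<close> are multiples \<open>s w\<close> and \<open>t w\<close> of a fixed
  vector, and \<open>(s, t)\<close> is an isomorphism to the projective line.
\<close>

lemma pair_of_lines:
  assumes dim: "vec.dim U = 3"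
    and rel: "\<And>u. u \<in> U \<Longrightarrow> n0 * y0 u + n1 * y1 u + n2 * y2 u + n3 * y3 u = 0"
    and surj: "\<And>a b c d. n0 * a + n1 * b + n2 * c + n3 * d = 0 \<Longrightarrow>
       \<exists>u\<in>U. y0 u = a \<and> y1 u = b \<and> y2 u = c \<and> y3 u = d"
    and nonzero: "(n0, n1, n2, n3) \<noteq> (0, 0, 0, 0)"
    and det: "n0 * n3 = n1 * n2"
  obtains L L' x where "linear_subspace 1 L" "x \<noteq> (0, 0)" "L \<subseteq> ruling n \<phi> x"
    "line_section n \<phi> L'" "Z = vanishing_ideal L \<inter> vanishing_ideal L'"
proof -
  obtain a0 a1 c0 c1 where n: "n0 = a0 * c0" "n1 = a0 * c1" "n2 = a1 * c0" "n3 = a1 * c1"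
  proof (cases "n0 = 0 \<and> n1 = 0")
    case True
    then show thesis by (intro that[of 0 n2 n3 1]) auto
  next
    case False
    show thesis
    proof (cases "n0 = 0")
      case True
      then show thesis using False det by (intro that[of 1 n0 n1 "n3 / n1"]) auto
    next
      case n0: False
      then show thesis using det by (intro that[of 1 n0 n1 "n2 / n0"]) (auto simp: field_simps)
    qed
  qed
  have a: "(a0, a1) \<noteq> (0, 0)" and c: "(c0, c1) \<noteq> (0, 0)" using nonzero n by auto
  obtain b0 b1 where b: "a0 * b1 - a1 * b0 = 1" using unimodular_completion[OF a] .
  obtain d0 d1 where d: "c0 * d1 - c1 * d0 = 1" using unimodular_completion[OF c] .
  define l where "l = a0 *s (d0 *s (g v* A) + d1 *s (h v* A)) + a1 *s (d0 *s (g v* B) + d1 *s (h v* B))"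
  define m where "m = b0 *s (c0 *s (g v* A) + c1 *s (h v* A)) + b1 *s (c0 *s (g v* B) + c1 *s (h v* B))"
  have l: "dot l u = a0 * (d0 * y0 u + d1 * y1 u) + a1 * (d0 * y2 u + d1 * y3 u)"
    and m: "dot m u = b0 * (c0 * y0 u + c1 * y1 u) + b1 * (c0 * y2 u + c1 * y3 u)" for u
    by (simp_all add: l_def m_def dot_lin_form_coeffs y_dot algebra_simps)
  have rel': "a0 * (c0 * y0 u + c1 * y1 u) + a1 * (c0 * y2 u + c1 * y3 u) = 0" if "u \<in> U" for u
    using rel[OF that] by (simp add: n algebra_simps)
  have F: "eval F u = - (dot l u * dot m u)" if "u \<in> U" for u
    unfolding eval_F l m by (rule det_product[OF b d rel'[OF that]])
  \<comment> \<open>\<open>el, em\<close> are dual to \<open>l, m\<close>; \<open>es, et\<close> are the products of the columns \<open>(1, 0), (0, 1)\<close>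
    with the row \<open>(- c1, c0)\<close>, and span the line section.\<close>
  obtain el where el: "el \<in> U" "y0 el = - c1 * b1" "y1 el = c0 * b1" "y2 el = c1 * b0" "y3 el = - c0 * b0"
    using surj[of "- c1 * b1" "c0 * b1" "c1 * b0" "- c0 * b0"] by (auto simp: n algebra_simps)
  obtain em where em: "em \<in> U" "y0 em = - a1 * d1" "y1 em = a1 * d0" "y2 em = a0 * d1" "y3 em = - a0 * d0"
    using surj[of "- a1 * d1" "a1 * d0" "a0 * d1" "- a0 * d0"] by (auto simp: n algebra_simps)
  obtain es where es: "es \<in> U" "y0 es = - c1" "y1 es = c0" "y2 es = 0" "y3 es = 0"
    using surj[of "- c1" c0 0 0] by (auto simp: n algebra_simps)
  obtain et where et: "et \<in> U" "y0 et = 0" "y1 et = 0" "y2 et = - c1" "y3 et = c0"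
    using surj[of 0 0 "- c1" c0] by (auto simp: n algebra_simps)
  have "dot l el = (a0 * b1 - a1 * b0) * (c0 * d1 - c1 * d0)"
    "dot m em = (a0 * b1 - a1 * b0) * (c0 * d1 - c1 * d0)"
    by (simp_all add: l m el em algebra_simps)
  then have dual_lm: "dot l el = 1" "dot l em = 0" "dot m el = 0" "dot m em = 1"
    by (simp_all add: b d) (simp_all add: l m el em algebra_simps)
  define L where "L = {u \<in> U. dot l u = 0}"
  define L' where "L' = {u \<in> U. dot m u = 0}"
  have lines: "linear_subspace 1 L" "linear_subspace 1 L'"
    using dim_hyperplane[OF subspace_U, of el l] dim_hyperplane[OF subspace_U, of em m]
    by (simp_all add: linear_subspace_def L_def L'_def subspace_hyperplane subspace_U el em dual_lm dim)
  have union: "X \<inter> U = L \<union> L'"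
    unfolding L_def L'_def by (auto simp: in_X_iff_F F)
  have x: "(- a1, a0) \<noteq> (0, 0)" using a by auto
  have "L \<subseteq> ruling n \<phi> (- a1, a0)"
  proof
    fix u assume "u \<in> L"
    then have u: "u \<in> U" "dot l u = 0" by (simp_all add: L_def)
    let ?r0 = "a0 * y0 u + a1 * y2 u" and ?r1 = "a0 * y1 u + a1 * y3 u"
    have r: "c0 * ?r0 + c1 * ?r1 = 0" "d0 * ?r0 + d1 * ?r1 = 0"
      using rel'[OF u(1)] u(2) by (simp_all add: l algebra_simps)
    have "?r0 = 0" using unimodular_orthogonal(1)[OF d r(1)] unfolding r(2) by simp
    moreover have "?r1 = 0" using unimodular_orthogonal(2)[OF d r(1)] unfolding r(2) by simp
    ultimately have "a0 * y0 u = - a1 * y2 u" "a0 * y1 u = - a1 * y3 u" by (simp_all add: eq_neg_iff_add_eq_0)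
    then show "u \<in> ruling n \<phi> (- a1, a0)"
      using u(1) unfolding ruling_iff[OF x] by (simp add: U_def vec.scale_right_distrib)
  qed
  moreover have "line_section n \<phi> L'"
  proof -
    define \<sigma> where "\<sigma> = P1_map 1 (\<lambda>j. if j = 0 then es else et)"
    have \<sigma>: "\<sigma> x = fst x *s es + snd x *s et" for x
      by (simp add: \<sigma>_def P1_map_def)
    have \<sigma>_U: "\<sigma> x \<in> U" and y_\<sigma>: "y0 (\<sigma> x) = - c1 * fst x" "y1 (\<sigma> x) = c0 * fst x"
      "y2 (\<sigma> x) = - c1 * snd x" "y3 (\<sigma> x) = c0 * snd x" for x
      unfolding \<sigma> by (simp_all add: U_combination es et y_simps)
    have morphism: "P1_morphism \<sigma>"
      unfolding P1_morphism_def
    proof (intro conjI exI allI impI)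
      show "\<sigma> = P1_map 1 (\<lambda>j. if j = 0 then es else et)" by (fact \<sigma>_def)
      fix x :: "'k \<times> 'k" assume x: "x \<noteq> (0, 0)"
      show "\<sigma> x \<noteq> 0"
      proof
        assume "\<sigma> x = 0"
        then have "c1 * fst x = 0" "c0 * fst x = 0" "c1 * snd x = 0" "c0 * snd x = 0"
          using y_\<sigma>[of x] by (simp_all add: y_zero)
        then show False using c x by (cases x) auto
      qed
    qed
    have sect: "\<sigma> x \<in> L' \<inter> ruling n \<phi> x" if "x \<noteq> (0, 0)" for x
    proof -
      have "\<sigma> x \<in> L'" by (simp add: L'_def \<sigma>_U m y_\<sigma> algebra_simps)
      moreover have A\<sigma>: "A *v \<sigma> x = (- c1 * fst x) *s \<alpha> + (c0 * fst x) *s \<beta>"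
        and B\<sigma>: "B *v \<sigma> x = (- c1 * snd x) *s \<alpha> + (c0 * snd x) *s \<beta>"
        using \<sigma>_U[of x] by (simp_all add: U_def y_\<sigma>)
      have "snd x *s (A *v \<sigma> x) = fst x *s (B *v \<sigma> x)"
        unfolding A\<sigma> B\<sigma> by (simp add: vec_eq_iff algebra_simps)
      then have "\<sigma> x \<in> ruling n \<phi> x" using that ruling_iff[of "fst x" "snd x"] by simp
      ultimately show ?thesis by blast
    qed
    have onto: "\<exists>x. x \<noteq> (0, 0) \<and> u \<in> vec.span {\<sigma> x}" if "u \<in> L'" for u
    proof -
      have u: "u \<in> U" "dot m u = 0" using that by (simp_all add: L'_def)
      let ?r0 = "c0 * y0 u + c1 * y1 u" and ?r1 = "c0 * y2 u + c1 * y3 u"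
      have mu: "b0 * ?r0 + b1 * ?r1 = 0" using u(2) by (simp add: m)
      have r0: "?r0 = 0" using unimodular_orthogonal(1)[OF b rel'[OF u(1)]] unfolding mu by simp
      have r1: "?r1 = 0" using unimodular_orthogonal(2)[OF b rel'[OF u(1)]] unfolding mu by simp
      note y = unimodular_orthogonal[OF d r0] unimodular_orthogonal[OF d r1]
      let ?x = "(d0 * y0 u + d1 * y1 u, d0 * y2 u + d1 * y3 u)"
      have u_eq: "u = \<sigma> ?x"
        by (rule U_eqI[OF u(1) \<sigma>_U]) (simp_all only: y_\<sigma> fst_conv snd_conv y[symmetric])
      show ?thesis
      proof (cases "?x = (0, 0)")
        case True
        then have "u = 0" using u_eq by (simp add: \<sigma>)
        then show ?thesis by (intro exI[of _ "(1, 0)"]) (simp add: vec.span_zero)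
      next
        case False
        then show ?thesis using u_eq vec.span_base[of "\<sigma> ?x" "{\<sigma> ?x}"] by (metis insertI1)
      qed
    qed
    have "L' \<subseteq> X" using union by blast
    with lines(2) morphism sect onto show ?thesis unfolding line_section_def by blast
  qed
  moreover have "Z = vanishing_ideal L \<inter> vanishing_ideal L'"
  proof -
    have el: "el \<in> X \<inter> U" unfolding union by (simp add: L'_def el dual_lm)
    moreover have "el \<noteq> 0" using dual_lm by auto
    moreover have "f \<in> saturation quadric_ideal" if "f \<in> vanishing_ideal (X \<inter> U)" for f
      using pair_of_lines_reduced[of el em l m, OF _ _ dual_lm F that] el em(1)
        saturation_superset[of quadric_ideal] by blast
    ultimately have "Z = vanishing_ideal (L \<union> L')" unfolding union[symmetric] by (rule Z_reduced(1))
    then show ?thesis by (auto simp: vanishing_ideal_def)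
  qed
  ultimately show thesis using that[of L "(- a1, a0)" L'] lines x by blast
qed

text \<open>
  In the chart \<open>l = 1\<close> of the line, \<open>F\<close> becomes \<open>\<mu>\<^sup>2\<close>, so modulo the ideal every polynomial is congruent to its Taylor
  polynomial \<open>a + b \<mu>\<close> at \<open>e\<close>.
\<close>

lemma double_point_length_le:
  assumes U: "U = vec.span {p, e}" and q: "e \<in> X \<inter> U" "e \<noteq> 0" and pol: "polar p e = 0"
    and zero: "zero_set Z = vec.span {e}"
  shows "scheme_length Z \<le> 2"
proof -
  have p_e: "p \<notin> vec.span {e, e}"
    using p_notin_X X_scale[of e] q by (auto simp: vec.span_singleton)
  obtain m where m: "dot m p = 1" "dot m e = 0" using dual_pair[OF p_e] by metis
  have e_p: "e \<notin> vec.span {p, p}"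
  proof
    assume "e \<in> vec.span {p, p}"
    then obtain c where c: "e = c *s p" by (auto simp: vec.span_singleton)
    then have "p = inverse c *s e" using q(2) by auto
    then show False using p_notin_X X_scale[of e] q by (metis IntD1)
  qed
  obtain c where c: "dot c e = 1" "dot c p = 0" using dual_pair[OF e_p] by metis
  have "quotient_dim (ideal.span (insert (lin_form c - 1) Z)) \<le> enat CARD(2)"
  proof (rule quotient_dim_le[where b = "\<lambda>i. if i = 1 then 1 else lin_form m"])
    fix f :: "('v, 'k) mpol"
    let ?J = "ideal.span (insert (lin_form c - 1) Z)" and ?C = "\<lambda>r. Poly_Mapping.single 0 r :: ('v, 'k) mpol"
    obtain a b G where G: "pullback f (tangent_line e p) = pCons a (pCons b G)"
      by (metis pCons_cases)
    have f_line: "eval f (e + T *s p) = a + b * T + T * T * poly G T" for T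
      using poly_pullback[of f "tangent_line e p" T] by (simp add: G curve_at_tangent_line algebra_simps)
    have "polyfun (\<lambda>u. (e + dot m u *s p) $ i)" for i by (rule polyfun_affine)
    from polyfun_shift[where g = "eval f" and b = "\<lambda>u. dot c u - 1" and e = e,
        OF polyfun_eval this polyfun_diff[OF polyfun_dot polyfun_const]]
    \<comment> \<open>\<open>u = (e + m u p) + (l u - 1) e\<close> on the line\<close>
    obtain r where r: "polyfun r" "\<And>u. eval f (e + dot m u *s p + (dot c u - 1) *s e)
        = eval f (e + dot m u *s p) + (dot c u - 1) * r u" by blast
    obtain R where R: "r = eval R" using r(1) by (auto simp: polyfun_def)
    obtain H where H: "(\<lambda>u. poly G (dot m u)) = eval H"
      using polyfun_poly[OF polyfun_dot] unfolding polyfun_def by blast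
    let ?f = "f - (?C a + ?C b * lin_form m) - R * (lin_form c - 1) - H * F"
    have "?f \<in> vanishing_ideal U"
    proof -
      have "eval ?f (\<mu> *s p + \<nu> *s e) = 0" for \<mu> \<nu>
      proof -
        let ?u = "\<mu> *s p + \<nu> *s e"
        have "e + dot m ?u *s p + (dot c ?u - 1) *s e = ?u"
          by (simp add: dot_simps m c vec_eq_iff algebra_simps)
        with r(2)[of ?u] have "eval f ?u = a + b * \<mu> + \<mu> * \<mu> * poly G \<mu> + (\<nu> - 1) * eval R ?u"
          by (simp add: dot_simps m c f_line R)
        moreover have "eval F ?u = \<mu> * \<mu>"
          using q in_X_iff_F[of e] by (simp add: eval_F_combination pol eval_F_p)
        moreover have "eval H ?u = poly G \<mu>" using fun_cong[OF H, of ?u] by (simp add: dot_simps m)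
        ultimately show ?thesis
          by (simp add: eval_simps eval_lin_form dot_simps m c algebra_simps)
      qed
      then show ?thesis by (auto simp: vanishing_ideal_def U in_span_pair)
    qed
    then have "?f + R * (lin_form c - 1) + H * F \<in> ?J"
      using scheme_inter_superset(2)[of "vanishing_ideal U" "vanishing_ideal X"]
        scheme_inter_superset(1)[of "vanishing_ideal X" "vanishing_ideal U"] F_in_vanishing_ideal
      by (intro ideal.span_add ideal.span_scale ideal.span_base) auto
    then show "\<exists>d. f - (\<Sum>i\<in>(UNIV :: 2 set). ?C (d i) * (if i = 1 then 1 else lin_form m)) \<in> ?J"
      by (intro exI[of _ "\<lambda>i. if i = 1 then a else b"]) (simp add: sum_2 algebra_simps)
  qed (rule ideal.subspace_span)
  then have "quotient_dim (ideal.span (insert (lin_form c - 1) Z)) \<le> 2" by (simp add: numeral_eq_enat)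
  then show ?thesis
    by (rule scheme_length_le[rotated]) (auto simp: zero vec.span_singleton dot_scale c)
qed

text \<open>
  With \<open>U\<close> spanned by \<open>p\<close> and a point \<open>e\<close> of the scroll, \<open>F\<close> is \<open>\<mu> (\<mu> + \<nu> polar p e)\<close>.  Its zeros coincide iff
  \<open>polar p e = 0\<close>.
\<close>

lemma secant_locus_of_line:
  assumes dim: "vec.dim U = 2"
  shows "double_point Z \<or> two_simple_points Z"
proof -
  have "\<not> U \<subseteq> vec.span {p}"
    using vec.dim_mono[of U "{p}"] dim p_nonzero by auto
  then obtain e where e: "e \<in> X" "e \<in> U" "e \<noteq> 0" using point_on_secant by (metis subsetI)
  have e_p: "e \<notin> vec.span {p}"
  proof
    assume "e \<in> vec.span {p}"
    then obtain c where c: "e = c *s p" by (auto simp: vec.span_singleton)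
    then have "p = inverse c *s e" using e(3) by auto
    then show False using p_notin_X X_scale[OF e(1)] by metis
  qed
  have U: "U = vec.span {p, e}"
  proof (rule sym, rule vec.subspace_dim_equal)
    show "vec.span {p, e} \<subseteq> U" using e p_in_U by (intro vec.span_minimal subspace_U) auto
    show "vec.dim U \<le> vec.dim (vec.span {p, e})"
      using e_p p_nonzero by (simp add: insert_commute[of p] vec.dim_insert dim)
  qed (simp_all add: subspace_U)
  let ?\<tau> = "polar p e"
  have Fe: "eval F e = 0" using e by (simp add: in_X_iff_F[symmetric])
  have F: "eval F (\<mu> *s p + \<nu> *s e) = \<mu> * (\<mu> + \<nu> * ?\<tau>)" for \<mu> \<nu>
    unfolding eval_F_combination by (simp add: eval_F_p Fe algebra_simps)
  have q: "e \<in> X \<inter> U" "e \<noteq> 0" using e by auto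
  show ?thesis
  proof (cases "?\<tau> = 0")
    case True
    have "X \<inter> U = vec.span {e}"
    proof
      show "X \<inter> U \<subseteq> vec.span {e}"
      proof
        fix u assume u: "u \<in> X \<inter> U"
        then obtain \<mu> \<nu> where \<mu>\<nu>: "u = \<mu> *s p + \<nu> *s e" by (auto simp: U in_span_pair)
        have "eval F u = 0" using u by (simp add: in_X_iff_F[symmetric])
        then have "\<mu> = 0" unfolding \<mu>\<nu> F by (simp add: True)
        then show "u \<in> vec.span {e}" by (simp add: \<mu>\<nu> vec.span_scale vec.span_base)
      qed
      show "vec.span {e} \<subseteq> X \<inter> U"
        using e by (auto simp: vec.span_singleton X_scale vec.subspace_scale[OF subspace_U])
    qed
    then have zero: "zero_set Z = vec.span {e}" using zero_set_Z[OF q] by simp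
    have "2 \<le> scheme_length Z" using line_length_ge_2[OF e] by (simp only: U[symmetric])
    then have "double_point Z"
      unfolding double_point_def using zero e(3) double_point_length_le[OF U q True zero]
      by (metis order_antisym)
    then show ?thesis ..
  next
    case False
    define e' where "e' = ?\<tau> *s p + (- 1) *s e"
    have e'_U: "e' \<in> U" unfolding e'_def by (rule U_combination[OF p_in_U e(2)])
    have Fe': "eval F e' = 0" unfolding e'_def F by simp
    have e': "e' \<in> X \<inter> U" using e'_U Fe' by (simp add: in_X_iff_F)
    have p_eq: "?\<tau> *s p = e' + e" by (simp add: e'_def)
    have XU: "X \<inter> U = vec.span {e} \<union> vec.span {e'}"
    proof
      show "X \<inter> U \<subseteq> vec.span {e} \<union> vec.span {e'}"
      proof
        fix u assume u: "u \<in> X \<inter> U"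
        then obtain \<mu> \<nu> where \<mu>\<nu>: "u = \<mu> *s p + \<nu> *s e" by (auto simp: U in_span_pair)
        have "eval F u = 0" using u by (simp add: in_X_iff_F[symmetric])
        then consider "\<mu> = 0" | "\<mu> = - \<nu> * ?\<tau>" unfolding \<mu>\<nu> F by (auto simp: eq_neg_iff_add_eq_0)
        then show "u \<in> vec.span {e} \<union> vec.span {e'}"
        proof cases
          case 1
          then show ?thesis by (simp add: \<mu>\<nu> vec.span_scale vec.span_base)
        next
          case 2
          then have "u = (- \<nu>) *s e'" by (simp add: \<mu>\<nu> e'_def vec_eq_iff algebra_simps)
          then show ?thesis using vec.span_scale[OF vec.span_base[of e' "{e'}"], of "- \<nu>"] by simp
        qed
      qed
      show "vec.span {e} \<union> vec.span {e'} \<subseteq> X \<inter> U"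
        using e e' by (auto simp: vec.span_singleton X_scale vec.subspace_scale[OF subspace_U])
    qed
    have red: "f \<in> saturation quadric_ideal" if f: "f \<in> vanishing_ideal (X \<inter> U)" for f
    proof -
      let ?t = "inverse (?\<tau> * ?\<tau>)"
      let ?L = "[(polar_form e', ?t *s e), (polar_form e, ?t *s e')]"
      show ?thesis
      proof (rule saturation_quadric_idealI[of "{..<2::nat}" "\<lambda>i. fst (?L ! i)" f "\<lambda>i. snd (?L ! i)"])
        show "fst (?L ! i) \<in> radical_colon quadric_ideal f" if "i \<in> {..<2}" for i
          using that polar_form_in_radical_colon[OF q(1) f] polar_form_in_radical_colon[OF e' f]
          by (auto simp: less_Suc_eq numeral_eq_Suc)
        fix u assume "u \<in> U"
        then obtain \<mu> \<nu> where \<mu>\<nu>: "u = \<mu> *s p + \<nu> *s e" by (auto simp: U in_span_pair)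
        have pol0: "polar e e = 0" "polar p p = 2" "polar e p = ?\<tau>"
          using Fe by (simp_all add: polar_def eval_F y_simps mult.commute)
        have pol_e: "polar e u = \<mu> * ?\<tau>" and pol_p: "polar p u = \<mu> * 2 + \<nu> * ?\<tau>"
          unfolding \<mu>\<nu> polar_combination by (simp_all only: pol0) simp
        have "polar e' u = ?\<tau> * polar p u - polar e u"
          unfolding e'_def polar_commute[of _ u] polar_combination by simp
        then have pol: "polar e u = \<mu> * ?\<tau>" "polar e' u = \<mu> * ?\<tau> + \<nu> * (?\<tau> * ?\<tau>)"
          by (simp_all add: pol_e pol_p algebra_simps)
        have comb: "(\<mu> * ?\<tau> + \<nu> * (?\<tau> * ?\<tau>)) *s e + (\<mu> * ?\<tau>) *s e' = (?\<tau> * ?\<tau>) *s u"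
          by (simp add: \<mu>\<nu> e'_def vec_eq_iff algebra_simps)
        have "?\<tau> * ?\<tau> \<noteq> 0" using False by simp
        then have "u = ?t *s ((?\<tau> * ?\<tau>) *s u)" by (metis left_inverse vec.scale_one vec.scale_scale)
        also have "\<dots> = ?t *s ((\<mu> * ?\<tau> + \<nu> * (?\<tau> * ?\<tau>)) *s e + (\<mu> * ?\<tau>) *s e')"
          by (simp only: comb)
        also have "\<dots> = (\<Sum>i\<in>{..<2}. eval (fst (?L ! i)) u *s snd (?L ! i))"
          by (simp add: numeral_eq_Suc eval_polar_form pol vec_eq_iff algebra_simps)
        finally show "u = (\<Sum>i\<in>{..<2}. eval (fst (?L ! i)) u *s snd (?L ! i))" .
      qed simp
    qed
    have "Z = vanishing_ideal (vec.span {e} \<union> vec.span {e'})"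
      using Z_reduced(1)[OF q red] by (simp only: XU)
    then have "Z = vanishing_ideal (vec.span {e}) \<inter> vanishing_ideal (vec.span {e'})"
      by (auto simp: vanishing_ideal_def)
    moreover have ne: "e' \<notin> vec.span {e}"
    proof
      assume "e' \<in> vec.span {e}"
      then obtain k where "e' = k *s e" by (auto simp: vec.span_singleton)
      then have "?\<tau> *s p = (k + 1) *s e" using p_eq by (simp add: algebra_simps)
      then have "p = (inverse ?\<tau> * (k + 1)) *s e"
        using False by (metis left_inverse vec.scale_one vec.scale_scale)
      then show False using p_notin_X X_scale[OF e(1)] by metis
    qed
    moreover have "e' \<noteq> 0" using ne vec.span_zero by metis
    moreover have "vec.span {e} \<noteq> vec.span {e'}" using ne vec.span_base[of e' "{e'}"] by auto
    ultimately have "two_simple_points Z" unfolding two_simple_points_def using e(3) by blast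
    then show ?thesis ..
  qed
qed

text \<open>
  The case distinction is by the dimension of \<open>U\<close> and, for dimension 3, by the rank of the linear relation
  that defines \<open>U\<close> among the \<open>2 \<times> 2\<close> matrices.
\<close>

theorem secant_locus_classification:
  assumes "\<not> U \<subseteq> vec.span {p}"
  shows "(linear_subspace 1 (secant_cone X p) \<and>
      vanishing_ideal (secant_cone X p) \<subseteq> secant_locus X p \<and>
      (double_point (secant_locus X p) \<or> two_simple_points (secant_locus X p)))
     \<or>
     (linear_subspace 2 (secant_cone X p) \<and>
      vanishing_ideal (secant_cone X p) \<subseteq> secant_locus X p \<and>
      (smooth_quadric_in (secant_cone X p) (secant_locus X p) \<or>
       (\<exists>L L' x. linear_subspace 1 L \<and> x \<noteq> (0, 0) \<and> L \<subseteq> ruling n \<phi> x \<and>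
          line_section n \<phi> L' \<and>
          secant_locus X p = vanishing_ideal L \<inter> vanishing_ideal L')))
     \<or>
     (linear_subspace 3 (secant_cone X p) \<and>
      vanishing_ideal (secant_cone X p) \<subseteq> secant_locus X p \<and>
      smooth_quadric_in (secant_cone X p) (secant_locus X p))"
proof -
  have cone: "secant_cone X p = U" by (rule secant_cone_eq_U[OF assms])
  have locus: "secant_locus X p = Z" by (simp add: secant_locus_def cone)
  have sub: "vanishing_ideal U \<subseteq> Z" by (rule scheme_inter_superset)
  have dim_space: "linear_subspace d U \<longleftrightarrow> vec.dim U = d + 1" for d
    by (simp add: linear_subspace_def subspace_U)
  have "vec.dim U \<noteq> 0" using p_in_U p_nonzero by auto
  moreover have "vec.dim U \<noteq> 1"
  proof
    assume "vec.dim U = 1"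
    then have "vec.span {p} = U"
      using p_in_U p_nonzero
      by (intro vec.subspace_dim_equal vec.span_minimal subspace_U vec.subspace_span) auto
    with assms show False by simp
  qed
  ultimately consider "vec.dim U = 2" | "vec.dim U = 3" | "vec.dim U = 4"
    using dim_U_le by linarith
  then show ?thesis
  proof cases
    case 1
    then show ?thesis unfolding locus cone dim_space using sub secant_locus_of_line by simp
  next
    case 2
    show ?thesis
    proof (rule coord_relation[OF 2])
      fix n0 n1 n2 n3
      assume rel: "(n0, n1, n2, n3) \<noteq> (0, 0, 0, 0)"
        "\<And>u. u \<in> U \<Longrightarrow> n0 * y0 u + n1 * y1 u + n2 * y2 u + n3 * y3 u = 0"
        "\<And>a b c d. n0 * a + n1 * b + n2 * c + n3 * d = 0 \<Longrightarrow>
           \<exists>u\<in>U. y0 u = a \<and> y1 u = b \<and> y2 u = c \<and> y3 u = d"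
      show ?thesis
      proof (cases "n0 * n3 - n1 * n2 = 0")
        case True
        then have "n0 * n3 = n1 * n2" by simp
        have "\<exists>L L' x. linear_subspace 1 L \<and> x \<noteq> (0, 0) \<and> L \<subseteq> ruling n \<phi> x \<and>
            line_section n \<phi> L' \<and> Z = vanishing_ideal L \<inter> vanishing_ideal L'"
        proof (rule pair_of_lines[OF 2 rel(2,3,1) \<open>n0 * n3 = n1 * n2\<close>])
          fix L L' x
          assume "linear_subspace 1 L" "x \<noteq> (0, 0)" "L \<subseteq> ruling n \<phi> x"
            "line_section n \<phi> L'" "Z = vanishing_ideal L \<inter> vanishing_ideal L'"
          then show "\<exists>L L' x. linear_subspace 1 L \<and> x \<noteq> (0, 0) \<and> L \<subseteq> ruling n \<phi> x \<and>
            line_section n \<phi> L' \<and> Z = vanishing_ideal L \<inter> vanishing_ideal L'" by (intro exI conjI)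
        qed
        then show ?thesis unfolding locus cone dim_space using sub 2 by simp
      next
        case False
        from smooth_conic[OF rel(2,3) this] show ?thesis
          unfolding locus cone dim_space using sub 2 by simp
      qed
    qed
  next
    case 3
    then show ?thesis unfolding locus cone dim_space using sub smooth_quadric_surface by simp
  qed
qed

end

section \<open>Points of the secant variety\<close>

definition minor3 :: "'v \<Rightarrow> 'v \<Rightarrow> 'v \<Rightarrow> 'k::comm_ring_1 ^ 'v::finite \<Rightarrow> 'k ^ 'v \<Rightarrow> 'k ^ 'v \<Rightarrow> 'k" where
  "minor3 i j k x y z = (x $ i * y $ j - x $ j * y $ i) * z $ k
     - (x $ i * y $ k - x $ k * y $ i) * z $ j + (x $ j * y $ k - x $ k * y $ j) * z $ i"

text \<open>
  Three vectors in a plane are dependent.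
\<close>

lemma minor3_eq_0:
  "minor3 i j k (a *s v + b *s w) (c *s v + d *s w) (e *s v + f *s w) = 0"
  by (simp add: minor3_def algebra_simps)

text \<open>
  The ruling over \<open>(s, t)\<close> is the kernel of \<open>t A - s B\<close>.  The rulings are spanned
  by polynomial curves, which provide the tangent vectors of the scroll.
\<close>

context scroll_pencil

begin

text \<open>
  For independent \<open>A u\<close> and \<open>B u\<close> the common zeros of the linear forms other than \<open>c\<close> are the \<open>z\<close> with \<open>A z\<close> and
  \<open>B z\<close> in the plane of \<open>A u\<close> and \<open>B u\<close>.  The forms are \<open>3 \<times> 3\<close> minors, so they depend polynomially on \<open>u\<close>.  Their
  zeros have dimension at least 2 iff for every further form \<open>c\<close> there is a nonzero common zero, and this is a
  condition on determinants.
\<close>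

definition secant_row :: "'k ^ 'v \<Rightarrow> 'k ^ 'v \<Rightarrow> ('v \<times> 'v \<times> 'v \<times> bool) option \<Rightarrow> 'k ^ 'v" where
  "secant_row c u x = (case x of None \<Rightarrow> c | Some (i, j, k, e) \<Rightarrow>
     let M = (if e then A else B); v = A *v u; w = B *v u in
     (v $ i * w $ j - v $ j * w $ i) *s M $ k - (v $ i * w $ k - v $ k * w $ i) *s M $ j
       + (v $ j * w $ k - v $ k * w $ j) *s M $ i)"

lemma dot_secant_row:
  "dot (secant_row c u None) z = dot c z"
  "dot (secant_row c u (Some (i, j, k, True))) z = minor3 i j k (A *v u) (B *v u) (A *v z)"
  "dot (secant_row c u (Some (i, j, k, False))) z = minor3 i j k (A *v u) (B *v u) (B *v z)"
  by (simp_all add: secant_row_def minor3_def dot_lin_form_coeffs matrix_vector_nth Let_def algebra_simps)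

lemma polyfun_secant_row: "polyfun (\<lambda>u. secant_row c u x $ j)"
proof (cases x)
  case None
  then show ?thesis by (simp add: secant_row_def polyfun_const)
next
  case (Some y)
  obtain i k l e where "y = (i, k, l, e)" by (cases y) auto
  with Some show ?thesis
    by (simp add: secant_row_def matrix_vector_nth Let_def)
      (intro conjI impI polyfun_add polyfun_diff polyfun_mult polyfun_dot polyfun_const)
qed

text \<open>
  For a point \<open>q\<close> of a chord, all \<open>A z\<close> and \<open>B z\<close> with \<open>z\<close> on the chord lie in the plane of the two vectors \<open>w, w'\<close> that belong
  to the end points.  Some such \<open>z \<noteq> 0\<close> is also a zero of \<open>c\<close>.
\<close>

lemma det_secant_rows_zero:
  assumes uv: "u \<in> X" "v \<in> X" "u \<noteq> 0" "v \<noteq> 0" "vec.span {u} \<noteq> vec.span {v}"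
    and q: "q \<in> vec.span {u, v}"
  shows "det (\<chi> a. secant_row c q (f a)) = 0"
proof -
  obtain s t w where u: "A *v u = s *s w" "B *v u = t *s w" using in_XE[OF uv(1)] by metis
  obtain s' t' w' where v: "A *v v = s' *s w'" "B *v v = t' *s w'" using in_XE[OF uv(2)] by metis
  obtain x y where q: "q = x *s u + y *s v" using q by (auto simp: in_span_pair)
  \<comment> \<open>a combination of the end points on which \<open>c\<close> vanishes\<close>
  obtain x' y' where xy': "(x', y') \<noteq> (0, 0)" "x' * dot c u + y' * dot c v = 0"
  proof (cases "dot c u = 0")
    case True
    then show thesis by (intro that[of 1 0]) auto
  next
    case False
    then show thesis by (intro that[of "- dot c v" "dot c u"]) auto
  qed
  define z where "z = x' *s u + y' *s v"
  have "z \<noteq> 0"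
  proof
    assume z0: "z = 0"
    show False
    proof (cases "x' = 0")
      case True
      with z0 xy' uv show False by (simp add: z_def)
    next
      case False
      from z0 have "x' *s u = (- y') *s v" by (simp add: z_def eq_neg_iff_add_eq_0)
      then have "u = (inverse x' * (- y')) *s v"
        using False by (metis left_inverse vec.scale_one vec.scale_scale)
      then have "u \<in> vec.span {v}" by (metis vec.span_base vec.span_scale singletonI)
      with span_singleton_neq_imp_notin[OF uv(3,5)] show False ..
    qed
  qed
  moreover have "dot (secant_row c q i) z = 0" for i
  proof (cases i)
    case None
    then show ?thesis using xy' by (simp add: dot_secant_row z_def dot_simps)
  next
    case (Some i')
    obtain i1 i2 i3 e where i': "i' = (i1, i2, i3, e)" by (cases i') auto
    have "A *v q = (x * s) *s w + (y * s') *s w'" "B *v q = (x * t) *s w + (y * t') *s w'"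
      "A *v z = (x' * s) *s w + (y' * s') *s w'" "B *v z = (x' * t) *s w + (y' * t') *s w'"
      by (simp_all add: q z_def vec.add vec.scale u v)
    then show ?thesis unfolding Some i' by (cases e) (simp_all only: dot_secant_row minor3_eq_0)
  qed
  then have "(\<chi> a. secant_row c q (f a)) *v z = 0"
    by (simp add: vec_eq_iff matrix_vector_nth)
  ultimately show ?thesis using det_nonzero_iff_kernel by blast
qed

end

text \<open>
  The determinants of \<open>det_secant_rows_zero\<close> are polynomials in the point, so they vanish on the closure.  If \<open>U\<close> were
  spanned by \<open>p\<close>, then with a linear form \<open>c\<close> that does not vanish at \<open>p\<close> the rows would have no common zero, and one of
  these determinants would not vanish.
\<close>

lemma (in scroll_point) secant_point_U:
  assumes "p \<in> secant_variety X"
  shows "\<not> U \<subseteq> vec.span {p}"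
proof
  assume U: "U \<subseteq> vec.span {p}"
  have "p \<notin> vec.span {0, 0}" using p_nonzero by (simp add: vec.span_insert_0)
  then obtain c where c: "dot c p = 1" using dual_pair by metis
  obtain i j where d: "\<alpha> $ i * \<beta> $ j - \<alpha> $ j * \<beta> $ i \<noteq> 0"
  proof (rule ccontr)
    assume "\<not> thesis"
    then have eq: "\<alpha> $ i * \<beta> $ j = \<alpha> $ j * \<beta> $ i" for i j using that by force
    have "dot g \<alpha> * dot h \<beta> = (\<Sum>i\<in>UNIV. \<Sum>j\<in>UNIV. g $ i * h $ j * (\<alpha> $ i * \<beta> $ j))"
      by (simp add: dot_def sum_product ac_simps)
    also have "\<dots> = (\<Sum>i\<in>UNIV. \<Sum>j\<in>UNIV. g $ i * h $ j * (\<alpha> $ j * \<beta> $ i))"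
      by (simp only: eq)
    also have "\<dots> = dot g \<beta> * dot h \<alpha>"
      by (simp add: dot_def sum_product ac_simps)
    finally show False by (simp add: dual)
  qed
  have in_plane: "\<exists>a b. z = a *s \<alpha> + b *s \<beta>" if z: "\<And>k. minor3 i j k \<alpha> \<beta> z = 0" for z
  proof -
    let ?d = "\<alpha> $ i * \<beta> $ j - \<alpha> $ j * \<beta> $ i"
    let ?a = "\<beta> $ j * z $ i - \<beta> $ i * z $ j" and ?b = "\<alpha> $ i * z $ j - \<alpha> $ j * z $ i"
    have "?d * z $ k = ?a * \<alpha> $ k + ?b * \<beta> $ k" for k
      using z[of k] by (simp add: minor3_def algebra_simps)
    then have "?d *s z = ?a *s \<alpha> + ?b *s \<beta>"
      by (simp only: vec_eq_iff vector_smult_component vector_add_component simp_thms)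
    then have "z = inverse ?d *s (?a *s \<alpha> + ?b *s \<beta>)"
      using d by (metis left_inverse vec.scale_one vec.scale_scale)
    then show ?thesis by (metis vec.scale_right_distrib vec.scale_scale)
  qed
  have "u = 0" if u: "\<forall>x. dot (secant_row c p x) u = 0" for u
  proof -
    have "minor3 i j k \<alpha> \<beta> (A *v u) = 0" "minor3 i j k \<alpha> \<beta> (B *v u) = 0" for k
      using u[THEN spec, of "Some (i, j, k, True)"] u[THEN spec, of "Some (i, j, k, False)"] by (simp_all add: dot_secant_row)
    then obtain a b a' b' where "A *v u = a *s \<alpha> + b *s \<beta>" "B *v u = a' *s \<alpha> + b' *s \<beta>"
      using in_plane by metis
    then have "u \<in> U" by (rule in_UI(1))
    then obtain k where k: "u = k *s p" using U by (auto simp: vec.span_singleton)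
    then show "u = 0" using u[THEN spec, of None] by (simp add: dot_secant_row dot_simps c)
  qed
  then have "\<exists>f :: 'v \<Rightarrow> ('v \<times> 'v \<times> 'v \<times> bool) option. det (\<chi> a. secant_row c p (f a)) \<noteq> 0"
    by (rule det_rows_nonzero)
  then obtain f :: "'v \<Rightarrow> ('v \<times> 'v \<times> 'v \<times> bool) option"
    where f: "det (\<chi> a. secant_row c p (f a)) \<noteq> 0" ..
  have "polyfun (\<lambda>u. det (\<chi> a. secant_row c u (f a)))"
    by (rule polyfun_det) (simp add: polyfun_secant_row)
  then obtain D where D: "\<And>u. eval D u = det (\<chi> a. secant_row c u (f a))"
    unfolding polyfun_def by metis
  have "eval D p = 0"
  proof -
    have "D \<in> vanishing_ideal (\<Union>{vec.span {u, v} | u v. u \<in> X \<and> v \<in> X \<and> u \<noteq> 0 \<and> v \<noteq> 0 \<and>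
        vec.span {u} \<noteq> vec.span {v}})"
      unfolding vanishing_ideal_def by (auto simp: D intro: det_secant_rows_zero)
    then show ?thesis
      using assms unfolding secant_variety_def zariski_closure_def zero_set_def by blast
  qed
  with f show False by (simp add: D)
qed

section \<open>The pencil of a rational normal scroll\<close>

text \<open>
  The coefficients \<open>c i j\<close> of the rational normal curves form a basis, because they span and their number is
  the dimension.  In the coordinates \<open>z i j\<close>, the map \<open>A\<close> keeps \<open>z i j\<close> for \<open>j < a ! i\<close>, the map \<open>B\<close> shifts \<open>z i (j + 1)\<close> to \<open>z i j\<close>,
  and \<open>t z i j = s z i (j + 1)\<close> says that \<open>z i\<close> is a geometric progression of ratio \<open>t / s\<close>.
\<close>

lemma scroll_pencil_exists:
  fixes \<phi> :: "nat \<Rightarrow> 'k::alg_closed_field \<times> 'k \<Rightarrow> 'k ^ 'v::finite"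
  assumes "scroll_data a \<Lambda> \<phi>"
  obtains A B where "scroll_pencil (length a) \<phi> A B"
proof -
  let ?n = "length a"
  have a_pos: "1 \<le> a ! i" if "i < ?n" for i using assms that by (simp add: scroll_data_def)
  have "\<exists>c. \<phi> i = P1_map (a ! i) c \<and> vec.span (c ` {..a ! i}) = \<Lambda> i" if "i < ?n" for i
    using assms that by (auto simp: scroll_data_def rational_normal_curve_def)
  then obtain c where \<phi>: "\<And>i. i < ?n \<Longrightarrow> \<phi> i = P1_map (a ! i) (c i)"
    and \<Lambda>: "\<And>i. i < ?n \<Longrightarrow> vec.span (c i ` {..a ! i}) = \<Lambda> i" by metis
  define I where "I = Sigma {..<?n} (\<lambda>i. {..a ! i})"
  define b where "b = (\<lambda>(i, j). c i j)"
  have "finite I" by (simp add: I_def)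
  have "card I = (\<Sum>i<?n. a ! i + 1)" by (simp add: I_def)
  also have "\<dots> = sum_list a + ?n"
    unfolding sum.distrib by (simp add: sum_list_sum_nth atLeast0LessThan)
  finally have card_I: "card I = CARD('v)" using assms by (simp add: scroll_data_def)
  have span: "vec.span (b ` I) = UNIV"
  proof -
    have "\<Lambda> i \<subseteq> vec.span (b ` I)" if "i < ?n" for i
      unfolding \<Lambda>[OF that, symmetric] using that by (intro vec.span_mono) (auto simp: I_def b_def)
    then have "vec.span (\<Union>i<?n. \<Lambda> i) \<subseteq> vec.span (b ` I)"
      by (intro vec.span_minimal vec.subspace_span) auto
    then show ?thesis using assms by (auto simp: scroll_data_def)
  qed
  have indep: "vec.independent (b ` I)"
    using card_image_le[OF \<open>finite I\<close>, of b] \<open>finite I\<close> span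
    by (intro vec.card_le_dim_spanning[of _ UNIV]) (auto simp: vec_dim_card card_cart_basis card_I)
  have "card (b ` I) = card I"
    using vec.basis_card_eq_dim[of "b ` I" UNIV] indep span by (simp add: vec_dim_card card_cart_basis card_I)
  then have inj: "inj_on b I" by (rule eq_card_imp_inj_on[OF \<open>finite I\<close>])
  define comb where "comb z = (\<Sum>i<?n. \<Sum>j\<le>a ! i. z i j *s c i j)" for z :: "nat \<Rightarrow> nat \<Rightarrow> 'k"
  have comb_I: "comb z = (\<Sum>x\<in>I. (case x of (i, j) \<Rightarrow> z i j) *s b x)" for z
    unfolding comb_def I_def by (subst sum.Sigma) (auto simp: b_def intro!: sum.cong)
  have comb_ex: "\<exists>z. u = comb z" for u
  proof -
    have "u \<in> vec.span (b ` I)" by (simp add: span)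
    then obtain r where r: "u = (\<Sum>x\<in>I. r x *s b x)"
      unfolding in_span_image_iff[OF \<open>finite I\<close>] by blast
    have "u = comb (\<lambda>i j. r (i, j))"
      unfolding comb_I r by (intro sum.cong) auto
    then show ?thesis by (intro exI[of _ "\<lambda>i j. r (i, j)"])
  qed
  have comb_zero: "z i j = 0" if z: "comb z = 0" and ij: "i < ?n" "j \<le> a ! i" for z i j
  proof -
    let ?z = "\<lambda>x. case x of (i, j) \<Rightarrow> z i j"
    have "(\<Sum>y\<in>b ` I. ?z (the_inv_into I b y) *s y) = 0"
      using z unfolding comb_I by (subst sum.reindex[OF inj]) (simp add: the_inv_into_f_f[OF inj])
    note zero = vec.independentD[OF indep finite_imageI[OF \<open>finite I\<close>] subset_refl this, of "b (i, j)"]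
    have "(i, j) \<in> I" using ij by (simp add: I_def)
    then show ?thesis using zero by (simp add: the_inv_into_f_f[OF inj])
  qed
  define shift where "shift w = (\<Sum>i<?n. \<Sum>j<a ! i. w i j *s c i j)" for w :: "nat \<Rightarrow> nat \<Rightarrow> 'k"
  have shift_zero: "w i j = 0" if w: "shift w = 0" and ij: "i < ?n" "j < a ! i" for w i j
  proof -
    have "comb (\<lambda>i j. if j < a ! i then w i j else 0) = shift w"
      unfolding comb_def shift_def
      by (intro sum.cong refl sum.mono_neutral_cong_right) auto
    then have "comb (\<lambda>i j. if j < a ! i then w i j else 0) = 0" using w by simp
    from comb_zero[OF this ij(1), of j] ij(2) show ?thesis by simp
  qed
  \<comment> \<open>linear extension from the basis \<open>c\<close>\<close>
  have extend: "\<exists>M :: 'k ^ 'v ^ 'v. \<forall>i<?n. \<forall>j\<le>a ! i. M *v c i j = F i j" for F :: "nat \<Rightarrow> nat \<Rightarrow> 'k ^ 'v"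
  proof -
    obtain L where L: "Vector_Spaces.linear (*s) (*s) L"
      "\<And>y. y \<in> b ` I \<Longrightarrow> L y = (case the_inv_into I b y of (i, j) \<Rightarrow> F i j)"
      using vec.linear_independent_extend[OF indep, of "\<lambda>y. case the_inv_into I b y of (i, j) \<Rightarrow> F i j"]
      by blast
    have "matrix L *v c i j = F i j" if "i < ?n" "j \<le> a ! i" for i j
    proof -
      have "(i, j) \<in> I" using that by (simp add: I_def)
      then show ?thesis
        using L(2)[OF imageI, of "(i, j)"] the_inv_into_f_f[OF inj, of "(i, j)"]
        by (simp add: matrix_works[OF L(1)] b_def)
    qed
    then show ?thesis by blast
  qed
  obtain A :: "'k ^ 'v ^ 'v" where A: "\<forall>i<?n. \<forall>j\<le>a ! i. A *v c i j = (if j < a ! i then c i j else 0)"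
    using extend[of "\<lambda>i j. if j < a ! i then c i j else 0"] by blast
  obtain B :: "'k ^ 'v ^ 'v" where B: "\<forall>i<?n. \<forall>j\<le>a ! i. B *v c i j = (if j = 0 then 0 else c i (j - 1))"
    using extend[of "\<lambda>i j. if j = 0 then 0 else c i (j - 1)"] by blast
  have A_comb: "A *v comb z = shift z" for z
  proof -
    have "A *v comb z = (\<Sum>i<?n. \<Sum>j\<le>a ! i. z i j *s (if j < a ! i then c i j else 0))"
      unfolding comb_def vec.sum vec.scale using A by (intro sum.cong refl) auto
    also have "\<dots> = shift z"
      unfolding shift_def by (intro sum.cong refl sum.mono_neutral_cong_right) auto
    finally show ?thesis .
  qed
  have B_comb: "B *v comb z = shift (\<lambda>i j. z i (Suc j))" for z
  proof -
    have "B *v comb z = (\<Sum>i<?n. \<Sum>j\<le>a ! i. z i j *s (if j = 0 then 0 else c i (j - 1)))"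
      unfolding comb_def vec.sum vec.scale using B by (intro sum.cong refl) auto
    also have "\<dots> = shift (\<lambda>i j. z i (Suc j))"
      unfolding shift_def by (rule sum.cong[OF refl]) (simp add: sum.atMost_shift)
    finally show ?thesis .
  qed
  have pencil: "t *s (A *v comb z) = s *s (B *v comb z) \<longleftrightarrow> (\<forall>i<?n. \<forall>j<a ! i. t * z i j = s * z i (Suc j))"
    (is "?L \<longleftrightarrow> ?R") for s t z
  proof -
    have "t *s (A *v comb z) - s *s (B *v comb z) = shift (\<lambda>i j. t * z i j - s * z i (Suc j))"
      unfolding A_comb B_comb
      by (simp add: shift_def vec.scale_sum_right sum_subtractf[symmetric] vec.scale_left_diff_distrib)
    then have "?L \<longleftrightarrow> shift (\<lambda>i j. t * z i j - s * z i (Suc j)) = 0" by (metis eq_iff_diff_eq_0)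
    also have "\<dots> \<longleftrightarrow> ?R"
    proof
      assume "shift (\<lambda>i j. t * z i j - s * z i (Suc j)) = 0"
      from shift_zero[OF this] show ?R by simp
    qed (simp add: shift_def)
    finally show ?thesis .
  qed
  have ruling: "u \<in> ruling ?n \<phi> (s, t) \<longleftrightarrow> (\<exists>r. u = comb (\<lambda>i j. r i * (s ^ (a ! i - j) * t ^ j)))" for u s t
  proof -
    have "(\<Sum>i<?n. r i *s \<phi> i (s, t)) = comb (\<lambda>i j. r i * (s ^ (a ! i - j) * t ^ j))" for r
      unfolding comb_def by (intro sum.cong refl) (simp add: \<phi> P1_map_def vec.scale_sum_right)
    then show ?thesis by (simp add: ruling_def in_span_image_iff)
  qed
  have "scroll_pencil ?n \<phi> A B"
  proof
    fix s t :: 'k and u :: "'k ^ 'v"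
    assume st: "(s, t) \<noteq> (0, 0)"
    show "u \<in> ruling ?n \<phi> (s, t) \<longleftrightarrow> t *s (A *v u) = s *s (B *v u)"
    proof
      assume "u \<in> ruling ?n \<phi> (s, t)"
      then obtain r where u: "u = comb (\<lambda>i j. r i * (s ^ (a ! i - j) * t ^ j))" using ruling by blast
      have "s ^ (a ! i - j) = s * s ^ (a ! i - Suc j)" if "j < a ! i" for i j
        using that by (metis Suc_diff_Suc power_Suc)
      then show "t *s (A *v u) = s *s (B *v u)" unfolding u pencil by (simp add: ac_simps)
    next
      assume eq: "t *s (A *v u) = s *s (B *v u)"
      obtain z where u: "u = comb z" using comb_ex by blast
      then have z: "t * z i j = s * z i (Suc j)" if "i < ?n" "j < a ! i" for i j
        using eq that unfolding u pencil by blast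
      have "\<exists>r. \<forall>i<?n. \<forall>j\<le>a ! i. z i j = r i * (s ^ (a ! i - j) * t ^ j)"
      proof (cases "s = 0")
        case True
        then have t: "t \<noteq> 0" using st by simp
        show ?thesis
        proof (intro exI allI impI)
          fix i j assume "i < ?n" "j \<le> a ! i"
          then show "z i j = z i (a ! i) / t ^ (a ! i) * (s ^ (a ! i - j) * t ^ j)"
            using z[of i j] t True by (cases "j = a ! i") auto
        qed
      next
        case False
        show ?thesis
        proof (intro exI allI impI)
          fix i j assume i: "i < ?n" and "j \<le> a ! i"
          from this(2) show "z i j = z i 0 / s ^ (a ! i) * (s ^ (a ! i - j) * t ^ j)"
          proof (induction j)
            case 0
            show ?case using False by simp
          next
            case (Suc j)
            then have "s ^ (a ! i - j) = s * s ^ (a ! i - Suc j)" by (metis Suc_diff_Suc Suc_le_lessD power_Suc)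
            moreover have "s * z i (Suc j) = t * z i j" using z[OF i, of j] Suc by simp
            ultimately have "s * z i (Suc j) = s * (z i 0 / s ^ (a ! i) * (s ^ (a ! i - Suc j) * t ^ Suc j))"
              using Suc by (simp add: ac_simps)
            then show ?case by (rule mult_left_cancel[OF False, THEN iffD1])
          qed
        qed
      qed
      then obtain r where r: "\<And>i j. i < ?n \<Longrightarrow> j \<le> a ! i \<Longrightarrow> z i j = r i * (s ^ (a ! i - j) * t ^ j)" by blast
      have "u = comb (\<lambda>i j. r i * (s ^ (a ! i - j) * t ^ j))"
        unfolding u comb_def by (intro sum.cong refl) (simp add: r)
      then show "u \<in> ruling ?n \<phi> (s, t)" unfolding ruling by blast
    qed
  next
    fix u :: "'k ^ 'v"
    assume A0: "A *v u = 0" and B0: "B *v u = 0"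
    obtain z where u: "u = comb z" using comb_ex by blast
    have z0: "z i j = 0" "z i (Suc j) = 0" if "i < ?n" "j < a ! i" for i j
      using shift_zero[OF A0[unfolded u A_comb] that] shift_zero[OF B0[unfolded u B_comb] that] by simp_all
    have "z i j = 0" if "i < ?n" "j \<le> a ! i" for i j
      using that z0[of i j] z0[of i "j - 1"] a_pos[of i] by (cases j) auto
    then show "u = 0" by (simp add: u comb_def)
  qed (use \<phi> in blast)
  then show thesis by (rule that)
qed

section \<open>The classification of secant loci of smooth scrolls\<close>

theorem theorem3p2:
  fixes a :: "nat list"
    and \<Lambda> :: "nat \<Rightarrow> ('k::alg_closed_field ^ 'v::finite) set"
    and \<phi> :: "nat \<Rightarrow> 'k \<times> 'k \<Rightarrow> 'k ^ 'v"
    and X :: "('k ^ 'v) set"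
    and p :: "'k ^ 'v"
  assumes "scroll_data a \<Lambda> \<phi>"
    and "X = scroll (length a) \<phi>"
    and "length a + 2 \<le> CARD('v) - 1"
    and "p \<in> secant_variety X - X"
  shows
    "(linear_subspace 1 (secant_cone X p) \<and>
      vanishing_ideal (secant_cone X p) \<subseteq> secant_locus X p \<and>
      (double_point (secant_locus X p) \<or> two_simple_points (secant_locus X p)))
     \<or>
     (linear_subspace 2 (secant_cone X p) \<and>
      vanishing_ideal (secant_cone X p) \<subseteq> secant_locus X p \<and>
      (smooth_quadric_in (secant_cone X p) (secant_locus X p) \<or>
       (\<exists>L L' x. linear_subspace 1 L \<and> x \<noteq> (0, 0) \<and> L \<subseteq> ruling (length a) \<phi> x \<and>
          line_section (length a) \<phi> L' \<and>
          secant_locus X p = vanishing_ideal L \<inter> vanishing_ideal L')))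
     \<or>
     (linear_subspace 3 (secant_cone X p) \<and>
      vanishing_ideal (secant_cone X p) \<subseteq> secant_locus X p \<and>
      smooth_quadric_in (secant_cone X p) (secant_locus X p))"
proof -
  obtain A B where "scroll_pencil (length a) \<phi> A B"
    using scroll_pencil_exists[OF assms(1)] .
  then interpret scroll_pencil "length a" \<phi> A B .
  from assms(2,4) have p: "p \<in> secant_variety (scroll (length a) \<phi>)" "p \<notin> scroll (length a) \<phi>" by auto
  obtain g h where "scroll_point (length a) \<phi> A B p g h"
    using scroll_point_exists[OF p(2)] .
  then interpret scroll_point "length a" \<phi> A B p g h .
  show ?thesis
    unfolding assms(2) by (rule secant_locus_classification[OF secant_point_U[OF p(1)]])
qed

end
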